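(* Fix integers $n,m\ge1$, $k_1,k_2\ge0$ and $C>1$. If $\delta\to0^+$ while $1/C\le\kappa\le C$, then \[p_{1,k_1,k_2}(x,t)=\frac{(-1)^{k_2}\pi^{k_1+k_2}}{4^n(\pi\delta)^{n+k_1-\frac{m+1}2}\kappa^{\frac{m-1}2}}e^{-\frac14d(x,t)^2}e^{-\kappa}I_{n+k_1-1}(\kappa)\big[1+O(\delta)\big].\] When $\kappa\to0^+$ and $|t|\to+\infty$, \[p_{1,k_1,k_2}(x,t)=\frac{(-1)^{k_2}\pi^{k_1+k_2}}{2^{2n+\frac{m-1}2}(n+k_1-1)!}|t|^{n+k_1-1-\frac{m-1}2}e^{-\frac14d(x,t)^2}\Big[1+O\Big(\kappa+\frac1{|t|}\Big)\Big].\]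
   Context: For $(x,t)\in\mathbb{R}^{2n}\times\mathbb{R}^m$, $u_1$ the first standard basis vector of $\mathbb{R}^m$, \[p_{1,k_1,k_2}(x,t)=\frac{(-1)^{k_1}i^{k_2}}{(4\pi)^n(2\pi)^m}\int_{\mathbb{R}^m}e^{i|t|(\lambda,u_1)-\frac{|x|^2}{4}|\lambda|\coth|\lambda|}\frac{|\lambda|^{n+k_1}\cosh(|\lambda|)^{k_1}}{\sinh(|\lambda|)^{n+k_1}}(\lambda,u_1)^{k_2}\,d\lambda .\] $R=|x|^2/4$, $\omega=|t|/R$, $\delta=\sqrt{R/(\pi|t|)}$, $\kappa=2\sqrt{\pi|t|R}$. $\theta(\lambda)=\frac{2\lambda-\sin(2\lambda)}{2\sin^2\lambda}$ ($\theta(0)=0$) is a diffeomorphism $(-\pi,\pi)\to\mathbb{R}$, $y_\omega=\theta^{-1}(\omega)$; $d(x,t)=|x|y_\omega/\sin(y_\omega)$ if $x\ne0,t\ne0$, $d(x,0)=|x|$, $d(0,t)=\sqrt{4\pi|t|}$. $I_\nu$ is the modified Bessel function of integer order $\nu$, $I_\nu(\zeta)=\sum_{k\ge0}\frac{\zeta^{2k+\nu}}{2^{2k+\nu}k!\,\Gamma(k+\nu+1)}$. *)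

theory Defs
  imports "HOL-Analysis.Analysis"
begin

text \<open>x ranges over real^'a with CARD('a) = 2n, t over real^'m with m = CARD('m).
  The index type of R^m is well-ordered so that u_1 is the first standard basis vector.\<close>

definition first_basis :: "real^'m::{finite,wellorder}" where
  "first_basis = axis (LEAST i. True) 1"

definition theta :: "real \<Rightarrow> real" where
  "theta l = (if l = 0 then 0 else (2*l - sin (2*l)) / (2 * (sin l)^2))"

definition y_om :: "real \<Rightarrow> real" where
  "y_om w = (THE y. - pi < y \<and> y < pi \<and> theta y = w)"

definition Rpar :: "real^'a \<Rightarrow> real" where
  "Rpar x = norm x ^ 2 / 4"

definition omega :: "real^'a \<Rightarrow> real^'m \<Rightarrow> real" where
  "omega x t = norm t / Rpar x"

definition delta :: "real^'a \<Rightarrow> real^'m \<Rightarrow> real" where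
  "delta x t = sqrt (Rpar x / (pi * norm t))"

definition kappa :: "real^'a \<Rightarrow> real^'m \<Rightarrow> real" where
  "kappa x t = 2 * sqrt (pi * norm t * Rpar x)"

definition dd :: "real^'a \<Rightarrow> real^'m \<Rightarrow> real" where
  "dd x t = (if x = 0 then sqrt (4 * pi * norm t)
             else if t = 0 then norm x
             else norm x * y_om (omega x t) / sin (y_om (omega x t)))"

definition besselI :: "nat \<Rightarrow> real \<Rightarrow> real" where
  "besselI \<nu> z = (\<Sum>k. z ^ (2*k+\<nu>) / (2 ^ (2*k+\<nu>) * fact k * Gamma (real (k+\<nu>+1))))"

definition pker :: "nat \<Rightarrow> nat \<Rightarrow> nat \<Rightarrow> real^'a \<Rightarrow> real^'m::{finite,wellorder} \<Rightarrow> complex" where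
  "pker n k1 k2 x (t::real^'m::{finite,wellorder}) =
     ((-1) ^ k1 * \<i> ^ k2 / ((4 * of_real pi) ^ n * (2 * of_real pi) ^ CARD('m))) *
     (LINT (l::real^'m::{finite,wellorder})|lborel.
        exp (\<i> * of_real (norm t * inner l first_basis)
             - of_real (norm x ^ 2 / 4 * norm l * (cosh (norm l) / sinh (norm l)))) *
        of_real (norm l ^ (n+k1) * cosh (norm l) ^ k1 / sinh (norm l) ^ (n+k1)
                 * (inner l first_basis) ^ k2))"

end

theory Submission
  imports Defs "HOL-Complex_Analysis.Residue_Theorem" "HOL-Probability.Sinc_Integral" "HOL-Real_Asymp.Real_Asymp"
begin

text \<open>
  Let \<open>u\<close> be the first basis vector, write \<open>\<lambda> = v u + \<lambda>'\<close> with \<open>q = |\<lambda>'|^2\<close>, and use Fubini: the kernel is the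
  integral over \<open>\<lambda>'\<close> of a line integral in \<open>v\<close> whose integrand is meromorphic up to essential singularities at
  \<open>v^2 + q = - (pi j)^2\<close>. The line is shifted to \<open>Im v = sqrt ((3 pi/2)^2 + q)\<close>, which crosses exactly one
  singularity for every \<open>q\<close>, namely \<open>v = i a\<close> with \<open>a = sqrt (pi^2 + q)\<close>, and leaves an exponentially smaller
  integral. With \<open>t\<close> for the norm of the central variable, the residue is computed on the circle
  \<open>v = i (a - pi u / (a t))\<close>, \<open>|u| = 1\<close>. On it the integrand is, after extracting \<open>exp (- t a)\<close> and a power of \<open>t\<close>,
  within \<open>O (1/t + q)\<close> of a constant times \<open>exp (u + \<kappa>^2 / (4 u)) u^(-(n + k1))\<close>, uniformly for bounded \<open>\<kappa>\<close>, and
  the loop integral of the latter is a Bessel series. Laplace's method in \<open>\<lambda>'\<close>, with phase \<open>a - pi \<approx> q / (2 pi)\<close>, and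
  \<open>d^2/4 = pi t - \<kappa> + O (1/t)\<close> give one estimate with relative error \<open>O (1/t)\<close> for all bounded \<open>\<kappa>\<close>; both
  regimes of the theorem are special cases of it.
\<close>

subsection \<open>Entire functions of the squared variable\<close>

text \<open>In the variable \<open>z = v^2 + q\<close> the square root hidden in the norm of
  \<open>\<lambda>\<close> disappears: \<open>cosh w\<close> and \<open>sinh w / w\<close> are even,
  hence entire in \<open>z = w^2\<close>, and no branch cut meets the contour. The singularities in
  \<open>v\<close>, at \<open>i sqrt ((pi j)^2 + q)\<close> and their negatives, move away from the
  real axis as \<open>q\<close> grows, so no fixed height separates the first from the second for
  every \<open>q\<close>. The chosen height belongs at \<open>Re v = 0\<close> to
  \<open>w = 3 pi i / 2\<close>, midway between \<open>pi i\<close> and \<open>2 pi i\<close>. The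
  first singularity is essential, so its residue involves infinitely many derivatives and is
  compared on a circle instead. Near it the exponent has a singular part of size \<open>R\<close>
  over the displacement of \<open>z\<close>, and \<open>i t v\<close> varies by \<open>t\<close>
  times the displacement of \<open>v\<close>; at displacements of order \<open>1/t\<close> both stay
  bounded when \<open>t R\<close>, that is \<open>\<kappa>^2\<close>, is bounded. This fixes the
  scale of the circle. An error \<open>q\<close> costs no more than \<open>1/t\<close>, because
  Laplace's method concentrates at \<open>q\<close> of order \<open>1/t\<close>. Finally
  \<open>\<kappa> = 2 pi t \<delta>\<close>, so \<open>1/t\<close> is \<open>O(\<delta>)\<close> as
  soon as \<open>\<kappa>\<close> is bounded below.\<close>

definition sinhc_sqrt :: "complex \<Rightarrow> complex" where
  "sinhc_sqrt z = (\<Sum>k. z ^ k / fact (2 * k + 1))"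

definition cosh_sqrt :: "complex \<Rightarrow> complex" where
  "cosh_sqrt z = (\<Sum>k. z ^ k / fact (2 * k))"

lemma sums_cosh_square: "(\<lambda>k. (w\<^sup>2) ^ k / fact (2 * k)) sums cosh (w :: complex)"
proof -
  have "(\<lambda>k. if even (2*k) then w ^ (2*k) /\<^sub>R fact (2*k) else 0) sums cosh w"
    using cosh_converges[of w]
    by (subst sums_mono_reindex[of "\<lambda>k::nat. 2*k"]) (auto simp: strict_mono_def elim!: evenE)
  thus ?thesis
    by (simp add: scaleR_conv_of_real power_mult divide_inverse mult.commute[of "inverse _"])
qed

lemma sums_sinh_square: "(\<lambda>k. w * ((w\<^sup>2) ^ k / fact (2 * k + 1))) sums sinh (w :: complex)"
proof -
  have "(\<lambda>k. if even (2*k+1) then 0 else w ^ (2*k+1) /\<^sub>R fact (2*k+1)) sums sinh w"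
    using sinh_converges[of w]
    by (subst sums_mono_reindex[of "\<lambda>k::nat. 2*k+1"]) (auto simp: strict_mono_def elim!: oddE)
  thus ?thesis
    by (simp add: scaleR_conv_of_real power_mult power_Suc divide_inverse mult.commute[of "inverse _"] mult.assoc del: fact_Suc)
qed

lemma sums_cosh_sqrt: "(\<lambda>k. z ^ k / fact (2 * k)) sums cosh_sqrt z"
  using sums_cosh_square[of "csqrt z"] unfolding cosh_sqrt_def
  by (simp add: sums_iff)

lemma cosh_sqrt_square: "cosh_sqrt (w\<^sup>2) = cosh w"
  using sums_cosh_square[of w] sums_cosh_sqrt[of "w\<^sup>2"] by (rule sums_unique2[symmetric])

lemma sums_sinhc_sqrt: "(\<lambda>k. z ^ k / fact (2 * k + 1)) sums sinhc_sqrt z"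
proof (cases "z = 0")
  case True
  show ?thesis
    using powser_sums_zero[of "\<lambda>k. 1 / fact (2 * k + 1) :: complex"] True
    unfolding sinhc_sqrt_def by (simp add: sums_iff del: fact_Suc)
next
  case False
  have "(\<lambda>k. csqrt z * (z ^ k / fact (2 * k + 1))) sums sinh (csqrt z)"
    using sums_sinh_square[of "csqrt z"] by simp
  from sums_divide[OF this, of "csqrt z"] False
  have "(\<lambda>k. z ^ k / fact (2 * k + 1)) sums (sinh (csqrt z) / csqrt z)"
    by (simp del: fact_Suc)
  thus ?thesis unfolding sinhc_sqrt_def by (simp add: sums_iff)
qed

lemma sinhc_sqrt_square: "w * sinhc_sqrt (w\<^sup>2) = sinh w"
  using sums_sinh_square[of w] sums_mult[OF sums_sinhc_sqrt[of "w\<^sup>2"], of w]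
  by (rule sums_unique2[symmetric])

lemma sinhc_sqrt_0: "sinhc_sqrt 0 = 1"
  using sums_unique2[OF sums_sinhc_sqrt[of 0], of 1] powser_sums_zero[of "\<lambda>k. 1 / fact (2*k+1) :: complex"]
  by (simp add: field_simps)

lemma everywhere_sums_imp_holomorphic:
  assumes "\<And>z. (\<lambda>k. a k * z ^ k) sums f z"
  shows "f holomorphic_on UNIV"
proof -
  have *: "f holomorphic_on ball 0 r" for r
    using assms by (intro power_series_holomorphic[where a = a]) simp
  have "f field_differentiable at z" for z
    using *[of "norm z + 1"] by (auto simp: holomorphic_on_open field_differentiable_def dest!: bspec[of _ _ z])
  thus ?thesis by (simp add: holomorphic_on_def)
qed

lemma holomorphic_cosh_sqrt [holomorphic_intros]:
  "f holomorphic_on A \<Longrightarrow> (\<lambda>z. cosh_sqrt (f z)) holomorphic_on A"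
  using sums_cosh_sqrt
  by (intro holomorphic_on_compose_gen[of f A cosh_sqrt UNIV, unfolded o_def]
      everywhere_sums_imp_holomorphic[where a = "\<lambda>k. 1 / fact (2*k)"]) auto

lemma holomorphic_sinhc_sqrt [holomorphic_intros]:
  "f holomorphic_on A \<Longrightarrow> (\<lambda>z. sinhc_sqrt (f z)) holomorphic_on A"
  using sums_sinhc_sqrt
  by (intro holomorphic_on_compose_gen[of f A sinhc_sqrt UNIV, unfolded o_def]
      everywhere_sums_imp_holomorphic[where a = "\<lambda>k. 1 / fact (2*k+1)"]) auto

lemma Re_sinh: "Re (sinh z) = sinh (Re z) * cos (Im z)"
  and Im_sinh: "Im (sinh z) = cosh (Re z) * sin (Im z)"
  by (simp_all add: sinh_field_def cosh_field_def Re_exp Im_exp field_simps)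

text \<open>With \<open>w\<close> a square root of \<open>z\<close>, a zero forces
  \<open>exp (2 w) = 1\<close>, so \<open>w\<close> is an integer multiple of \<open>i pi\<close>.
  The value \<open>1\<close> at \<open>z = 0\<close> removes the multiple zero, and squaring forgets
  the sign, so positive integers index the zeros.\<close>

lemma sinhc_sqrt_eq_0_iff:
  "sinhc_sqrt z = 0 \<longleftrightarrow> (\<exists>j::nat. j \<ge> 1 \<and> z = - of_real ((pi * real j)\<^sup>2))"
proof
  assume 0: "sinhc_sqrt z = 0"
  hence "z \<noteq> 0" using sinhc_sqrt_0 by auto
  define w where "w = csqrt z"
  have w: "w\<^sup>2 = z" "w \<noteq> 0" using \<open>z \<noteq> 0\<close> by (auto simp: w_def)
  have "sinh w = 0" using sinhc_sqrt_square[of w] w 0 by simp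
  hence "exp (w + w) = 1" unfolding exp_add by (auto simp: sinh_zero_iff)
  then obtain n :: int where "Re w = 0" "Im w = of_int n * pi"
    by (auto simp: exp_eq_1)
  hence "\<i> * w = of_real (- (of_int n * pi))"
    by (simp add: complex_eq_iff)
  hence "(\<i> * w)\<^sup>2 = of_real ((of_int n * pi)\<^sup>2)" "n \<noteq> 0" using w by (auto simp del: mult_minus_left)
  hence "z = - of_real ((pi * real (nat \<bar>n\<bar>))\<^sup>2)" "nat \<bar>n\<bar> \<ge> 1"
    using w by (auto simp: power_mult_distrib mult.commute neg_eq_iff_add_eq_0 add_eq_0_iff
        simp flip: of_int_power of_int_abs)
  thus "\<exists>j::nat. j \<ge> 1 \<and> z = - of_real ((pi * real j)\<^sup>2)" by blast
next
  assume "\<exists>j::nat. j \<ge> 1 \<and> z = - of_real ((pi * real j)\<^sup>2)"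
  then obtain j :: nat where j: "j \<ge> 1" "z = (\<i> * of_real (pi * real j))\<^sup>2"
    by (auto simp: power_mult_distrib)
  have "sinh (\<i> * of_real (pi * real j)) = 0"
    by (simp add: complex_eq_iff Re_sinh Im_sinh)
  with sinhc_sqrt_square[of "\<i> * of_real (pi * real j)"] j show "sinhc_sqrt z = 0"
    by simp
qed

subsection \<open>Bounds for the radial symbol\<close>

text \<open>\<open>1 + s \<le> exp s\<close> at \<open>s = c x / (K + 1)\<close>, raised to the
  power \<open>K\<close>, stays below \<open>exp (c x)\<close>; the factor \<open>M\<close> absorbs
  the change of slope. Dividing by \<open>K + 1\<close> instead of \<open>K\<close> also covers
  \<open>K = 0\<close>.\<close>

lemma poly_le_exp:
  fixes c :: real assumes "c > 0"
  shows "\<exists>C>0. \<forall>x\<ge>0. (1 + x) ^ K \<le> C * exp (c * x)"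
proof -
  define M where "M = max 1 (real (Suc K) / c)"
  have M: "M \<ge> 1" "M * c \<ge> real (Suc K)"
    using assms by (auto simp: M_def field_simps max_def)
  have "(1 + x) ^ K \<le> M ^ K * exp (c * x)" if "x \<ge> 0" for x
  proof -
    have "x \<le> M * c * x / real (Suc K)"
      using M that by (simp add: divide_simps mult_mono mult.commute)
    hence "1 + x \<le> M * (1 + c * x / real (Suc K))"
      using M by (simp add: algebra_simps)
    also have "\<dots> \<le> M * exp (c * x / real (Suc K))"
      using M by (intro mult_left_mono exp_ge_add_one_self) auto
    finally have "(1 + x) ^ K \<le> (M * exp (c * x / real (Suc K))) ^ K"
      using that by (intro power_mono) auto
    also have "\<dots> = M ^ K * exp (real K * (c * x / real (Suc K)))"
      by (simp only: power_mult_distrib exp_of_nat_mult)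
    also have "\<dots> \<le> M ^ K * exp (c * x)"
      using M assms that by (intro mult_left_mono) (auto simp: field_simps)
    finally show ?thesis .
  qed
  thus ?thesis using M by (intro exI[of _ "M ^ K"]) auto
qed

text \<open>For \<open>v = x + i y\<close> the square of the right side is
  \<open>(|z| + Re z) / 2\<close>, and \<open>|z|^2\<close> exceeds \<open>(x^2 + y^2 - q)^2\<close>
  by \<open>4 x^2 q\<close>. Exponential decay in \<open>Re w\<close> thereby becomes decay in
  \<open>Re v\<close> that is uniform in \<open>q\<close>.\<close>

lemma Re_csqrt_ge:
  assumes "q \<ge> 0"
  shows "\<bar>Re v\<bar> \<le> Re (csqrt (v\<^sup>2 + of_real q))"
proof -
  define x y where "x = Re v" and "y = Im v"
  define z where "z = v\<^sup>2 + of_real q"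
  have z: "Re z = x\<^sup>2 - y\<^sup>2 + q" "Im z = 2 * x * y"
    by (simp_all add: z_def x_def y_def power2_eq_square)
  have "(x\<^sup>2 + y\<^sup>2 - q)\<^sup>2 \<le> (Re z)\<^sup>2 + (Im z)\<^sup>2"
  proof -
    have "(Re z)\<^sup>2 + (Im z)\<^sup>2 - (x\<^sup>2 + y\<^sup>2 - q)\<^sup>2 = 4 * x\<^sup>2 * q"
      by (simp add: z power2_eq_square algebra_simps)
    moreover have "4 * x\<^sup>2 * q \<ge> 0" using assms by simp
    ultimately show ?thesis by linarith
  qed
  hence "x\<^sup>2 + y\<^sup>2 - q \<le> cmod z"
    unfolding cmod_def by (rule real_le_rsqrt)
  hence "x\<^sup>2 \<le> (cmod z + Re z) / 2" by (simp add: z)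
  hence "\<bar>x\<bar> \<le> sqrt ((cmod z + Re z) / 2)"
    by (simp add: real_le_rsqrt)
  thus ?thesis by (simp add: z_def x_def)
qed

lemma Re_square_eq: "Re (w\<^sup>2) = (Re w)\<^sup>2 - (Im w)\<^sup>2"
  by (simp add: power2_eq_square)

lemma cmod_cosh_le: "Re w \<ge> 0 \<Longrightarrow> cmod (cosh w) \<le> exp (Re w)"
proof -
  assume "Re w \<ge> 0"
  have "cmod (cosh w) \<le> (exp (Re w) + exp (- Re w)) / 2"
    using norm_triangle_ineq[of "exp w" "exp (-w)"]
    by (simp add: cosh_field_def norm_divide)
  also have "exp (- Re w) \<le> exp (Re w)" using \<open>Re w \<ge> 0\<close> by simp
  finally show ?thesis by simp
qed

text \<open>One of two sources of the same lower bound: here \<open>w\<close> is far enough to the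
  right, in the companion lemma \<open>Im w\<close> is away from the zeros of \<open>sin\<close>.
  The constant \<open>6\<close> is a crude one that serves both.\<close>

lemma cmod_sinh_ge_of_Re:
  assumes "Re w \<ge> 1" shows "cmod (sinh w) \<ge> exp (Re w) / 6"
proof -
  have "exp (Re w) \<ge> 2" using exp_ge_add_one_self[of "Re w"] assms by linarith
  moreover have "exp (- Re w) \<le> 1" using assms by simp
  moreover have "cmod (sinh w) \<ge> (exp (Re w) - exp (- Re w)) / 2"
    using norm_triangle_ineq2[of "exp w" "exp (-w)"]
    by (simp add: sinh_field_def norm_divide)
  moreover have "E / 6 \<le> s" if "2 \<le> E" "e \<le> 1" "(E - e) / 2 \<le> s" for E e s :: real
    using that by (simp add: field_simps)
  ultimately show ?thesis by blast
qed

lemma cmod_sinh_ge_of_Im: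
  assumes "\<bar>sin (Im w)\<bar> \<ge> 1 / 2" shows "cmod (sinh w) \<ge> exp (Re w) / 6"
proof -
  have "exp (Re w) / 6 \<le> cosh (Re w) * (1/2)"
    by (simp add: cosh_field_def add_increasing2)
  also have "\<dots> \<le> cosh (Re w) * \<bar>sin (Im w)\<bar>"
    using assms by (intro mult_left_mono) (auto simp: cosh_real_nonneg)
  also have "\<dots> = \<bar>Im (sinh w)\<bar>" by (simp add: Im_sinh abs_mult)
  also have "\<dots> \<le> cmod (sinh w)" by (rule abs_Im_le_cmod)
  finally show ?thesis .
qed

text \<open>\<open>w coth w = w + w exp (- w) / sinh w\<close>, and the lower bound on
  \<open>sinh\<close> makes the second summand exponentially small.\<close>

lemma Re_mult_coth_ge:
  assumes "cmod (sinh w) \<ge> exp (Re w) / 6"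
  shows "Re (w * cosh w / sinh w) \<ge> Re w - 6 * cmod w * exp (- 2 * Re w)"
proof -
  have pos: "cmod (sinh w) > 0" using assms exp_gt_zero[of "Re w"] by linarith
  hence "sinh w \<noteq> 0" by auto
  have "cosh w = sinh w + exp (-w)" by (simp add: cosh_field_def sinh_field_def field_simps)
  hence "w * cosh w / sinh w = w + w * exp (-w) / sinh w"
    using \<open>sinh w \<noteq> 0\<close> by (simp add: field_simps)
  moreover have "cmod (w * exp (-w) / sinh w) \<le> 6 * cmod w * exp (- 2 * Re w)"
  proof -
    have "cmod (w * exp (-w) / sinh w) = cmod w * exp (- Re w) / cmod (sinh w)"
      by (simp add: norm_mult norm_divide)
    also have "\<dots> \<le> cmod w * exp (- Re w) / (exp (Re w) / 6)"
      using assms by (intro divide_left_mono) (auto intro!: mult_pos_pos pos)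
    also have "\<dots> = 6 * cmod w * exp (- 2 * Re w)"
      by (simp add: exp_minus field_simps flip: exp_add)
    finally show ?thesis .
  qed
  moreover have "Re (w * exp (-w) / sinh w) \<ge> - cmod (w * exp (-w) / sinh w)"
    using abs_Re_le_cmod abs_le_D2 by (metis minus_le_iff)
  ultimately show ?thesis by simp
qed

text \<open>The radial factor of the kernel, continued to complex values \<open>z\<close> of the
  squared norm; it is used with \<open>N = n + k1\<close>. Zeros of \<open>sinhc_sqrt\<close> in the
  exponent are what make its singularities essential for \<open>R > 0\<close>.\<close>

definition radial_symbol :: "real \<Rightarrow> nat \<Rightarrow> nat \<Rightarrow> complex \<Rightarrow> complex" where
  "radial_symbol R N k1 z =
     exp (- of_real R * (cosh_sqrt z / sinhc_sqrt z)) * cosh_sqrt z ^ k1 / sinhc_sqrt z ^ N"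

lemma radial_symbol_square:
  assumes "w \<noteq> 0"
  shows "radial_symbol R N k1 (w\<^sup>2) =
     exp (- of_real R * (w * cosh w / sinh w)) * cosh w ^ k1 * w ^ N / sinh w ^ N"
  using assms sinhc_sqrt_square[of w]
  by (simp add: radial_symbol_def cosh_sqrt_square power_mult_distrib flip: sinhc_sqrt_square)

text \<open>\<open>- 6 (2 + 3 pi / 2)\<close> is a lower bound for \<open>Re (w coth w)\<close> in
  the region of the shift, and \<open>6 ^ N\<close> comes from \<open>N\<close> uses of the lower
  bound for \<open>sinh\<close>.\<close>

definition shift_const :: "real \<Rightarrow> nat \<Rightarrow> real" where
  "shift_const R N = exp (6 * R * (2 + 3 * pi / 2)) * 6 ^ N"

text \<open>The growth of \<open>cosh w ^ k1\<close> cancels against \<open>k1\<close> of the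
  \<open>n + k1\<close> factors \<open>sinh w\<close>, which leaves \<open>exp (- n Re w)\<close>.
  The bound on \<open>Re z\<close> gives \<open>|Im w| \<le> Re w + 3 pi / 2\<close>, so
  \<open>|w| exp (- 2 Re w)\<close> is bounded and the exponential factor cannot become
  large.\<close>

lemma cmod_radial_symbol_le:
  assumes "R \<ge> 0" "z \<noteq> 0" and w: "w = csqrt z" and sinh: "cmod (sinh w) \<ge> exp (Re w) / 6"
    and Re: "Re z \<ge> - (3 * pi / 2)\<^sup>2"
  shows "cmod (radial_symbol R (n + k1) k1 z)
           \<le> shift_const R (n + k1) * cmod w ^ (n + k1) * exp (- real n * Re w)"
proof -
  define a where "a = Re w"
  have a: "a \<ge> 0" by (simp add: a_def w Re_csqrt del: csqrt.simps)
  have w2: "w\<^sup>2 = z" "w \<noteq> 0" using assms by auto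
  have "(Im w)\<^sup>2 \<le> a\<^sup>2 + (3 * pi / 2)\<^sup>2"
    using Re by (simp add: Re_square_eq a_def flip: w2)
  also have "\<dots> \<le> (a + 3 * pi / 2)\<^sup>2" using a by (simp add: power2_sum)
  finally have "\<bar>Im w\<bar> \<le> a + 3 * pi / 2"
    using a by (metis abs_le_square_iff abs_of_nonneg add_nonneg_nonneg pi_ge_zero divide_nonneg_pos mult_nonneg_nonneg zero_le_numeral zero_less_numeral)
  hence mod_w: "cmod w \<le> 2 * a + 3 * pi / 2"
    using cmod_le[of w] a by (simp add: a_def)
  have "cmod w * exp (- 2 * a) \<le> 2 + 3 * pi / 2"
  proof -
    have "a * exp (-2 * a) \<le> 1"
      using order.trans[OF _ exp_ge_add_one_self[of "2*a"], of a] a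
      by (simp add: exp_minus divide_simps)
    moreover have "3 * pi / 2 * exp (-2*a) \<le> 3 * pi / 2 * 1" using a by (intro mult_left_mono) auto
    moreover have "cmod w * exp (- 2 * a) \<le> (2 * a + 3 * pi / 2) * exp (- 2 * a)"
      using mod_w by (intro mult_right_mono) auto
    moreover have "x \<le> 2 + p" if "u \<le> 1" "v \<le> p * 1" "x \<le> 2 * u + v" for x u v p :: real
      using that by linarith
    ultimately show ?thesis by (simp only: distrib_right mult.assoc)
  qed
  hence "Re (w * cosh w / sinh w) \<ge> - 6 * (2 + 3 * pi / 2)"
    using Re_mult_coth_ge[OF sinh] a by (simp add: a_def)
  have Re_smult: "Re (- of_real R * c) = - (R * Re c)" for c by simp
  from \<open>Re (w * cosh w / sinh w) \<ge> - 6 * (2 + 3 * pi / 2)\<close>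
  have "R * (- 6 * (2 + 3 * pi / 2)) \<le> R * Re (w * cosh w / sinh w)"
    using \<open>R \<ge> 0\<close> by (rule mult_left_mono)
  hence "Re (- of_real R * (w * cosh w / sinh w)) \<le> 6 * R * (2 + 3 * pi / 2)"
    unfolding Re_smult by (simp add: algebra_simps)
  hence E: "cmod (exp (- of_real R * (w * cosh w / sinh w))) \<le> exp (6 * R * (2 + 3 * pi / 2))"
    by (simp only: norm_exp_eq_Re exp_le_cancel_iff)
  have "cmod (radial_symbol R (n + k1) k1 z)
      = cmod (exp (- of_real R * (w * cosh w / sinh w))) * (cmod (cosh w) ^ k1 * cmod w ^ (n + k1) / cmod (sinh w) ^ (n + k1))"
    unfolding w2(1)[symmetric] radial_symbol_square[OF w2(2)] by (simp add: norm_mult norm_divide norm_power)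
  also have "\<dots> \<le> exp (6 * R * (2 + 3 * pi / 2)) * (exp a ^ k1 * cmod w ^ (n + k1) / (exp a / 6) ^ (n + k1))"
  proof (intro mult_mono E frac_le power_mono)
    show "cmod (cosh w) \<le> exp a" using cmod_cosh_le[of w] a by (simp add: a_def)
    show "exp a / 6 \<le> cmod (sinh w)" using sinh by (simp add: a_def)
  qed auto
  also have "\<dots> = shift_const R (n + k1) * cmod w ^ (n + k1) * exp (- real n * a)"
    by (simp add: shift_const_def power_divide power_add exp_minus field_simps flip: exp_of_nat_mult)
  finally show ?thesis by (simp add: a_def)
qed

text \<open>For \<open>Re w \<le> 1\<close> the modulus of \<open>Im w\<close> stays in \<open>[3 pi/2, 3 pi/2 + 1/2]\<close>, away from the zeros of \<open>sin\<close>.\<close>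

lemma csqrt_bounds_on_shifted_line:
  assumes "q \<ge> 0" and "Im v = sqrt ((3 * pi / 2)\<^sup>2 + q)" and w: "w = csqrt (v\<^sup>2 + of_real q)" and "Re w \<le> 1"
  shows "\<bar>sin (Im w)\<bar> \<ge> 1 / 2"
proof -
  have "(Im v)\<^sup>2 = (3 * pi / 2)\<^sup>2 + q" using assms by simp
  moreover have "w\<^sup>2 = v\<^sup>2 + of_real q" by (simp add: w)
  hence "(Re w)\<^sup>2 - (Im w)\<^sup>2 = (Re v)\<^sup>2 - (Im v)\<^sup>2 + q"
    by (metis Re_square_eq plus_complex.sel(1) Re_complex_of_real)
  ultimately have eq: "(Im w)\<^sup>2 = (Re w)\<^sup>2 - (Re v)\<^sup>2 + (3 * pi / 2)\<^sup>2" by simp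
  have *: "\<bar>Re v\<bar> \<le> Re w" unfolding w by (rule Re_csqrt_ge) fact
  hence "(Re v)\<^sup>2 \<le> (Re w)\<^sup>2" by (metis abs_ge_zero power_mono power2_abs)
  hence "(3 * pi / 2)\<^sup>2 \<le> \<bar>Im w\<bar>\<^sup>2" using eq by simp
  hence lo: "3 * pi / 2 \<le> \<bar>Im w\<bar>" by (rule power2_le_imp_le) simp
  have "(Re w)\<^sup>2 \<le> 1" using * assms(4) by (simp add: power_le_one)
  hence "\<bar>Im w\<bar>\<^sup>2 \<le> (3 * pi / 2)\<^sup>2 + 1" using eq zero_le_power2[of "Re v"] unfolding power2_abs by linarith
  also have "\<dots> \<le> (3 * pi / 2 + 1/2)\<^sup>2" using pi_ge_two by (simp add: power2_sum power_divide)
  finally have hi: "\<bar>Im w\<bar> \<le> 3 * pi / 2 + 1/2"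
    by (rule power2_le_imp_le) (use pi_ge_two in linarith)
  define s where "s = \<bar>Im w\<bar> - 3 * pi / 2"
  have "cos (pi/3) \<le> cos s"
    using lo hi pi_ge_two by (intro cos_monotone_0_pi_le) (auto simp: s_def)
  hence "1/2 \<le> cos s" by (simp add: cos_60)
  also have "cos s = - sin \<bar>Im w\<bar>"
    using sin_cos_eq[of s] sin_3over2_pi cos_3over2_pi by (simp add: s_def cos_diff)
  finally have "1/2 \<le> \<bar>sin \<bar>Im w\<bar>\<bar>" by linarith
  thus ?thesis by (cases "Im w \<ge> 0") auto
qed

section \<open>Decay of the integrand in the complexified coordinate\<close>

definition line_integrand :: "real \<Rightarrow> real \<Rightarrow> nat \<Rightarrow> nat \<Rightarrow> nat \<Rightarrow> real \<Rightarrow> complex \<Rightarrow> complex" where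
  "line_integrand t R N k1 k2 q v =
     exp (\<i> * of_real t * v) * v ^ k2 * radial_symbol R N k1 (v\<^sup>2 + of_real q)"

text \<open>The disjunction on \<open>v\<close> describes the vertical sides and the top of the
  rectangle of integration. If \<open>Re w \<ge> 1\<close>, the bound for \<open>sinh w\<close>
  comes from the real part; otherwise \<open>v\<close> must lie on the top line, where
  \<open>sin (Im w)\<close> is bounded away from zero. The base of the power dominates both
  \<open>|v|\<close> and \<open>|w|\<close>.\<close>

lemma cmod_line_integrand_le:
  assumes "q \<ge> 0" "R \<ge> 0" "n \<ge> 1" and Im: "0 \<le> Im v" "Im v \<le> h"
    and h: "h = sqrt ((3 * pi / 2)\<^sup>2 + q)" and v: "\<bar>Re v\<bar> \<ge> 1 \<or> Im v = h"
  shows "cmod (line_integrand t R (n + k1) k1 k2 q v)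
    \<le> exp (- t * Im v) * (shift_const R (n + k1) *
        ((1 + (Re v)\<^sup>2 + (3 * pi / 2)\<^sup>2 + 2 * q) ^ (k2 + (n + k1)) * exp (- \<bar>Re v\<bar>)))"
proof -
  define z where "z = v\<^sup>2 + of_real q"
  define w where "w = csqrt z"
  define B where "B = 1 + (Re v)\<^sup>2 + (3 * pi / 2)\<^sup>2 + 2 * q"
  have Re: "\<bar>Re v\<bar> \<le> Re w" unfolding w_def z_def by (rule Re_csqrt_ge) fact
  have "(Im v)\<^sup>2 \<le> h\<^sup>2" using Im by (intro power_mono) auto
  hence Im2: "(Im v)\<^sup>2 \<le> (3 * pi / 2)\<^sup>2 + q" using \<open>q \<ge> 0\<close> by (simp add: h)
  have Rez: "Re z = (Re v)\<^sup>2 - (Im v)\<^sup>2 + q" by (simp add: z_def Re_square_eq)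
  hence Re2: "Re z \<ge> - (3 * pi / 2)\<^sup>2" using Im2 zero_le_power2[of "Re v"] by linarith
  have sinh: "cmod (sinh w) \<ge> exp (Re w) / 6"
  proof (cases "Re w \<ge> 1")
    case False
    with v Re have "Im v = h" by auto
    with csqrt_bounds_on_shifted_line[of q v w] False \<open>q \<ge> 0\<close> show ?thesis
      by (intro cmod_sinh_ge_of_Im) (auto simp: h w_def z_def simp del: csqrt.simps)
  qed (rule cmod_sinh_ge_of_Re)
  have z0: "z \<noteq> 0"
  proof
    assume "z = 0"
    hence "w = 0" by (simp add: w_def)
    with sinh show False by simp
  qed
  have v2: "(cmod v)\<^sup>2 \<le> (Re v)\<^sup>2 + (3 * pi / 2)\<^sup>2 + q"
    using Im2 by (simp add: cmod_power2)
  have w2: "(cmod w)\<^sup>2 \<le> (cmod v)\<^sup>2 + q"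
    using norm_triangle_ineq[of "v\<^sup>2" "of_real q"] \<open>q \<ge> 0\<close>
    by (simp add: w_def z_def norm_power)
  have sq: "t \<le> 1 + t\<^sup>2" for t :: real
    using zero_le_power2[of "t - 1/2"] by (simp add: power2_eq_square algebra_simps)
  have vB: "cmod v \<le> B" using v2 sq[of "cmod v"] \<open>q \<ge> 0\<close> unfolding B_def by linarith
  have wB: "cmod w \<le> B" using v2 w2 sq[of "cmod w"] \<open>q \<ge> 0\<close> unfolding B_def by linarith
  have "cmod (line_integrand t R (n + k1) k1 k2 q v)
      = exp (- t * Im v) * (cmod v ^ k2 * cmod (radial_symbol R (n + k1) k1 z))"
    by (simp add: line_integrand_def norm_mult norm_power z_def mult_ac)
  also have "\<dots> \<le> exp (- t * Im v) * (B ^ k2 *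
      (shift_const R (n + k1) * cmod w ^ (n + k1) * exp (- real n * Re w)))"
    using vB cmod_radial_symbol_le[OF \<open>R \<ge> 0\<close> z0 w_def sinh Re2, of n k1]
    by (intro mult_left_mono mult_mono power_mono) (auto simp: B_def \<open>q \<ge> 0\<close>)
  also have "\<dots> \<le> exp (- t * Im v) * (B ^ k2 *
      (shift_const R (n + k1) * B ^ (n + k1) * exp (- \<bar>Re v\<bar>)))"
  proof (intro mult_left_mono mult_mono power_mono wB)
    have "Re w * 1 \<le> Re w * real n" using Re \<open>n \<ge> 1\<close> by (intro mult_left_mono) auto
    thus "exp (- real n * Re w) \<le> exp (- \<bar>Re v\<bar>)" using Re by (simp add: mult.commute)
  qed (auto simp: B_def \<open>q \<ge> 0\<close> shift_const_def)
  finally show ?thesis by (simp add: B_def power_add mult_ac)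
qed

text \<open>Half of what matters is that \<open>C\<close> depends on neither \<open>t\<close>,
  \<open>R\<close> nor \<open>q\<close>: the restriction \<open>R \<le> 1\<close> caps
  \<open>shift_const\<close>. The polynomial in \<open>Re v\<close> is absorbed by
  \<open>exp (- |Re v|)\<close>, with the exponent \<open>2 * (K + 1)\<close> leaving one spare
  factor \<open>1 + (Re v)^2\<close> for integrability, and the dependence on \<open>q\<close>
  splits off as a power.\<close>

lemma line_integrand_decay:
  assumes "n \<ge> 1"
  shows "\<exists>C>0. \<forall>t R q v. 0 \<le> q \<longrightarrow> 0 \<le> R \<longrightarrow> R \<le> 1 \<longrightarrow> 0 \<le> Im v \<longrightarrow> Im v \<le> sqrt ((3 * pi / 2)\<^sup>2 + q)
     \<longrightarrow> \<bar>Re v\<bar> \<ge> 1 \<or> Im v = sqrt ((3 * pi / 2)\<^sup>2 + q)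
     \<longrightarrow> cmod (line_integrand t R (n + k1) k1 k2 q v)
       \<le> exp (- t * Im v) * (C * (1 + q) ^ (k2 + (n + k1))) * inverse (1 + (Re v)\<^sup>2)"
    (is "\<exists>C>0. \<forall>t R q v. _ \<longrightarrow> _ \<longrightarrow> _ \<longrightarrow> _ \<longrightarrow> _ \<longrightarrow> _ \<longrightarrow> ?P t R q v C")
proof -
  define K where "K = k2 + (n + k1)"
  define A where "A = 2 + (3 * pi / 2)\<^sup>2"
  obtain D :: real where "D > 0" and D': "\<forall>x\<ge>0. (1 + x) ^ (2 * (K + 1)) \<le> D * exp (1 * x)"
    using poly_le_exp[OF zero_less_one, of "2 * (K + 1)"] by blast
  hence D: "D > 0" "x \<ge> 0 \<Longrightarrow> (1 + x) ^ (2 * (K + 1)) \<le> D * exp (1 * x)" for x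
    by blast+
  define S where "S = shift_const 1 (n + k1)"
  have S: "S > 0" "\<And>R. R \<le> 1 \<Longrightarrow> shift_const R (n + k1) \<le> S" "\<And>R. shift_const R (n + k1) \<ge> 0"
    using pi_gt_zero mult_right_mono[of _ 1 "6 * (2 + 3 * pi / 2)"]
    by (simp_all add: S_def shift_const_def mult_ac)
  have A: "A > 0" by (simp add: A_def add_pos_nonneg)
  have key: "(1 + x\<^sup>2 + (3 * pi / 2)\<^sup>2 + 2 * q) ^ K * exp (- \<bar>x\<bar>) \<le> A ^ K * D * (1 + q) ^ K * inverse (1 + x\<^sup>2)"
    if "q \<ge> 0" for x q :: real
  proof -
    have "0 \<le> (2 + (3 * pi / 2)\<^sup>2) * (x\<^sup>2 * q) + (3 * pi / 2)\<^sup>2 * (x\<^sup>2 + q) + 1 + x\<^sup>2"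
      using that by (intro add_nonneg_nonneg mult_nonneg_nonneg) auto
    hence "1 + x\<^sup>2 + (3 * pi / 2)\<^sup>2 + 2 * q \<le> A * ((1 + x\<^sup>2) * (1 + q))"
      by (simp add: A_def algebra_simps)
    hence "(1 + x\<^sup>2 + (3 * pi / 2)\<^sup>2 + 2 * q) ^ K \<le> (A * ((1 + x\<^sup>2) * (1 + q))) ^ K"
      using that by (intro power_mono) auto
    hence 1: "(1 + x\<^sup>2 + (3 * pi / 2)\<^sup>2 + 2 * q) ^ K * exp (- \<bar>x\<bar>)
        \<le> (A ^ K * (1 + q) ^ K) * ((1 + x\<^sup>2) ^ K * exp (- \<bar>x\<bar>))"
      by (simp add: power_mult_distrib mult_ac)
    have "(1 + x\<^sup>2) ^ (K + 1) \<le> ((1 + \<bar>x\<bar>)\<^sup>2) ^ (K + 1)"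
      by (intro power_mono) (auto simp: power2_sum)
    also have "\<dots> \<le> D * exp \<bar>x\<bar>"
      using D(2)[of "\<bar>x\<bar>"] unfolding power_mult[symmetric] by simp
    finally have "(1 + x\<^sup>2) ^ K * exp (- \<bar>x\<bar>) \<le> D * inverse (1 + x\<^sup>2)"
      by (simp add: exp_minus field_simps add_pos_nonneg)
    hence "(A ^ K * (1 + q) ^ K) * ((1 + x\<^sup>2) ^ K * exp (- \<bar>x\<bar>)) \<le> (A ^ K * (1 + q) ^ K) * (D * inverse (1 + x\<^sup>2))"
      using A that by (intro mult_left_mono) auto
    from order.trans[OF 1 this] show ?thesis by (simp only: mult_ac)
  qed
  have "?P t R q v (S * (A ^ K * D))"
    if "0 \<le> q" "0 \<le> R" "R \<le> 1" "0 \<le> Im v" "Im v \<le> sqrt ((3 * pi / 2)\<^sup>2 + q)"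
       "\<bar>Re v\<bar> \<ge> 1 \<or> Im v = sqrt ((3 * pi / 2)\<^sup>2 + q)" for t R q v
  proof -
    note cmod_line_integrand_le[OF that(1,2) assms that(4,5) refl that(6), of t k1 k2]
    also have "exp (- t * Im v) * (shift_const R (n + k1) *
        ((1 + (Re v)\<^sup>2 + (3 * pi / 2)\<^sup>2 + 2 * q) ^ (k2 + (n + k1)) * exp (- \<bar>Re v\<bar>)))
      \<le> exp (- t * Im v) * (S * (A ^ K * D * (1 + q) ^ K * inverse (1 + (Re v)\<^sup>2)))"
      unfolding K_def[symmetric] using S A D that
      by (intro mult_left_mono mult_mono key) auto
    finally show ?thesis unfolding K_def by (simp only: mult_ac)
  qed
  moreover have "S * (A ^ K * D) > 0" using S A D by simp
  ultimately show ?thesis by blast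
qed

subsection \<open>Shifting the contour past the first singularity\<close>

text \<open>After multiplication by \<open>2 sinh l\<close> this is
  \<open>2 l \<le> (1 + 2 l) (1 - exp (- 2 l))\<close>, that is,
  \<open>(1 + 2 l) exp (- 2 l) \<le> 1\<close>.\<close>

lemma l_div_sinh_le:
  assumes "l > (0::real)" shows "l / sinh l \<le> (1 + 2 * l) * exp (- l)"
proof -
  have "(1 + 2 * l) * exp (- (2 * l)) \<le> 1"
    using exp_ge_add_one_self[of "2 * l"] by (simp add: exp_minus field_simps)
  hence "2 * l \<le> (1 + 2 * l) * (1 - exp (- (2 * l)))" by (simp add: algebra_simps)
  also have "\<dots> = (1 + 2 * l) * exp (- l) * (2 * sinh l)"
  proof -
    have "exp (- l) * (2 * sinh l) = 1 - exp (- (2 * l))"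
    proof -
      have "2 * sinh l = exp l - exp (- l)" by (simp add: sinh_field_def)
      thus ?thesis by (simp add: right_diff_distrib flip: exp_add)
    qed
    thus ?thesis by (simp only: mult.assoc)
  qed
  finally have "2 * l \<le> 2 * ((1 + 2 * l) * exp (- l) * sinh l)" by (simp only: mult_ac)
  thus ?thesis using assms by (simp add: pos_divide_le_eq)
qed

lemma cmod_radial_symbol_real_le:
  assumes "R \<ge> 0" "l \<ge> 0"
  shows "cmod (radial_symbol R (n + k1) k1 (of_real (l\<^sup>2))) \<le> (1 + 2 * l) ^ (n + k1) * exp (- real n * l)"
proof (cases "l = 0")
  case True
  have "cosh_sqrt 0 = 1" using cosh_sqrt_square[of 0] by simp
  with True assms show ?thesis by (simp add: radial_symbol_def sinhc_sqrt_0)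
next
  case False
  with assms have l: "l > 0" by simp
  have real: "sinh (of_real l :: complex) = of_real (sinh l)" "cosh (of_real l :: complex) = of_real (cosh l)"
    by (simp_all add: sinh_field_def cosh_field_def flip: exp_of_real)
  have "cmod (radial_symbol R (n + k1) k1 ((of_real l)\<^sup>2))
      = exp (- R * (l * cosh l / sinh l)) * (cosh l ^ k1 * (l / sinh l) ^ (n + k1))"
    using l by (subst radial_symbol_square) (simp_all add: real norm_mult norm_divide norm_power power_divide
        flip: of_real_mult of_real_divide of_real_minus exp_of_real)
  also have "\<dots> \<le> 1 * (exp l ^ k1 * ((1 + 2 * l) * exp (- l)) ^ (n + k1))"
  proof (intro mult_mono power_mono l_div_sinh_le l)
    show "exp (- R * (l * cosh l / sinh l)) \<le> 1" using l assms by simp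
    show "cosh l \<le> exp l" using l by (simp add: cosh_field_def)
  qed (use l in auto)
  also have "\<dots> = (1 + 2 * l) ^ (n + k1) * exp (- real n * l)"
    by (simp add: power_mult_distrib power_add exp_minus field_simps flip: exp_of_nat_mult)
  finally show ?thesis by simp
qed

text \<open>On the real axis \<open>l coth l\<close> is positive, so the exponential factor is at
  most \<open>1\<close> and \<open>D\<close> is independent of \<open>R\<close>. The power
  \<open>p\<close> is left free: \<open>p = 1\<close> suffices on a line, while the dimension is
  needed to dominate by a product over coordinates.\<close>

lemma radial_symbol_real_decay:
  assumes "n \<ge> 1"
  shows "\<exists>D>0. \<forall>R l. R \<ge> 0 \<longrightarrow> l \<ge> 0 \<longrightarrow>
    l ^ k2 * cmod (radial_symbol R (n + k1) k1 (of_real (l\<^sup>2))) \<le> D * inverse ((1 + l\<^sup>2) ^ p)"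
    (is "\<exists>D>0. \<forall>R l. _ \<longrightarrow> _ \<longrightarrow> ?P R l D")
proof -
  define K where "K = k2 + (n + k1)"
  have "(1/2::real) > 0" by simp
  then obtain D :: real where D: "D > 0" "\<forall>x\<ge>0. (1 + x) ^ (K + 2 * p) \<le> D * exp (1/2 * x)"
    using poly_le_exp[of "1/2" "K + 2 * p"] by blast
  have "?P R l D" if "R \<ge> 0" "l \<ge> 0" for R l
  proof -
    have "l ^ k2 * cmod (radial_symbol R (n + k1) k1 (of_real (l\<^sup>2)))
        \<le> (1 + 2 * l) ^ k2 * ((1 + 2 * l) ^ (n + k1) * exp (- real n * l))"
      using that by (intro mult_mono power_mono cmod_radial_symbol_real_le) auto
    also have "\<dots> \<le> (1 + 2 * l) ^ k2 * ((1 + 2 * l) ^ (n + k1) * exp (- l))"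
      using that assms mult_right_mono[of 1 "real n" l] by (intro mult_left_mono) auto
    also have "\<dots> = (1 + 2 * l) ^ K * exp (- l)" by (simp add: K_def power_add)
    also have "\<dots> \<le> D * inverse ((1 + l\<^sup>2) ^ p)"
    proof -
      have "(1 + 2 * l) ^ K * (1 + l\<^sup>2) ^ p \<le> (1 + 2 * l) ^ K * ((1 + 2 * l)\<^sup>2) ^ p"
        using that by (intro mult_left_mono power_mono) (auto simp: power2_eq_square algebra_simps)
      also have "\<dots> \<le> D * exp l"
        using D(2)[rule_format, of "2 * l"] that by (simp add: power_add power_mult)
      finally show ?thesis
        using that by (simp add: exp_minus field_simps add_pos_nonneg)
    qed
    finally show ?thesis .
  qed
  with D show ?thesis by blast
qed

lemma integrable_inverse_1_plus_square': "integrable lborel (\<lambda>x::real. inverse (1 + x\<^sup>2))"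
  and integral_inverse_1_plus_square': "(LINT x|lborel. inverse (1 + x\<^sup>2 :: real)) = pi"
  using integrable_inverse_1_plus_square LBINT_inverse_1_plus_square
  by (simp_all add: set_integrable_def interval_lebesgue_integral_def set_lebesgue_integral_def)

text \<open>Connects the Lebesgue integral over the line with the gauge integrals over segments in
  which contour integrals are expressed.\<close>

lemma tendsto_integral_symmetric_interval:
  fixes g :: "real \<Rightarrow> complex"
  assumes g: "integrable lborel g"
  shows "(\<lambda>k. integral {- real k..real k} g) \<longlonglongrightarrow> integral\<^sup>L lborel g"
proof -
  have "(\<lambda>k. LINT x|lborel. indicator {- real k..real k} x *\<^sub>R g x) \<longlonglongrightarrow> integral\<^sup>L lborel g"
  proof (rule integral_dominated_convergence[where w = "\<lambda>x. cmod (g x)"])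
    show "AE x in lborel. (\<lambda>k. indicator {- real k..real k} x *\<^sub>R g x) \<longlonglongrightarrow> g x"
    proof (rule AE_I2, rule tendsto_eventually)
      fix x :: real
      obtain K :: nat where K: "\<bar>x\<bar> \<le> real K" using real_arch_simple by blast
      show "\<forall>\<^sub>F k in sequentially. indicator {- real k..real k} x *\<^sub>R g x = g x"
        using eventually_ge_at_top[of K] by eventually_elim (use K in \<open>auto simp: indicator_def\<close>)
    qed
  qed (use g in \<open>auto simp: indicator_def\<close>)
  moreover have "(LINT x|lborel. indicator {- real k..real k} x *\<^sub>R g x) = integral {- real k..real k} g" for k
    using set_borel_integral_eq_integral(2)[of "{- real k..real k}" g] g
    by (simp add: set_integrable_def set_lebesgue_integral_def integrable_mult_indicator)
  ultimately show ?thesis by simp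
qed

lemma contour_integral_linepath_same_Im:
  assumes "a < b"
  shows "contour_integral (linepath (Complex a c) (Complex b c)) f = integral {a..b} (\<lambda>x. f (Complex x c))"
proof -
  have shift: "linepath (Complex a c) (Complex b c) x = linepath (Complex a 0) (Complex b 0) x + \<i> * of_real c" for x
    by (simp add: linepath_def complex_eq_iff algebra_simps)
  have "(f has_contour_integral I) (linepath (Complex a c) (Complex b c)) \<longleftrightarrow>
      ((\<lambda>z. f (z + \<i> * of_real c)) has_contour_integral I) (linepath (Complex a 0) (Complex b 0))" for I
    unfolding has_contour_integral_linepath by (simp add: shift complex_diff)
  hence "contour_integral (linepath (Complex a c) (Complex b c)) f
      = contour_integral (linepath (Complex a 0) (Complex b 0)) (\<lambda>z. f (z + \<i> * of_real c))"
    by (simp add: contour_integral_def contour_integrable_on_def)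
  also have "\<dots> = integral {a..b} (\<lambda>x. f (of_real x + \<i> * of_real c))"
    using assms by (subst contour_integral_linepath_Reals_eq) (auto simp: complex_is_Real_iff)
  finally show ?thesis by (simp add: Complex_eq)
qed

text \<open>The zeros in \<open>v\<close> are plus and minus \<open>i sqrt ((pi j)^2 + q)\<close>.
  The lower bound \<open>-1\<close> excludes all the negative ones, whose imaginary parts are at
  most \<open>- pi\<close>, and the upper bound excludes \<open>j \<ge> 2\<close>.\<close>

lemma sinhc_sqrt_nonzero_in_strip:
  assumes "q \<ge> 0" "-1 < Im v" "Im v < sqrt ((2 * pi)\<^sup>2 + q)" "v \<noteq> \<i> * of_real (sqrt (pi\<^sup>2 + q))"
  shows "sinhc_sqrt (v\<^sup>2 + of_real q) \<noteq> 0"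
proof
  assume "sinhc_sqrt (v\<^sup>2 + of_real q) = 0"
  then obtain j :: nat where j: "j \<ge> 1" "v\<^sup>2 + of_real q = - of_real ((pi * real j)\<^sup>2)"
    by (auto simp: sinhc_sqrt_eq_0_iff)
  define b where "b = sqrt ((pi * real j)\<^sup>2 + q)"
  have b2: "b\<^sup>2 = (pi * real j)\<^sup>2 + q" using assms(1) by (simp add: b_def)
  have "of_real b ^ 2 = (of_real ((pi * real j)\<^sup>2) + of_real q :: complex)"
    by (metis b2 of_real_add of_real_power)
  hence "v\<^sup>2 = (\<i> * of_real b)\<^sup>2"
    using j(2) by (simp add: power_mult_distrib algebra_simps eq_neg_iff_add_eq_0)
  hence v: "v = \<i> * of_real b \<or> v = - (\<i> * of_real b)" by (simp add: power2_eq_iff)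
  have "pi * 1 \<le> pi * real j" using j by (intro mult_left_mono) auto
  hence "pi\<^sup>2 \<le> (pi * real j)\<^sup>2" by (intro power_mono) auto
  hence "b \<ge> sqrt (pi\<^sup>2)" unfolding b_def using assms(1) by (intro real_sqrt_le_mono) linarith
  hence "b \<ge> 1" using pi_ge_two by simp
  hence vb: "v = \<i> * of_real b" using v assms(2) by auto
  show False
  proof (cases "j = 1")
    case True
    thus False using vb assms(4) by (simp add: b_def)
  next
    case False
    hence "pi * 2 \<le> pi * real j" using j by (intro mult_left_mono) auto
    hence "(2 * pi)\<^sup>2 \<le> (pi * real j)\<^sup>2" by (intro power_mono) (auto simp: mult.commute)
    hence "b \<ge> sqrt ((2 * pi)\<^sup>2 + q)" unfolding b_def by (intro real_sqrt_le_mono) linarith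
    thus False using vb assms(3) by simp
  qed
qed

lemma line_integrand_holomorphic:
  assumes "\<And>v. v \<in> A \<Longrightarrow> sinhc_sqrt (v\<^sup>2 + of_real q) \<noteq> 0"
  shows "line_integrand t R N k1 k2 q holomorphic_on A"
  unfolding line_integrand_def radial_symbol_def using assms
  by (intro holomorphic_intros) auto

text \<open>The residue theorem on the rectangles with base \<open>[-k, k]\<close> and height
  \<open>h\<close>, which enclose only \<open>p\<close>. As \<open>k\<close> grows the vertical
  sides vanish, and the two horizontal sides converge to the integrals over the lines.\<close>

lemma contour_shift:
  fixes n k1 k2 :: nat and q R t :: real
  assumes n: "n \<ge> 1" and q: "q \<ge> 0" and R: "0 \<le> R" "R \<le> 1"
  defines "f \<equiv> line_integrand t R (n + k1) k1 k2 q"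
  defines "h \<equiv> sqrt ((3 * pi / 2)\<^sup>2 + q)" and "p \<equiv> \<i> * of_real (sqrt (pi\<^sup>2 + q))"
  shows "(LINT x|lborel. f (of_real x)) = 2 * pi * \<i> * residue f p + (LINT x|lborel. f (Complex x h))"
    and "integrable lborel (\<lambda>x. f (Complex x h))"
proof -
  \<comment> \<open>The strip is opened below the real axis and up to the second singularity, so
    that it is an open neighbourhood of the closed rectangles and still contains no singularity
    besides \<open>p\<close>.\<close>
  define s where "s = {v. -1 < Im v \<and> Im v < sqrt ((2 * pi)\<^sup>2 + q)}"
  have s: "open s" "convex s"
    unfolding s_def Collect_conj_eq using open_halfspace_Im_gt open_halfspace_Im_lt
    by (auto intro!: open_Int convex_Int convex_halfspace_Im_gt convex_halfspace_Im_lt)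
  have "(3 * pi / 2)\<^sup>2 < (2 * pi)\<^sup>2" "pi\<^sup>2 < (3 * pi / 2)\<^sup>2"
    by (intro power_strict_mono; simp)+
  hence h: "0 < h" "h < sqrt ((2 * pi)\<^sup>2 + q)" "sqrt (pi\<^sup>2 + q) < h" "0 < sqrt (pi\<^sup>2 + q)"
    unfolding h_def using q by (auto intro!: add_pos_nonneg)
  have h': "-1 < h" "pi\<^sup>2 + q \<noteq> 0" using h(1) h(4) by auto
  have holo: "f holomorphic_on s - {p}"
    unfolding f_def using sinhc_sqrt_nonzero_in_strip[OF q]
    by (intro line_integrand_holomorphic) (auto simp: s_def p_def)
  have cont: "continuous_on (s - {p}) f" using holo by (rule holomorphic_on_imp_continuous_on)
  obtain C where C: "C > 0" and
    bound: "\<And>v. 0 \<le> Im v \<Longrightarrow> Im v \<le> h \<Longrightarrow> \<bar>Re v\<bar> \<ge> 1 \<or> Im v = h \<Longrightarrow>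
      cmod (f v) \<le> exp (- t * Im v) * C * inverse (1 + (Re v)\<^sup>2)"
    using line_integrand_decay[OF n, of k1 k2]
  proof (elim exE conjE, goal_cases)
    case (1 C)
    have "C * (1 + q) ^ (k2 + (n + k1)) > 0" using 1(2) q by simp
    from 1(1)[OF this] show ?case using 1(3) q R unfolding f_def h_def by blast
  qed
  have cont_line: "continuous_on UNIV (\<lambda>x. f (Complex x y))" if "y = 0 \<or> y = h" for y
    by (rule continuous_on_compose2[OF cont, of UNIV])
       (use that h h' q in \<open>auto simp: s_def p_def complex_eq_iff Complex_eq add_pos_nonneg intro!: continuous_intros\<close>)
  have int_h: "integrable lborel (\<lambda>x. f (Complex x h))"
  proof (rule Bochner_Integration.integrable_bound)
    show "integrable lborel (\<lambda>x. exp (- t * h) * C * inverse (1 + x\<^sup>2))"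
      by (intro integrable_mult_right integrable_inverse_1_plus_square')
    show "AE x in lborel. cmod (f (Complex x h)) \<le> norm (exp (- t * h) * C * inverse (1 + x\<^sup>2))"
      using bound[of "Complex _ h"] h C by (intro AE_I2) (simp add: abs_mult)
  qed (use borel_measurable_continuous_onI[OF cont_line[of h]] in simp)
  show "integrable lborel (\<lambda>x. f (Complex x h))" by fact
  \<comment> \<open>At height \<open>0\<close> the estimate \<open>bound\<close> is silent about
    \<open>|Re v| < 1\<close>, so the decay on the real axis is used instead.\<close>
  have int_0: "integrable lborel (\<lambda>x. f (Complex x 0))"
  proof -
    obtain D where D: "D > 0" and bd: "\<And>R l. R \<ge> 0 \<Longrightarrow> l \<ge> 0 \<Longrightarrow>
       l ^ k2 * cmod (radial_symbol R (n + k1) k1 (of_real (l\<^sup>2))) \<le> D * inverse ((1 + l\<^sup>2) ^ 1)"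
      using radial_symbol_real_decay[OF n, of k2 k1 1] by blast
    have "cmod (f (Complex x 0)) \<le> D * inverse (1 + x\<^sup>2)" for x
    proof -
      define l where "l = sqrt (x\<^sup>2 + q)"
      have l: "l \<ge> 0" "l\<^sup>2 = x\<^sup>2 + q" "\<bar>x\<bar> \<le> l" using q by (auto simp: l_def real_le_rsqrt)
      have "cmod (f (Complex x 0)) = \<bar>x\<bar> ^ k2 * cmod (radial_symbol R (n + k1) k1 (of_real (l\<^sup>2)))"
        by (simp add: f_def line_integrand_def norm_mult norm_power power_abs l Complex_eq flip: of_real_power)
      also have "\<dots> \<le> l ^ k2 * cmod (radial_symbol R (n + k1) k1 (of_real (l\<^sup>2)))"
        using l by (intro mult_right_mono power_mono) auto
      also have "\<dots> \<le> D * inverse ((1 + l\<^sup>2) ^ 1)" using bd R l by blast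
      also have "\<dots> \<le> D * inverse (1 + x\<^sup>2)"
        using D q l by (intro mult_left_mono) (auto intro!: le_imp_inverse_le add_pos_nonneg)
      finally show ?thesis .
    qed
    thus ?thesis
      using D borel_measurable_continuous_onI[OF cont_line[of 0]]
      by (intro Bochner_Integration.integrable_bound[OF integrable_mult_right[OF integrable_inverse_1_plus_square', of D]] AE_I2)
         (auto simp: abs_mult)
  qed
  have rect: "integral {- real k..real k} (\<lambda>x. f (Complex x 0)) - integral {- real k..real k} (\<lambda>x. f (Complex x h))
      + contour_integral (linepath (Complex (real k) 0) (Complex (real k) h)) f
      - contour_integral (linepath (Complex (- real k) 0) (Complex (- real k) h)) f = 2 * pi * \<i> * residue f p"
    if k: "k \<ge> 1" for k :: nat
  proof -
    define X where "X = real k"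
    have X: "X > 0" using k by (simp add: X_def)
    define a b c d where "a = Complex (-X) 0" and "b = Complex X 0" and "c = Complex X h" and "d = Complex (-X) h"
    have p_box: "p \<in> box a c" using X h by (auto simp: in_box_complex_iff a_def c_def p_def)
    have sub: "cbox a c \<subseteq> s"
    proof
      fix z assume "z \<in> cbox a c"
      hence "0 \<le> Im z" "Im z \<le> h" by (simp_all add: a_def c_def in_cbox_complex_iff)
      thus "z \<in> s" using h(2) by (simp add: s_def)
    qed
    have img: "path_image (rectpath a c) \<subseteq> s - {p}"
    proof -
      have "path_image (rectpath a c) = cbox a c - box a c"
        using X h(1) by (intro path_image_rectpath_cbox_minus_box) (simp_all add: a_def c_def)
      thus ?thesis using sub p_box by blast
    qed
    have "contour_integral (rectpath a c) f = 2 * pi * \<i> * (\<Sum>p\<in>{p}. winding_number (rectpath a c) p * residue f p)"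
    proof (rule Residue_theorem[of s])
      show "\<forall>z. z \<notin> s \<longrightarrow> winding_number (rectpath a c) z = 0"
      proof (intro allI impI winding_number_rectpath_outside)
        show "z \<notin> cbox a c" if "z \<notin> s" for z using that sub by blast
        show "Re a \<le> Re c" "Im a \<le> Im c" using X h(1) by (simp_all add: a_def c_def)
      qed
    qed (use s holo img convex_connected in auto)
    hence 1: "contour_integral (rectpath a c) f = 2 * pi * \<i> * residue f p"
      using winding_number_rectpath[OF p_box] by simp
    have seg: "closed_segment a b \<subseteq> s - {p}" "closed_segment b c \<subseteq> s - {p}"
       "closed_segment c d \<subseteq> s - {p}" "closed_segment d a \<subseteq> s - {p}"
      using img X h by (auto simp: rectpath_def Let_def path_image_join a_def b_def c_def d_def)
    hence seg': "closed_segment d c \<subseteq> s - {p}" "closed_segment a d \<subseteq> s - {p}"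
      by (auto simp: closed_segment_commute)
    have ci: "f contour_integrable_on linepath u v" if "closed_segment u v \<subseteq> s - {p}" for u v
      using continuous_on_subset[OF cont that] by (rule contour_integrable_continuous_linepath)
    have "contour_integral (rectpath a c) f = contour_integral (linepath a b) f + contour_integral (linepath b c) f
        + contour_integral (linepath c d) f + contour_integral (linepath d a) f"
      using ci seg by (simp add: rectpath_def Let_def a_def b_def c_def d_def)
    also have "contour_integral (linepath c d) f = - contour_integral (linepath d c) f"
      using contour_integral_reverse_linepath[of d c f] continuous_on_subset[OF cont seg'(1)] by simp
    also have "contour_integral (linepath d a) f = - contour_integral (linepath a d) f"
      using contour_integral_reverse_linepath[of a d f] continuous_on_subset[OF cont seg'(2)] by simp
    also have "contour_integral (linepath a b) f = integral {- X..X} (\<lambda>x. f (Complex x 0))"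
      using X contour_integral_linepath_same_Im by (simp add: a_def b_def)
    also have "contour_integral (linepath d c) f = integral {- X..X} (\<lambda>x. f (Complex x h))"
      using X contour_integral_linepath_same_Im by (simp add: d_def c_def)
    finally show ?thesis using 1 by (simp add: X_def a_def b_def c_def d_def algebra_simps)
  qed
  \<comment> \<open>Each side has the fixed length \<open>h\<close>, and the integrand on it is
    \<open>O(1 / k^2)\<close>. The sign \<open>\<sigma>\<close> treats both sides at once, and
    \<open>E\<close> bounds \<open>exp (- t Im v)\<close> for either sign of
    \<open>t\<close>.\<close>
  have side: "(\<lambda>k. contour_integral (linepath (Complex (\<sigma> * real k) 0) (Complex (\<sigma> * real k) h)) f) \<longlonglongrightarrow> 0"
    if \<sigma>: "\<bar>\<sigma>\<bar> = 1" for \<sigma> :: real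
  proof (rule Lim_null_comparison)
    define E where "E = exp (\<bar>t\<bar> * h)"
    show "(\<lambda>k. (E * C * inverse (1 + (real k)\<^sup>2)) * h) \<longlonglongrightarrow> 0"
      by real_asymp
    show "\<forall>\<^sub>F k in sequentially. norm (contour_integral (linepath (Complex (\<sigma> * real k) 0) (Complex (\<sigma> * real k) h)) f)
         \<le> (E * C * inverse (1 + (real k)\<^sup>2)) * h"
      using eventually_ge_at_top[of 1]
    proof eventually_elim
      case (elim k)
      let ?a = "Complex (\<sigma> * real k) 0" and ?b = "Complex (\<sigma> * real k) h"
      have seg: "Re v = \<sigma> * real k \<and> 0 \<le> Im v \<and> Im v \<le> h" if "v \<in> closed_segment ?a ?b" for v
        using that h by (auto simp: closed_segment_same_Re closed_segment_eq_real_ivl)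
      have sk: "\<bar>\<sigma> * real k\<bar> = real k" using \<sigma> by (simp add: abs_mult)
      have "closed_segment ?a ?b \<subseteq> s - {p}"
        using seg h elim \<sigma> by (force simp: s_def p_def)
      hence "f contour_integrable_on linepath ?a ?b"
        using continuous_on_subset[OF cont] contour_integrable_continuous_linepath by blast
      moreover have "cmod (f v) \<le> E * C * inverse (1 + (real k)\<^sup>2)" if "v \<in> closed_segment ?a ?b" for v
      proof -
        have v: "Re v = \<sigma> * real k" "0 \<le> Im v" "Im v \<le> h" using seg that by auto
        have "(Re v)\<^sup>2 = (real k)\<^sup>2" using sk v by (metis power2_abs)
        hence "cmod (f v) \<le> exp (- t * Im v) * C * inverse (1 + (real k)\<^sup>2)"
          using bound[of v] v sk elim by simp
        also have "exp (- t * Im v) \<le> E"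
          using v mult_mono[of "- t" "\<bar>t\<bar>" "Im v" h] by (auto simp: E_def)
        finally show ?thesis using C by (simp add: mult_right_mono)
      qed
      moreover have "norm (?b - ?a) = h" using h(1) by (simp add: cmod_def)
      ultimately show ?case
        using contour_integral_bound_linepath[of f ?a ?b "E * C * inverse (1 + (real k)\<^sup>2)"] C by (simp add: E_def)
    qed
  qed
  define Q where "Q k = integral {- real k..real k} (\<lambda>x. f (Complex x 0)) - integral {- real k..real k} (\<lambda>x. f (Complex x h))
      + contour_integral (linepath (Complex (real k) 0) (Complex (real k) h)) f
      - contour_integral (linepath (Complex (- real k) 0) (Complex (- real k) h)) f" for k :: nat
  have "Q \<longlonglongrightarrow> (LINT x|lborel. f (Complex x 0)) - (LINT x|lborel. f (Complex x h)) + 0 - 0"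
    using side[of 1] side[of "-1"] unfolding Q_def
    by (intro tendsto_intros tendsto_integral_symmetric_interval int_0 int_h) auto
  moreover have "Q \<longlonglongrightarrow> 2 * pi * \<i> * residue f p"
  proof (rule tendsto_eventually)
    show "\<forall>\<^sub>F k in sequentially. Q k = 2 * pi * \<i> * residue f p"
      using eventually_ge_at_top[of 1] by eventually_elim (use rect in \<open>simp add: Q_def\<close>)
  qed
  ultimately have "(LINT x|lborel. f (Complex x 0)) - (LINT x|lborel. f (Complex x h)) + 0 - 0 = 2 * pi * \<i> * residue f p"
    using LIMSEQ_unique by blast
  thus "(LINT x|lborel. f (of_real x)) = 2 * pi * \<i> * residue f p + (LINT x|lborel. f (Complex x h))"
    by (simp add: algebra_simps Complex_eq)
qed

subsection \<open>Uniform approximation and loop integrals\<close>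

text \<open>Closeness of order \<open>e\<close> together with boundedness of both functions, since
  boundedness is what makes the relation stable under products, powers and \<open>exp\<close>. All
  parameters are packed into the point \<open>x\<close>, so the single constant expresses uniformity
  in them.\<close>

definition approx_on :: "'i set \<Rightarrow> ('i \<Rightarrow> real) \<Rightarrow> ('i \<Rightarrow> complex) \<Rightarrow> ('i \<Rightarrow> complex) \<Rightarrow> bool" where
  "approx_on X e f g \<longleftrightarrow>
     (\<exists>M. \<forall>x\<in>X. cmod (f x) \<le> M \<and> cmod (g x) \<le> M \<and> cmod (f x - g x) \<le> M * e x)"

lemma approx_onI:
  assumes "\<And>x. x \<in> X \<Longrightarrow> cmod (f x) \<le> A" "\<And>x. x \<in> X \<Longrightarrow> cmod (g x) \<le> B"
    "\<And>x. x \<in> X \<Longrightarrow> cmod (f x - g x) \<le> C * e x" and e: "\<And>x. x \<in> X \<Longrightarrow> e x \<ge> 0"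
  shows "approx_on X e f g"
  unfolding approx_on_def
proof (intro exI ballI conjI)
  fix x assume x: "x \<in> X"
  let ?M = "max A (max B C)"
  show "cmod (f x) \<le> ?M" "cmod (g x) \<le> ?M" using assms(1,2)[OF x] by auto
  have "C * e x \<le> ?M * e x" using e[OF x] by (intro mult_right_mono) auto
  thus "cmod (f x - g x) \<le> ?M * e x" using assms(3)[OF x] by linarith
qed

lemma approx_onE:
  assumes "approx_on X e f g"
  obtains M where "M \<ge> 1" "\<And>x. x \<in> X \<Longrightarrow> e x \<ge> 0 \<Longrightarrow> cmod (f x) \<le> M \<and> cmod (g x) \<le> M \<and> cmod (f x - g x) \<le> M * e x"
proof -
  obtain M where M: "\<And>x. x \<in> X \<Longrightarrow> cmod (f x) \<le> M \<and> cmod (g x) \<le> M \<and> cmod (f x - g x) \<le> M * e x"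
    using assms unfolding approx_on_def by blast
  show ?thesis
  proof (rule that[of "max 1 M"])
    fix x assume x: "x \<in> X" "e x \<ge> 0"
    have "M * e x \<le> max 1 M * e x" using x by (intro mult_right_mono) auto
    thus "cmod (f x) \<le> max 1 M \<and> cmod (g x) \<le> max 1 M \<and> cmod (f x - g x) \<le> max 1 M * e x"
      using M[OF x(1)] by auto
  qed auto
qed

lemma approx_on_refl:
  assumes "\<And>x. x \<in> X \<Longrightarrow> cmod (f x) \<le> A" "\<And>x. x \<in> X \<Longrightarrow> e x \<ge> 0"
  shows "approx_on X e f f"
  using assms by (intro approx_onI[of X f A f A 0]) auto

lemma approx_on_mult:
  assumes f: "approx_on X e f f'" and g: "approx_on X e g g'" and e: "\<And>x. x \<in> X \<Longrightarrow> e x \<ge> 0"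
  shows "approx_on X e (\<lambda>x. f x * g x) (\<lambda>x. f' x * g' x)"
proof -
  obtain M where M: "M \<ge> 1" "\<And>x. x \<in> X \<Longrightarrow> e x \<ge> 0 \<Longrightarrow> cmod (f x) \<le> M \<and> cmod (f' x) \<le> M \<and> cmod (f x - f' x) \<le> M * e x"
    using approx_onE[OF f] by blast
  obtain L where L: "L \<ge> 1" "\<And>x. x \<in> X \<Longrightarrow> e x \<ge> 0 \<Longrightarrow> cmod (g x) \<le> L \<and> cmod (g' x) \<le> L \<and> cmod (g x - g' x) \<le> L * e x"
    using approx_onE[OF g] by blast
  show ?thesis
  proof (rule approx_onI[where A = "M * L" and B = "M * L" and C = "2 * M * L"])
    fix x assume x: "x \<in> X"
    note b = M(2)[OF x e[OF x]] L(2)[OF x e[OF x]]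
    show "cmod (f x * g x) \<le> M * L" "cmod (f' x * g' x) \<le> M * L"
      using b M(1) L(1) by (auto simp: norm_mult intro!: mult_mono)
    have "cmod ((f x - f' x) * g x) \<le> (M * e x) * L" "cmod (f' x * (g x - g' x)) \<le> M * (L * e x)"
      unfolding norm_mult using b M(1) L(1) e[OF x] by (intro mult_mono; simp)+
    hence "cmod ((f x - f' x) * g x + f' x * (g x - g' x)) \<le> 2 * M * L * e x"
      by (intro norm_triangle_le) (simp add: mult_ac)
    thus "cmod (f x * g x - f' x * g' x) \<le> 2 * M * L * e x" by (simp add: algebra_simps)
  qed (use e in auto)
qed

lemma approx_on_power:
  assumes f: "approx_on X e f f'" and e: "\<And>x. x \<in> X \<Longrightarrow> e x \<ge> 0"
  shows "approx_on X e (\<lambda>x. f x ^ k) (\<lambda>x. f' x ^ k)"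
  by (induction k) (auto intro!: approx_on_mult f e approx_on_refl[of X "\<lambda>_. 1" 1])

lemma cmod_exp_diff_le:
  assumes "cmod a \<le> M" "cmod b \<le> M"
  shows "cmod (exp a - exp b) \<le> exp M * cmod (a - b)"
proof (rule field_differentiable_bound[of "cball 0 M" exp exp "exp M"])
  show "cmod (exp z) \<le> exp M" if "z \<in> cball 0 M" for z
    using that abs_Re_le_cmod[of z] by (auto simp: norm_exp_eq_Re)
qed (use assms in \<open>auto intro: DERIV_subset[OF DERIV_exp]\<close>)

lemma approx_on_exp:
  assumes f: "approx_on X e f f'" and e: "\<And>x. x \<in> X \<Longrightarrow> e x \<ge> 0"
  shows "approx_on X e (\<lambda>x. exp (f x)) (\<lambda>x. exp (f' x))"
proof -
  obtain M where M: "M \<ge> 1" "\<And>x. x \<in> X \<Longrightarrow> e x \<ge> 0 \<Longrightarrow> cmod (f x) \<le> M \<and> cmod (f' x) \<le> M \<and> cmod (f x - f' x) \<le> M * e x"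
    using approx_onE[OF f] by blast
  show ?thesis
  proof (rule approx_onI[where A = "exp M" and B = "exp M" and C = "exp M * M"])
    fix x assume x: "x \<in> X"
    note b = M(2)[OF x e[OF x]]
    show "cmod (exp (f x)) \<le> exp M" "cmod (exp (f' x)) \<le> exp M"
      using b abs_Re_le_cmod[of "f x"] abs_Re_le_cmod[of "f' x"] by (auto simp: norm_exp_eq_Re)
    have "cmod (exp (f x) - exp (f' x)) \<le> exp M * cmod (f x - f' x)"
      using b by (intro cmod_exp_diff_le) auto
    also have "\<dots> \<le> exp M * (M * e x)" using b by (intro mult_left_mono) auto
    finally show "cmod (exp (f x) - exp (f' x)) \<le> exp M * M * e x" by simp
  qed (use e in auto)
qed

lemma approx_on_inverse:
  assumes f: "approx_on X e f f'" and e: "\<And>x. x \<in> X \<Longrightarrow> e x \<ge> 0"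
    and m: "m > 0" "\<And>x. x \<in> X \<Longrightarrow> cmod (f x) \<ge> m" "\<And>x. x \<in> X \<Longrightarrow> cmod (f' x) \<ge> m"
  shows "approx_on X e (\<lambda>x. inverse (f x)) (\<lambda>x. inverse (f' x))"
proof -
  obtain M where M: "M \<ge> 1" "\<And>x. x \<in> X \<Longrightarrow> e x \<ge> 0 \<Longrightarrow> cmod (f x) \<le> M \<and> cmod (f' x) \<le> M \<and> cmod (f x - f' x) \<le> M * e x"
    using approx_onE[OF f] by blast
  show ?thesis
  proof (rule approx_onI[where A = "inverse m" and B = "inverse m" and C = "M * inverse m ^ 2"])
    fix x assume x: "x \<in> X"
    note b = M(2)[OF x e[OF x]]
    have i: "inverse (cmod (f x)) \<le> inverse m" "inverse (cmod (f' x)) \<le> inverse m"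
      using m x by (auto intro!: le_imp_inverse_le)
    thus "cmod (inverse (f x)) \<le> inverse m" "cmod (inverse (f' x)) \<le> inverse m"
      by (simp_all add: norm_inverse)
    have nz: "f x \<noteq> 0" "f' x \<noteq> 0" using m(1) m(2)[OF x] m(3)[OF x] by auto
    have "cmod (inverse (f x) - inverse (f' x)) = cmod (f x - f' x) * (inverse (cmod (f x)) * inverse (cmod (f' x)))"
      using nz by (simp add: division_ring_inverse_diff norm_mult norm_inverse norm_minus_commute mult_ac)
    also have "\<dots> \<le> (M * e x) * (inverse m * inverse m)"
      using b i M(1) m(1) e[OF x] by (intro mult_mono) auto
    finally show "cmod (inverse (f x) - inverse (f' x)) \<le> M * inverse m ^ 2 * e x"
      by (simp add: power2_eq_square mult_ac)
  qed (use e in auto)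
qed

text \<open>Taylor's formula, with the second derivative bounded by compactness of the closed unit
  disc around \<open>z\<close>; the size of \<open>B\<close> never matters.\<close>

lemma entire_second_order:
  assumes "f holomorphic_on UNIV"
  shows "\<exists>B\<ge>0. \<forall>h. cmod h \<le> 1 \<longrightarrow> cmod (f (z + h) - f z - deriv f z * h) \<le> B * cmod h ^ 2"
proof -
  have holo: "(deriv ^^ i) f holomorphic_on UNIV" for i
    using assms by (intro holomorphic_higher_deriv) auto
  have "compact ((deriv ^^ 2) f ` cball z 1)"
    by (intro compact_continuous_image holomorphic_on_imp_continuous_on holomorphic_on_subset[OF holo]) auto
  then obtain B where B: "B > 0" "\<And>x. x \<in> cball z 1 \<Longrightarrow> cmod ((deriv ^^ 2) f x) \<le> B"
    using compact_imp_bounded bounded_pos by (metis imageI)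
  have "cmod (f (z + h) - f z - deriv f z * h) \<le> B * cmod h ^ 2" if h: "cmod h \<le> 1" for h
  proof -
    have "cmod ((deriv ^^ 0) f (z + h) - (\<Sum>i\<le>1. (deriv ^^ i) f z * (z + h - z) ^ i / fact i))
        \<le> B * cmod (z + h - z) ^ Suc 1 / fact 1"
    proof (rule complex_Taylor[where S = "cball z 1" and f = "\<lambda>i. (deriv ^^ i) f"])
      fix i x assume "x \<in> cball z 1"
      have "(deriv ^^ i) f field_differentiable at x"
        using holo holomorphic_on_open[of UNIV] by (auto simp: field_differentiable_def)
      thus "((deriv ^^ i) f has_field_derivative (deriv ^^ Suc i) f x) (at x within cball z 1)"
        by (simp add: DERIV_deriv_iff_field_differentiable has_field_derivative_at_within)
    qed (use B h in \<open>auto simp: numeral_2_eq_2 dist_norm\<close>)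
    thus ?thesis by (simp add: numeral_2_eq_2 diff_diff_eq)
  qed
  with B(1) show ?thesis by (intro exI[of _ B]) auto
qed

text \<open>Differentiating \<open>w sinhc_sqrt (w^2) = sinh w\<close> at \<open>w = i pi\<close>,
  where the undifferentiated term vanishes, leaves \<open>2 w^2\<close> times the derivative equal
  to \<open>cosh w = -1\<close>.\<close>

lemma sinhc_sqrt_at_neg_pi_square:
  "sinhc_sqrt (- of_real (pi\<^sup>2)) = 0" "cosh_sqrt (- of_real (pi\<^sup>2)) = -1"
  "deriv sinhc_sqrt (- of_real (pi\<^sup>2)) = of_real (1 / (2 * pi\<^sup>2))"
proof -
  define w where "w = \<i> * of_real pi"
  have w2: "w\<^sup>2 = - of_real (pi\<^sup>2)" by (simp add: w_def power_mult_distrib)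
  have cw: "cosh w = -1" by (simp add: w_def cosh_field_def exp_minus)
  show 0: "sinhc_sqrt (- of_real (pi\<^sup>2)) = 0"
    unfolding sinhc_sqrt_eq_0_iff by (intro exI[of _ 1]) auto
  show "cosh_sqrt (- of_real (pi\<^sup>2)) = -1"
    unfolding w2[symmetric] cosh_sqrt_square by (rule cw)
  have S: "(sinhc_sqrt has_field_derivative deriv sinhc_sqrt z) (at z)" for z
    using holomorphic_sinhc_sqrt[OF holomorphic_on_ident, of UNIV] by (intro holomorphic_derivI[of _ UNIV]) auto
  have "((\<lambda>w. w * sinhc_sqrt (w\<^sup>2)) has_field_derivative (1 * sinhc_sqrt (w\<^sup>2) + deriv sinhc_sqrt (w\<^sup>2) * (2 * w) * w)) (at w)"
    by (rule derivative_eq_intros DERIV_chain2[OF S] refl | simp)+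
  hence "(sinh has_field_derivative (1 * sinhc_sqrt (w\<^sup>2) + deriv sinhc_sqrt (w\<^sup>2) * (2 * w) * w)) (at w)"
    by (simp add: sinhc_sqrt_square)
  moreover have "(sinh has_field_derivative cosh w) (at w)" by (auto intro!: derivative_eq_intros)
  ultimately have "1 * sinhc_sqrt (w\<^sup>2) + deriv sinhc_sqrt (w\<^sup>2) * (2 * w) * w = -1"
    using DERIV_unique cw by metis
  hence "deriv sinhc_sqrt (w\<^sup>2) * (2 * w\<^sup>2) = -1"
    using 0 unfolding w2[symmetric] by (simp add: power2_eq_square[of w] mult_ac)
  thus "deriv sinhc_sqrt (- of_real (pi\<^sup>2)) = of_real (1 / (2 * pi\<^sup>2))"
    unfolding w2 by (simp add: field_simps eq_neg_iff_add_eq_0 add_eq_0_iff)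
qed

section \<open>Loop integrals and the Bessel series\<close>

lemma higher_deriv_exp_linear:
  "(deriv ^^ k) (\<lambda>v. exp (\<alpha> * (v - p))) = (\<lambda>v. \<alpha> ^ k * exp (\<alpha> * (v - p)))"
proof (induction k)
  case (Suc k)
  have "deriv (\<lambda>v. \<alpha> ^ k * exp (\<alpha> * (v - p))) v = \<alpha> ^ Suc k * exp (\<alpha> * (v - p))" for v
    by (rule DERIV_imp_deriv) (auto intro!: derivative_eq_intros)
  hence "deriv (\<lambda>v. \<alpha> ^ k * exp (\<alpha> * (v - p))) = (\<lambda>v. \<alpha> ^ Suc k * exp (\<alpha> * (v - p)))" by (rule ext)
  thus ?case by (simp only: funpow.simps o_apply Suc.IH)
qed auto

text \<open>Expand \<open>exp (\<beta> / (v - p))\<close>; the convergence is uniform on the circle.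
  Cauchy's formula for the derivative of order \<open>N - 1 + k\<close> evaluates the
  \<open>k\<close>-th term, since its pole has order \<open>N + k\<close>.\<close>

lemma loop_integral_exp_exp_inverse:
  assumes r: "r > 0" and N: "N \<ge> 1"
  shows "((\<lambda>v. exp (\<alpha> * (v - p)) * exp (\<beta> / (v - p)) / (v - p) ^ N) has_contour_integral
     2 * pi * \<i> * (\<Sum>k. \<alpha> ^ (N - 1 + k) * \<beta> ^ k / (fact k * fact (N - 1 + k)))) (circlepath p r)"
proof -
  define T where "T = (\<lambda>k v. exp (\<alpha> * (v - p)) / (v - p) ^ N * ((\<beta> / (v - p)) ^ k /\<^sub>R fact k))"
  define c where "c = (\<lambda>k. \<alpha> ^ (N - 1 + k) * \<beta> ^ k / (fact k * fact (N - 1 + k)))"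
  define F where "F = (\<lambda>v. exp (\<alpha> * (v - p)) * exp (\<beta> / (v - p)) / (v - p) ^ N)"
  have T: "(T k has_contour_integral 2 * pi * \<i> * c k) (circlepath p r)" for k
  proof -
    have "((\<lambda>v. exp (\<alpha> * (v - p)) / (v - p) ^ Suc (N - 1 + k)) has_contour_integral
        (2 * pi * \<i>) / fact (N - 1 + k) * (deriv ^^ (N - 1 + k)) (\<lambda>v. exp (\<alpha> * (v - p))) p) (circlepath p r)"
      using r by (intro Cauchy_has_contour_integral_higher_derivative_circlepath)
        (auto intro!: continuous_intros holomorphic_intros)
    moreover have "Suc (N - 1 + k) = N + k" using N by simp
    ultimately have "((\<lambda>v. exp (\<alpha> * (v - p)) / (v - p) ^ (N + k)) has_contour_integral
        (2 * pi * \<i>) / fact (N - 1 + k) * (\<alpha> ^ (N - 1 + k) * exp (\<alpha> * (p - p)))) (circlepath p r)"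
      by (simp only: higher_deriv_exp_linear)
    from has_contour_integral_lmul[OF this, of "\<beta> ^ k / fact k"]
    have "((\<lambda>v. \<beta> ^ k / fact k * (exp (\<alpha> * (v - p)) / (v - p) ^ (N + k))) has_contour_integral 2 * pi * \<i> * c k) (circlepath p r)"
      by (simp add: c_def mult_ac)
    also have "(\<lambda>v. \<beta> ^ k / fact k * (exp (\<alpha> * (v - p)) / (v - p) ^ (N + k))) = T k"
      by (simp add: fun_eq_iff T_def power_add power_divide scaleR_conv_of_real field_simps)
    finally show ?thesis .
  qed
  have ul: "uniform_limit (sphere p r) (\<lambda>n v. \<Sum>k<n. T k v) F sequentially"
  proof -
    have bd: "cmod (exp (\<alpha> * (v - p)) / (v - p) ^ N) \<le> exp (cmod \<alpha> * r) / r ^ N" if "v \<in> sphere p r" for v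
    proof -
      have "cmod (v - p) = r" using that by (simp add: dist_norm norm_minus_commute)
      moreover have "Re (\<alpha> * (v - p)) \<le> cmod \<alpha> * cmod (v - p)"
        using complex_Re_le_cmod[of "\<alpha> * (v - p)"] by (simp add: norm_mult)
      ultimately show ?thesis using r by (simp add: norm_divide norm_power divide_right_mono)
    qed
    have "uniform_limit (sphere p r) (\<lambda>n v. \<Sum>k<n. T k v) (\<lambda>v. \<Sum>k. T k v) sequentially"
    proof (rule Weierstrass_m_test)
      show "norm (T k v) \<le> exp (cmod \<alpha> * r) / r ^ N * ((cmod \<beta> / r) ^ k /\<^sub>R fact k)" if "v \<in> sphere p r" for k v
      proof -
        have "cmod (v - p) = r" using that by (simp add: dist_norm norm_minus_commute)
        hence "norm (T k v) = cmod (exp (\<alpha> * (v - p)) / (v - p) ^ N) * ((cmod \<beta> / r) ^ k /\<^sub>R fact k)"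
          by (simp add: T_def norm_mult norm_divide norm_power power_divide)
        also have "\<dots> \<le> exp (cmod \<alpha> * r) / r ^ N * ((cmod \<beta> / r) ^ k /\<^sub>R fact k)"
          using bd[OF that] r by (intro mult_right_mono) auto
        finally show ?thesis .
      qed
      show "summable (\<lambda>k. exp (cmod \<alpha> * r) / r ^ N * ((cmod \<beta> / r) ^ k /\<^sub>R fact k))"
        by (intro summable_mult summable_exp_generic)
    qed
    moreover have "(\<Sum>k. T k v) = F v" for v
    proof -
      have "(\<lambda>k. T k v) sums (exp (\<alpha> * (v - p)) / (v - p) ^ N * exp (\<beta> / (v - p)))"
        unfolding T_def by (intro sums_mult exp_converges)
      thus ?thesis by (simp add: F_def sums_iff)
    qed
    ultimately show ?thesis by simp
  qed
  have sumI: "((\<lambda>v. \<Sum>k<n. T k v) has_contour_integral (\<Sum>k<n. 2 * pi * \<i> * c k)) (circlepath p r)" for n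
    using T by (intro has_contour_integral_sum) auto
  have ev: "\<forall>\<^sub>F n in sequentially. (\<lambda>v. \<Sum>k<n. T k v) contour_integrable_on circlepath p r"
    using sumI by (intro always_eventually) (auto simp: contour_integrable_on_def)
  note lim = contour_integral_uniform_limit_circlepath[OF ev ul _ r]
  have "(\<lambda>n. \<Sum>k<n. 2 * pi * \<i> * c k) \<longlonglongrightarrow> contour_integral (circlepath p r) F"
    using lim(2) contour_integral_unique[OF sumI] by simp
  hence "(\<lambda>k. 2 * pi * \<i> * c k) sums contour_integral (circlepath p r) F" by (simp add: sums_def)
  hence "contour_integral (circlepath p r) F = (\<Sum>k. 2 * pi * \<i> * c k)" by (simp add: sums_iff)
  also have "\<dots> = 2 * pi * \<i> * (\<Sum>k. c k)"
  proof (rule suminf_mult)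
    show "summable c" using \<open>(\<lambda>k. 2 * pi * \<i> * c k) sums _\<close>
      by (auto simp: sums_iff dest: summable_mult_D)
  qed
  finally show ?thesis
    using lim(1) has_contour_integral_integral unfolding F_def c_def by force
qed

text \<open>This is \<open>I_(N-1)(\<kappa>)\<close> divided by \<open>(\<kappa>/2)^(N-1)\<close>.
  Without that power the series stays positive at \<open>\<kappa> = 0\<close>, so one estimate can
  reach both regimes.\<close>

definition loop_series :: "nat \<Rightarrow> real \<Rightarrow> real" where
  "loop_series N \<kappa> = (\<Sum>k. (\<kappa>\<^sup>2 / 4) ^ k / (fact k * fact (N - 1 + k)))"

text \<open>Comparison with the exponential series from above and with the term \<open>k = 0\<close>
  from below. The lower bound, uniform in \<open>\<kappa>\<close>, is what later turns absolute
  errors into relative ones.\<close>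

lemma summable_loop_series: "summable (\<lambda>k. (\<kappa>\<^sup>2 / 4) ^ k / (fact k * fact (N - 1 + k) :: real))"
  and loop_series_le: "loop_series N \<kappa> \<le> exp (\<kappa>\<^sup>2 / 4)"
  and loop_series_ge: "loop_series N \<kappa> \<ge> 1 / fact (N - 1)"
proof -
  define a where "a = (\<lambda>k. (\<kappa>\<^sup>2 / 4) ^ k / (fact k * fact (N - 1 + k) :: real))"
  have e: "(\<lambda>k. (\<kappa>\<^sup>2 / 4) ^ k /\<^sub>R fact k) sums exp (\<kappa>\<^sup>2 / 4)" by (rule exp_converges)
  have a: "a k \<ge> 0" "a k \<le> (\<kappa>\<^sup>2 / 4) ^ k /\<^sub>R fact k" for k
  proof -
    show "a k \<ge> 0" by (simp add: a_def)
    have "fact k * 1 \<le> (fact k * fact (N - 1 + k) :: real)"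
      by (intro mult_left_mono fact_ge_1) auto
    hence "a k \<le> (\<kappa>\<^sup>2 / 4) ^ k / fact k" unfolding a_def by (intro divide_left_mono) auto
    thus "a k \<le> (\<kappa>\<^sup>2 / 4) ^ k /\<^sub>R fact k" by (simp only: real_scaleR_def divide_inverse mult.commute)
  qed
  have s: "summable a"
    by (rule summable_comparison_test'[OF sums_summable[OF e], of 0]) (use a in auto)
  thus "summable (\<lambda>k. (\<kappa>\<^sup>2 / 4) ^ k / (fact k * fact (N - 1 + k) :: real))" by (simp add: a_def)
  have "suminf a \<le> exp (\<kappa>\<^sup>2 / 4)"
    unfolding sums_unique[OF e] by (intro suminf_le a s sums_summable[OF e])
  thus "loop_series N \<kappa> \<le> exp (\<kappa>\<^sup>2 / 4)" by (simp add: loop_series_def a_def)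
  have "sum a {0} \<le> suminf a" using a s by (intro sum_le_suminf) auto
  thus "loop_series N \<kappa> \<ge> 1 / fact (N - 1)" by (simp add: loop_series_def a_def)
qed

text \<open>The case \<open>\<beta> = \<kappa>^2 / (4 \<alpha>)\<close>, in which the powers of
  \<open>\<alpha>\<close> in the series collapse to \<open>\<alpha>^(N-1)\<close>. The integrand
  depends on \<open>v\<close> only through \<open>u = \<alpha> (v - p)\<close>, the form in which
  the limit near the pole appears.\<close>

lemma loop_integral_loop_series:
  assumes r: "r > 0" and N: "N \<ge> 1" and \<alpha>: "\<alpha> \<noteq> 0"
  shows "((\<lambda>v. exp (\<alpha> * (v - p)) * exp (of_real (\<kappa>\<^sup>2 / 4) / (\<alpha> * (v - p))) * (of_real pi / (\<alpha> * (v - p))) ^ N) has_contour_integral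
     2 * pi * \<i> / \<alpha> * of_real (pi ^ N * loop_series N \<kappa>)) (circlepath p r)"
proof -
  define c where "c = complex_of_real (\<kappa>\<^sup>2 / 4)"
  have "(\<Sum>k. \<alpha> ^ (N - 1 + k) * (c / \<alpha>) ^ k / (fact k * fact (N - 1 + k)))
      = (\<Sum>k. \<alpha> ^ (N - 1) * of_real ((\<kappa>\<^sup>2 / 4) ^ k / (fact k * fact (N - 1 + k))))"
    using \<alpha> by (intro suminf_cong) (simp add: power_add power_divide c_def field_simps)
  also have "\<dots> = \<alpha> ^ (N - 1) * of_real (loop_series N \<kappa>)"
    using summable_loop_series[of \<kappa> N] unfolding loop_series_def
    by (subst suminf_mult) (auto simp: suminf_of_real summable_of_real simp del: of_real_divide)
  finally have S: "(\<Sum>k. \<alpha> ^ (N - 1 + k) * (c / \<alpha>) ^ k / (fact k * fact (N - 1 + k))) = \<alpha> ^ (N - 1) * of_real (loop_series N \<kappa>)" .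
  have \<alpha>N: "\<alpha> ^ N = \<alpha> * \<alpha> ^ (N - 1)" using N by (cases N) auto
  have "((\<lambda>v. (of_real pi / \<alpha>) ^ N * (exp (\<alpha> * (v - p)) * exp ((c / \<alpha>) / (v - p)) / (v - p) ^ N)) has_contour_integral
     (of_real pi / \<alpha>) ^ N * (2 * pi * \<i> * (\<alpha> ^ (N - 1) * of_real (loop_series N \<kappa>)))) (circlepath p r)"
    using loop_integral_exp_exp_inverse[OF r N, of \<alpha> p "c / \<alpha>"] unfolding S
    by (rule has_contour_integral_lmul)
  also have "(of_real pi / \<alpha>) ^ N * (2 * pi * \<i> * (\<alpha> ^ (N - 1) * of_real (loop_series N \<kappa>)))
      = 2 * pi * \<i> / \<alpha> * of_real (pi ^ N * loop_series N \<kappa>)"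
    using \<alpha> by (simp add: power_divide \<alpha>N)
  also have "(\<lambda>v. (of_real pi / \<alpha>) ^ N * (exp (\<alpha> * (v - p)) * exp ((c / \<alpha>) / (v - p)) / (v - p) ^ N))
     = (\<lambda>v. exp (\<alpha> * (v - p)) * exp (of_real (\<kappa>\<^sup>2 / 4) / (\<alpha> * (v - p))) * (of_real pi / (\<alpha> * (v - p))) ^ N)"
    by (simp add: fun_eq_iff power_divide power_mult_distrib c_def mult.assoc)
  finally show ?thesis .
qed

text \<open>The line integrand on the circle of radius \<open>pi / (a t)\<close> around \<open>i a\<close>, stripped of the factors \<open>exp (- t a)\<close>,
  \<open>(i a)^k2\<close> and \<open>t^N\<close>, with \<open>R = \<kappa>^2 / (4 pi t)\<close>. Shrinking the radius like \<open>1/a\<close> keeps \<open>v^2 + q\<close> within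
  \<open>O (1/t)\<close> of \<open>- pi^2\<close> uniformly in \<open>q\<close>.\<close>

definition pole_integrand :: "nat \<Rightarrow> nat \<Rightarrow> nat \<Rightarrow> real \<times> real \<times> complex \<times> real \<Rightarrow> complex" where
  "pole_integrand N k1 k2 = (\<lambda>(t, q, u, \<kappa>).
     let b = inverse (sqrt (pi\<^sup>2 + q));
         z = - of_real (pi\<^sup>2) + (of_real (2 * pi / t) * u - of_real ((pi * b / t)\<^sup>2) * u\<^sup>2);
         s = inverse (of_real t * sinhc_sqrt z)
     in exp (of_real (pi * b) * u) * (1 - of_real (pi * b\<^sup>2 / t) * u) ^ k2
        * exp (- of_real (\<kappa>\<^sup>2 / (4 * pi)) * (cosh_sqrt z * s)) * cosh_sqrt z ^ k1 * s ^ N)"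

text \<open>What \<open>pole_integrand\<close> becomes for \<open>q = 0\<close> as \<open>t\<close>
  tends to infinity: \<open>b\<close> is then \<open>1 / pi\<close>, \<open>cosh_sqrt z\<close>
  tends to \<open>-1\<close> and \<open>s\<close> to \<open>pi / u\<close>. The two signs cancel in
  the exponent, giving \<open>\<kappa>^2 / (4 u)\<close>.\<close>

definition pole_limit :: "nat \<Rightarrow> nat \<Rightarrow> real \<times> real \<times> complex \<times> real \<Rightarrow> complex" where
  "pole_limit N k1 = (\<lambda>(t, q, u, \<kappa>).
     exp u * exp (of_real (\<kappa>\<^sup>2 / 4) / u) * (-1) ^ k1 * (of_real pi / u) ^ N)"

section \<open>The integrand on the small circle\<close>

lemma sqrt_pi_square_bounds:
  assumes "q \<ge> 0"
  shows "pi \<le> sqrt (pi\<^sup>2 + q)" "(sqrt (pi\<^sup>2 + q) - pi) * (sqrt (pi\<^sup>2 + q) + pi) = q"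
    "sqrt (pi\<^sup>2 + q) - pi \<le> q"
proof -
  define a where "a = sqrt (pi\<^sup>2 + q)"
  have a2: "a\<^sup>2 = pi\<^sup>2 + q" using assms by (simp add: a_def)
  have a: "a \<ge> pi" using assms unfolding a_def by (intro real_le_rsqrt) simp
  have aq: "(a - pi) * (a + pi) = q" using a2 by (simp add: power2_eq_square algebra_simps)
  have "(a - pi) * 1 \<le> (a - pi) * (a + pi)"
  proof (rule mult_left_mono)
    show "1 \<le> a + pi" using a pi_ge_two by linarith
  qed (use a in simp)
  thus "pi \<le> sqrt (pi\<^sup>2 + q)" "(sqrt (pi\<^sup>2 + q) - pi) * (sqrt (pi\<^sup>2 + q) + pi) = q"
    "sqrt (pi\<^sup>2 + q) - pi \<le> q"
    using a aq unfolding a_def by (simp_all only: mult_1_right)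
qed

lemma inverse_sqrt_pi_square_bounds:
  assumes "q \<ge> 0"
  shows "0 < inverse (sqrt (pi\<^sup>2 + q))" "inverse (sqrt (pi\<^sup>2 + q)) \<le> 1"
    "pi * inverse (sqrt (pi\<^sup>2 + q)) \<le> 1" "\<bar>inverse (sqrt (pi\<^sup>2 + q)) - 1 / pi\<bar> \<le> q / pi"
proof -
  define a where "a = sqrt (pi\<^sup>2 + q)"
  have a: "a \<ge> pi" and q: "a - pi \<le> q" unfolding a_def by (rule sqrt_pi_square_bounds[OF assms])+
  have a0: "a \<ge> 1" using a pi_ge_two by linarith
  have "0 < inverse a \<and> inverse a \<le> 1 \<and> pi * inverse a \<le> 1 \<and> \<bar>inverse a - 1 / pi\<bar> \<le> q / pi"
  proof (intro conjI)
    show "0 < inverse a" "inverse a \<le> 1" using a0 by (simp_all add: inverse_le_1_iff)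
    show "pi * inverse a \<le> 1" using a a0 by (simp flip: divide_inverse)
    have "\<bar>inverse a - 1 / pi\<bar> = inverse a * ((a - pi) / pi)"
      using a a0 by (simp add: abs_if field_simps)
    also have "\<dots> \<le> 1 * (q / pi)"
      using a a0 q by (intro mult_mono divide_right_mono) (auto simp: inverse_le_1_iff)
    finally show "\<bar>inverse a - 1 / pi\<bar> \<le> q / pi" by simp
  qed
  thus "0 < inverse (sqrt (pi\<^sup>2 + q))" "inverse (sqrt (pi\<^sup>2 + q)) \<le> 1"
    "pi * inverse (sqrt (pi\<^sup>2 + q)) \<le> 1" "\<bar>inverse (sqrt (pi\<^sup>2 + q)) - 1 / pi\<bar> \<le> q / pi"
    by (simp_all add: a_def)
qed

text \<open>Each factor is compared with its limit, and the calculus of \<open>approx_on\<close>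
  assembles the product. Taylor expansion at \<open>- pi^2\<close> gives
  \<open>t sinhc_sqrt z = u / pi + O(1/t)\<close> and \<open>cosh_sqrt z = -1 + O(1/t)\<close>,
  uniformly in \<open>q\<close>.\<close>

lemma pole_integrand_approx:
  assumes "K \<ge> 0"
  shows "\<exists>T\<ge>9. approx_on {(t, q, u, \<kappa>). t \<ge> T \<and> q \<ge> 0 \<and> cmod u = 1 \<and> 0 \<le> \<kappa> \<and> \<kappa> \<le> K}
     (\<lambda>(t, q, u, \<kappa>). 1 / t + q) (pole_integrand N k1 k2) (pole_limit N k1)"
proof -
  define z0 where "z0 = - complex_of_real (pi\<^sup>2)"
  note at_z0 = sinhc_sqrt_at_neg_pi_square[folded z0_def]
  obtain B where "B \<ge> 0" and B': "\<forall>h. cmod h \<le> 1 \<longrightarrow>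
      cmod (sinhc_sqrt (z0 + h) - sinhc_sqrt z0 - deriv sinhc_sqrt z0 * h) \<le> B * cmod h ^ 2"
    using entire_second_order[OF holomorphic_sinhc_sqrt[OF holomorphic_on_ident], of z0] by blast
  hence B: "B \<ge> 0" "cmod h \<le> 1 \<Longrightarrow> cmod (sinhc_sqrt (z0 + h) - of_real (1 / (2 * pi\<^sup>2)) * h) \<le> B * cmod h ^ 2" for h
    unfolding at_z0 diff_0_right by blast+
  obtain D where D: "D \<ge> 0" "\<And>h. cmod h \<le> 1 \<Longrightarrow> cmod (cosh_sqrt (z0 + h) + 1) \<le> D * cmod h"
  proof -
    obtain D where D: "D \<ge> 0" "\<forall>h. cmod h \<le> 1 \<longrightarrow>
        cmod (cosh_sqrt (z0 + h) - cosh_sqrt z0 - deriv cosh_sqrt z0 * h) \<le> D * cmod h ^ 2"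
      using entire_second_order[OF holomorphic_cosh_sqrt[OF holomorphic_on_ident], of z0] by blast
    have "cmod (cosh_sqrt (z0 + h) + 1) \<le> (D + cmod (deriv cosh_sqrt z0)) * cmod h" if "cmod h \<le> 1" for h
    proof -
      have "cmod (cosh_sqrt (z0 + h) - cosh_sqrt z0 - deriv cosh_sqrt z0 * h + deriv cosh_sqrt z0 * h)
          \<le> D * cmod h ^ 2 + cmod (deriv cosh_sqrt z0 * h)"
        using D(2) that by (intro norm_triangle_le) auto
      also have "D * cmod h ^ 2 \<le> D * cmod h"
        using D(1) that by (intro mult_left_mono) (auto simp: power2_eq_square mult_left_le)
      finally show ?thesis by (simp add: at_z0 norm_mult distrib_right)
    qed
    moreover have "D + cmod (deriv cosh_sqrt z0) \<ge> 0" using D(1) by simp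
    ultimately show ?thesis using that by blast
  qed
  \<comment> \<open>The increment \<open>h\<close> has modulus at most
    \<open>(2 pi + 1) / t \<le> 9 / t\<close>; its square yields \<open>81 B / t\<close> from the
    Taylor remainder after multiplication by \<open>t\<close>, and the quadratic part of
    \<open>h\<close> adds at most \<open>1 / t\<close>.\<close>
  define L where "L = 81 * B + 1"
  have L: "L \<ge> 1" using B(1) by (simp add: L_def)
  \<comment> \<open>Ensures both \<open>|h| \<le> 1\<close> and \<open>L / t \<le> 1/8\<close>. The
    latter keeps \<open>t sinhc_sqrt z\<close> away from zero, because its limit
    \<open>u / pi\<close> has modulus at least \<open>1/4\<close>.\<close>
  define T where "T = 9 * L"
  define X where "X = {(t, q::real, u, \<kappa>). t \<ge> T \<and> q \<ge> 0 \<and> cmod u = 1 \<and> 0 \<le> \<kappa> \<and> \<kappa> \<le> K}"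
  define e :: "real \<times> real \<times> complex \<times> real \<Rightarrow> real" where "e = (\<lambda>(t, q, u, \<kappa>). 1 / t + q)"
  define b where "b = (\<lambda>q. inverse (sqrt (pi\<^sup>2 + q)))"
  define h where "h = (\<lambda>(t, q::real, u::complex, \<kappa>::real). of_real (2 * pi / t) * u - of_real ((pi * b q / t)\<^sup>2) * u\<^sup>2)"
  have T9: "T \<ge> 9" using L by (simp add: T_def)
  have XE: thesis if "x \<in> X"
    "\<And>t q u \<kappa>. x = (t, q, u, \<kappa>) \<Longrightarrow> t \<ge> T \<Longrightarrow> q \<ge> 0 \<Longrightarrow> cmod u = 1 \<Longrightarrow> t > 0 \<Longrightarrow> t \<ge> 1 \<Longrightarrow> thesis" for x thesis
    using that T9 by (cases x) (auto simp: X_def)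
  have e0: "e x \<ge> 0" if "x \<in> X" for x using that T9 by (auto simp: e_def X_def)
  have b: "0 < b q" "b q \<le> 1" "pi * b q \<le> 1" "\<bar>b q - 1 / pi\<bar> \<le> q / pi" if "q \<ge> 0" for q
    unfolding b_def using inverse_sqrt_pi_square_bounds[OF that] .
  have pi9: "2 * pi + 1 \<le> 9" using pi_less_4 by simp
  have h: "cmod (h (t, q, u, \<kappa>)) \<le> 9 / t" "cmod (h (t, q, u, \<kappa>)) \<le> 1" if "(t, q, u, \<kappa>) \<in> X" for t q u \<kappa>
  proof -
    have x: "t \<ge> T" "q \<ge> 0" "cmod u = 1" "t > 0" "t \<ge> 1" using that T9 by (auto simp: X_def)
    have "(pi * b q / t)\<^sup>2 \<le> (1 / t)\<^sup>2"
      using x b[OF x(2)] by (intro power_mono divide_right_mono) auto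
    also have "\<dots> \<le> 1 / t" using x by (simp add: power2_eq_square divide_simps)
    finally have "cmod (h (t, q, u, \<kappa>)) \<le> 2 * pi / t + 1 / t"
      unfolding h_def using x b(1)[OF x(2)] by (simp, intro norm_triangle_le_diff) (simp add: norm_mult norm_power norm_divide)
    also have "\<dots> = (2 * pi + 1) / t" by (rule add_divide_distrib[symmetric])
    also have "\<dots> \<le> 9 / t" using pi9 x by (intro divide_right_mono) auto
    finally show "cmod (h (t, q, u, \<kappa>)) \<le> 9 / t" .
    also have "\<dots> \<le> 1" using x T9 by simp
    finally show "cmod (h (t, q, u, \<kappa>)) \<le> 1" .
  qed
  have S: "cmod (of_real t * sinhc_sqrt (z0 + h (t, q, u, \<kappa>)) - u / of_real pi) \<le> L * (1 / t)"
    if "(t, q, u, \<kappa>) \<in> X" for t q u \<kappa>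
  proof -
    have x: "t \<ge> T" "q \<ge> 0" "cmod u = 1" "t > 0" "t \<ge> 1" using that T9 by (auto simp: X_def)
    let ?h = "h (t, q, u, \<kappa>)"
    have "cmod (sinhc_sqrt (z0 + ?h) - of_real (1 / (2 * pi\<^sup>2)) * ?h) \<le> B * (9 / t)\<^sup>2"
      using B(2)[OF h(2)[OF that]] B(1) h(1)[OF that] by (meson mult_left_mono norm_ge_zero order.trans power_mono)
    hence "cmod (of_real t * (sinhc_sqrt (z0 + ?h) - of_real (1 / (2 * pi\<^sup>2)) * ?h)) \<le> t * (B * (9 / t)\<^sup>2)"
      unfolding norm_mult using x by (simp add: mult_left_mono)
    also have "\<dots> = 81 * B * (1 / t)" using x by (simp add: power2_eq_square)
    finally have 1: "cmod (of_real t * (sinhc_sqrt (z0 + ?h) - of_real (1 / (2 * pi\<^sup>2)) * ?h)) \<le> 81 * B * (1 / t)" .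
    have "of_real t * (of_real (1 / (2 * pi\<^sup>2)) * ?h) - u / of_real pi = - (of_real ((b q)\<^sup>2 / (2 * t)) * u\<^sup>2)"
      using x by (simp add: h_def field_simps power2_eq_square)
    hence "cmod (of_real t * (of_real (1 / (2 * pi\<^sup>2)) * ?h) - u / of_real pi) = (b q)\<^sup>2 / (2 * t)"
      using x by (simp add: norm_mult norm_divide norm_power)
    also have "\<dots> \<le> 1 / t"
      using b[OF x(2)] x power_mono[of "b q" 1 2] by (simp add: divide_simps)
    finally have "cmod (of_real t * (sinhc_sqrt (z0 + ?h) - of_real (1 / (2 * pi\<^sup>2)) * ?h)
        + (of_real t * (of_real (1 / (2 * pi\<^sup>2)) * ?h) - u / of_real pi)) \<le> 81 * B * (1 / t) + 1 / t"
      using 1 by (intro norm_triangle_le add_mono)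
    thus ?thesis by (simp add: L_def algebra_simps)
  qed
  have norm_upi: "cmod (u / of_real pi) \<le> 1" if "cmod u = 1" for u
    using that pi_ge_two by (simp add: norm_divide)
  have aS: "approx_on X e (\<lambda>x. of_real (fst x) * sinhc_sqrt (z0 + h x)) (\<lambda>x. fst (snd (snd x)) / of_real pi)"
  proof (rule approx_onI[where A = "L + 1" and B = 1 and C = L, OF _ _ _ e0])
    fix x assume x: "x \<in> X"
    from XE[OF this] obtain t q u \<kappa> where [simp]: "x = (t, q, u, \<kappa>)"
      and y: "t \<ge> T" "q \<ge> 0" "cmod u = 1" "t > 0" "t \<ge> 1" .
    have s: "cmod (of_real t * sinhc_sqrt (z0 + h x) - u / of_real pi) \<le> L * (1 / t)"
      using S x by simp
    also have "\<dots> \<le> L * e x" using L y by (intro mult_left_mono) (auto simp: e_def)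
    finally show "cmod (of_real (fst x) * sinhc_sqrt (z0 + h x) - fst (snd (snd x)) / of_real pi) \<le> L * e x" by simp
    have "L * (1 / t) \<le> L * 1" using L y by (intro mult_left_mono) auto
    hence "cmod (of_real t * sinhc_sqrt (z0 + h x) - u / of_real pi + u / of_real pi) \<le> L + 1"
      using s norm_upi[OF y(3)] by (intro norm_triangle_le) linarith
    thus "cmod (of_real (fst x) * sinhc_sqrt (z0 + h x)) \<le> L + 1" by simp
    show "cmod (fst (snd (snd x)) / of_real pi) \<le> 1" using norm_upi y by simp
  qed
  have aSi: "approx_on X e (\<lambda>x. inverse (of_real (fst x) * sinhc_sqrt (z0 + h x))) (\<lambda>x. inverse (fst (snd (snd x)) / of_real pi))"
  proof (rule approx_on_inverse[OF aS e0, of "1/8"])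
    fix x assume x: "x \<in> X"
    from XE[OF this] obtain t q u \<kappa> where [simp]: "x = (t, q, u, \<kappa>)"
      and y: "t \<ge> T" "q \<ge> 0" "cmod u = 1" "t > 0" "t \<ge> 1" .
    have "cmod (u / of_real pi) = 1 / pi" using y by (simp add: norm_divide)
    also have "\<dots> \<ge> 1/4" using pi_less_4 by (simp add: divide_simps)
    finally have u: "cmod (u / of_real pi) \<ge> 1/4" .
    thus "1/8 \<le> cmod (fst (snd (snd x)) / of_real pi)" by simp
    have "cmod (of_real t * sinhc_sqrt (z0 + h x) - u / of_real pi) \<le> L * (1 / t)"
      using S x by simp
    also have "\<dots> \<le> 1/8" using y L by (simp add: T_def divide_simps)
    finally have "cmod (u / of_real pi - of_real t * sinhc_sqrt (z0 + h x)) \<le> 1/8"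
      by (simp add: norm_minus_commute)
    with u norm_triangle_ineq2[of "u / of_real pi" "of_real t * sinhc_sqrt (z0 + h x)"]
    have "1/8 \<le> cmod (of_real t * sinhc_sqrt (z0 + h x))"
      unfolding norm_minus_commute[of "u / of_real pi"] by linarith
    thus "1/8 \<le> cmod (of_real (fst x) * sinhc_sqrt (z0 + h x))" by simp
  qed auto
  have aC: "approx_on X e (\<lambda>x. cosh_sqrt (z0 + h x)) (\<lambda>x. -1)"
  proof (rule approx_onI[where A = "9 * D + 1" and B = 1 and C = "9 * D", OF _ _ _ e0])
    fix x assume x: "x \<in> X"
    from XE[OF this] obtain t q u \<kappa> where [simp]: "x = (t, q, u, \<kappa>)"
      and y: "t \<ge> T" "q \<ge> 0" "cmod u = 1" "t > 0" "t \<ge> 1" .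
    have zx: "cmod (h x) \<le> 9 / t" "cmod (h x) \<le> 1" using h[of t q u \<kappa>] x by simp_all
    have "cmod (cosh_sqrt (z0 + h x) + 1) \<le> D * (9 / t)"
      by (rule order.trans[OF D(2)[OF zx(2)] mult_left_mono[OF zx(1) D(1)]])
    also have "\<dots> = 9 * D * (1 / t)" by simp
    finally have c: "cmod (cosh_sqrt (z0 + h x) + 1) \<le> 9 * D * (1 / t)" .
    also have "\<dots> \<le> 9 * D * e x" using D y by (intro mult_left_mono) (auto simp: e_def)
    finally show "cmod (cosh_sqrt (z0 + h x) - (-1)) \<le> 9 * D * e x" by simp
    have "9 * D * (1 / t) \<le> 9 * D * 1" using D y by (intro mult_left_mono) auto
    hence "cmod (cosh_sqrt (z0 + h x) + 1 + (-1)) \<le> 9 * D + 1"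
      using c by (intro norm_triangle_le) simp
    thus "cmod (cosh_sqrt (z0 + h x)) \<le> 9 * D + 1" by simp
  qed simp
  \<comment> \<open>The only factor whose error is governed by \<open>q\<close> instead of
    \<open>1/t\<close>: it compares \<open>pi / sqrt (pi^2 + q)\<close> with
    \<open>1\<close>.\<close>
  have aU: "approx_on X e (\<lambda>x. of_real (pi * b (fst (snd x))) * fst (snd (snd x))) (\<lambda>x. fst (snd (snd x)))"
  proof (rule approx_onI[where A = 1 and B = 1 and C = 1, OF _ _ _ e0])
    fix x assume x: "x \<in> X"
    from XE[OF this] obtain t q u \<kappa> where [simp]: "x = (t, q, u, \<kappa>)"
      and y: "t \<ge> T" "q \<ge> 0" "cmod u = 1" "t > 0" "t \<ge> 1" .
    show "cmod (of_real (pi * b (fst (snd x))) * fst (snd (snd x))) \<le> 1"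
      using y b[OF y(2)] by (simp add: norm_mult)
    show "cmod (fst (snd (snd x))) \<le> 1" using y by simp
    have "of_real (pi * b q) * u - u = of_real (pi * (b q - 1 / pi)) * u" by (simp add: algebra_simps)
    hence "cmod (of_real (pi * b q) * u - u) = pi * \<bar>b q - 1 / pi\<bar>"
      using y by (simp add: norm_mult abs_mult del: of_real_mult of_real_diff)
    also have "\<dots> \<le> pi * (q / pi)" using b[OF y(2)] by (intro mult_left_mono) auto
    also have "\<dots> \<le> e x" using y by (simp add: e_def)
    finally show "cmod (of_real (pi * b (fst (snd x))) * fst (snd (snd x)) - fst (snd (snd x))) \<le> 1 * e x" by simp
  qed
  have aV: "approx_on X e (\<lambda>x. 1 - of_real (pi * (b (fst (snd x)))\<^sup>2 / fst x) * fst (snd (snd x))) (\<lambda>x. 1)"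
  proof (rule approx_onI[where A = 2 and B = 1 and C = 1, OF _ _ _ e0])
    fix x assume x: "x \<in> X"
    from XE[OF this] obtain t q u \<kappa> where [simp]: "x = (t, q, u, \<kappa>)"
      and y: "t \<ge> T" "q \<ge> 0" "cmod u = 1" "t > 0" "t \<ge> 1" .
    have "pi * b q * b q \<le> 1 * 1" using b[OF y(2)] by (intro mult_mono) auto
    hence "cmod (of_real (pi * (b q)\<^sup>2 / t) * u) \<le> 1 / t"
      using y b[OF y(2)] by (simp add: norm_mult norm_divide norm_power power2_eq_square divide_right_mono mult.assoc)
    moreover have "1 / t \<le> e x" "1 / t \<le> 1" using y by (auto simp: e_def)
    ultimately have *: "cmod (of_real (pi * (b q)\<^sup>2 / t) * u) \<le> e x" "cmod (of_real (pi * (b q)\<^sup>2 / t) * u) \<le> 1"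
      by linarith+
    show "cmod (1 - of_real (pi * (b (fst (snd x)))\<^sup>2 / fst x) * fst (snd (snd x)) - 1) \<le> 1 * e x" using *(1) by simp
    show "cmod (1 - of_real (pi * (b (fst (snd x)))\<^sup>2 / fst x) * fst (snd (snd x))) \<le> 2"
      using *(2) norm_triangle_ineq4[of 1 "of_real (pi * (b q)\<^sup>2 / t) * u"] by simp
  qed simp
  have aK: "approx_on X e (\<lambda>x. - of_real ((snd (snd (snd x)))\<^sup>2 / (4 * pi))) (\<lambda>x. - of_real ((snd (snd (snd x)))\<^sup>2 / (4 * pi)))"
  proof (rule approx_on_refl[where A = "K\<^sup>2 / (4 * pi)", OF _ e0])
    fix x assume "x \<in> X"
    thus "cmod (- of_real ((snd (snd (snd x)))\<^sup>2 / (4 * pi))) \<le> K\<^sup>2 / (4 * pi)"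
      by (auto simp: X_def norm_divide norm_mult norm_power intro!: divide_right_mono power_mono)
  qed
  have "pole_integrand N k1 k2 = (\<lambda>x. exp (of_real (pi * b (fst (snd x))) * fst (snd (snd x)))
        * (1 - of_real (pi * (b (fst (snd x)))\<^sup>2 / fst x) * fst (snd (snd x))) ^ k2
        * exp (- of_real ((snd (snd (snd x)))\<^sup>2 / (4 * pi)) * (cosh_sqrt (z0 + h x) * inverse (of_real (fst x) * sinhc_sqrt (z0 + h x))))
        * cosh_sqrt (z0 + h x) ^ k1 * inverse (of_real (fst x) * sinhc_sqrt (z0 + h x)) ^ N)"
    by (simp add: fun_eq_iff pole_integrand_def Let_def b_def z0_def h_def)
  moreover have "pole_limit N k1 = (\<lambda>x. exp (fst (snd (snd x))) * 1 ^ k2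
        * exp (- of_real ((snd (snd (snd x)))\<^sup>2 / (4 * pi)) * ((-1) * inverse (fst (snd (snd x)) / of_real pi)))
        * (-1) ^ k1 * inverse (fst (snd (snd x)) / of_real pi) ^ N)"
    by (simp add: fun_eq_iff pole_limit_def)
  ultimately have "approx_on X e (pole_integrand N k1 k2) (pole_limit N k1)"
    by (simp only:) (intro approx_on_mult approx_on_exp approx_on_power aS aSi aC aU aV aK e0)
  thus ?thesis using T9 unfolding X_def e_def by blast
qed

subsection \<open>The residue at the first singularity\<close>

lemma power_diff_le:
  fixes a c :: real assumes "1 \<le> c" "c \<le> a"
  shows "a ^ k - c ^ k \<le> real k * (a - c) * a ^ k"
proof (induction k)
  case (Suc k)
  have "a ^ Suc k - c ^ Suc k = a * (a ^ k - c ^ k) + c ^ k * (a - c)" by (simp add: algebra_simps)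
  also have "\<dots> \<le> a * (real k * (a - c) * a ^ k) + a ^ Suc k * (a - c)"
  proof (intro add_mono mult_left_mono mult_right_mono Suc.IH)
    have "c ^ k \<le> a ^ k" using assms by (intro power_mono) auto
    also have "\<dots> \<le> a * a ^ k" using assms by (simp add: mult_left_le order.trans)
    finally show "c ^ k \<le> a ^ Suc k" by simp
  qed (use assms in auto)
  also have "\<dots> = real (Suc k) * (a - c) * a ^ Suc k" by (simp add: algebra_simps)
  finally show ?case .
qed auto

text \<open>An exact change of variables. With \<open>R = \<kappa>^2 / (4 pi t)\<close> the factor
  \<open>1/t\<close> joins \<open>1 / sinhc_sqrt z\<close> to form the bounded quantity
  \<open>s\<close>, and the remaining \<open>N\<close> such factors release
  \<open>t^N\<close>.\<close>

lemma line_integrand_near_pole: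
  fixes t q \<kappa> :: real
  assumes t: "t > 0" and q: "q \<ge> 0"
  defines "a \<equiv> sqrt (pi\<^sup>2 + q)"
  shows "line_integrand t (\<kappa>\<^sup>2 / (4 * pi * t)) N k1 k2 q (\<i> * of_real a - \<i> * of_real (pi / (a * t)) * u)
    = of_real (exp (- t * a) * t ^ N) * (\<i> * of_real a) ^ k2 * pole_integrand N k1 k2 (t, q, u, \<kappa>)"
proof -
  have a2: "a\<^sup>2 = pi\<^sup>2 + q" using q by (simp add: a_def)
  have a: "a > 0" using q unfolding a_def by (simp add: add_pos_nonneg)
  define v where "v = \<i> * of_real a - \<i> * of_real (pi / (a * t)) * u"
  define z where "z = - of_real (pi\<^sup>2) + (of_real (2 * pi / t) * u - of_real ((pi * inverse a / t)\<^sup>2) * u\<^sup>2)"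
  define s where "s = inverse (of_real t * sinhc_sqrt z)"
  have 1: "\<i> * of_real t * v = of_real (- t * a) + of_real (pi * inverse a) * u"
    using a t by (simp add: v_def field_simps)
  have 2: "v = \<i> * of_real a * (1 - of_real (pi * (inverse a)\<^sup>2 / t) * u)"
    using a t by (simp add: v_def field_simps power2_eq_square)
  have "of_real a ^ 2 = (of_real (pi\<^sup>2) + of_real q :: complex)"
    by (metis a2 of_real_add of_real_power)
  moreover have "v\<^sup>2 = - (of_real a ^ 2) + (of_real (2 * pi / t) * u - of_real ((pi * inverse a / t)\<^sup>2) * u\<^sup>2)"
    using a t by (simp add: v_def power2_eq_square field_simps)
  ultimately have 3: "v\<^sup>2 + of_real q = z" by (simp add: z_def)
  have 4: "- of_real (\<kappa>\<^sup>2 / (4 * pi * t)) * (cosh_sqrt z / sinhc_sqrt z) = - of_real (\<kappa>\<^sup>2 / (4 * pi)) * (cosh_sqrt z * s)"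
    using t by (cases "sinhc_sqrt z = 0") (simp_all add: s_def field_simps)
  have 5: "cosh_sqrt z ^ k1 / sinhc_sqrt z ^ N = of_real (t ^ N) * (cosh_sqrt z ^ k1 * s ^ N)"
  proof -
    have "t ^ N * inverse t ^ N = 1" using t by (simp flip: power_mult_distrib)
    hence "of_real (t ^ N) * s ^ N = inverse (sinhc_sqrt z) ^ N"
      unfolding s_def inverse_mult_distrib power_mult_distrib of_real_inverse[symmetric] of_real_power[symmetric]
      by (metis mult.assoc mult.left_neutral of_real_1 of_real_mult)
    thus ?thesis by (simp only: divide_inverse power_inverse mult.left_commute)
  qed
  have "line_integrand t (\<kappa>\<^sup>2 / (4 * pi * t)) N k1 k2 q v
     = exp (\<i> * of_real t * v) * v ^ k2 * (exp (- of_real (\<kappa>\<^sup>2 / (4 * pi * t)) * (cosh_sqrt z / sinhc_sqrt z))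
         * (cosh_sqrt z ^ k1 / sinhc_sqrt z ^ N))"
    unfolding line_integrand_def radial_symbol_def 3 by simp
  also have "\<dots> = of_real (exp (- t * a) * t ^ N) * (\<i> * of_real a) ^ k2 *
     (exp (of_real (pi * inverse a) * u) * (1 - of_real (pi * (inverse a)\<^sup>2 / t) * u) ^ k2
        * exp (- of_real (\<kappa>\<^sup>2 / (4 * pi)) * (cosh_sqrt z * s)) * cosh_sqrt z ^ k1 * s ^ N)"
  proof -
    have "exp (\<i> * of_real t * v) = of_real (exp (- t * a)) * exp (of_real (pi * inverse a) * u)"
      unfolding 1 exp_add exp_of_real ..
    moreover have "v ^ k2 = (\<i> * of_real a) ^ k2 * (1 - of_real (pi * (inverse a)\<^sup>2 / t) * u) ^ k2"
      by (subst 2) (rule power_mult_distrib)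
    ultimately show ?thesis unfolding 4 5 by (simp only: of_real_mult mult_ac)
  qed
  also have "(exp (of_real (pi * inverse a) * u) * (1 - of_real (pi * (inverse a)\<^sup>2 / t) * u) ^ k2
        * exp (- of_real (\<kappa>\<^sup>2 / (4 * pi)) * (cosh_sqrt z * s)) * cosh_sqrt z ^ k1 * s ^ N)
      = pole_integrand N k1 k2 (t, q, u, \<kappa>)"
    unfolding pole_integrand_def prod.case Let_def a_def[symmetric] z_def[symmetric] s_def[symmetric] ..
  finally show ?thesis unfolding v_def .
qed

text \<open>The factors of the loop integral that remain at \<open>q = 0\<close>, where
  \<open>a = pi\<close>, once the exponential, the power of \<open>t\<close> and the series are
  split off.\<close>

definition residue_const :: "nat \<Rightarrow> nat \<Rightarrow> nat \<Rightarrow> complex" where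
  "residue_const N k1 k2 = 2 * of_real pi * (\<i> * of_real pi) ^ k2 * (-1) ^ k1 * of_real pi ^ N"

lemma loop_series_nonneg: "loop_series N \<kappa> \<ge> 0"
  by (rule order.trans[OF _ loop_series_ge]) simp

text \<open>The residue is an integral over the circle of radius \<open>pi / (a t)\<close>, compared
  there with the explicit loop integral \<open>G\<close>. A second comparison replaces
  \<open>a\<close> by \<open>pi\<close> in the prefactor \<open>a^k2 pi / a\<close> at relative cost
  \<open>O(q)\<close>.\<close>

lemma residue_estimate:
  assumes "K \<ge> 0" and N: "N \<ge> 1"
  shows "\<exists>M T. M \<ge> 0 \<and> T \<ge> 1 \<and> (\<forall>t q \<kappa>. t \<ge> T \<longrightarrow> q \<ge> 0 \<longrightarrow> 0 \<le> \<kappa> \<longrightarrow> \<kappa> \<le> K \<longrightarrow>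
    cmod (2 * pi * \<i> * residue (line_integrand t (\<kappa>\<^sup>2 / (4 * pi * t)) N k1 k2 q) (\<i> * of_real (sqrt (pi\<^sup>2 + q)))
      - of_real (exp (- t * sqrt (pi\<^sup>2 + q)) * t ^ (N - 1) * loop_series N \<kappa>) * residue_const N k1 k2)
    \<le> M * (1 / t + q) * (1 + q) ^ k2 * (exp (- t * sqrt (pi\<^sup>2 + q)) * t ^ (N - 1)))"
    (is "\<exists>M T. _ \<and> _ \<and> (\<forall>t q \<kappa>. _ \<longrightarrow> _ \<longrightarrow> _ \<longrightarrow> _ \<longrightarrow> ?P t q \<kappa> M)")
proof -
  obtain T where T: "T \<ge> 9" and approx: "approx_on {(t, q, u, \<kappa>). t \<ge> T \<and> q \<ge> 0 \<and> cmod u = 1 \<and> 0 \<le> \<kappa> \<and> \<kappa> \<le> K}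
     (\<lambda>(t, q, u, \<kappa>). 1 / t + q) (pole_integrand N k1 k2) (pole_limit N k1)"
    using pole_integrand_approx[OF assms(1), of N k1 k2] by blast
  obtain M where M: "M \<ge> 1" and M': "\<And>x. x \<in> {(t, q, u, \<kappa>). t \<ge> T \<and> q \<ge> 0 \<and> cmod u = 1 \<and> 0 \<le> \<kappa> \<and> \<kappa> \<le> K} \<Longrightarrow>
      (case x of (t, q, u, \<kappa>) \<Rightarrow> 1 / t + q) \<ge> 0 \<Longrightarrow>
      cmod (pole_integrand N k1 k2 x) \<le> M \<and> cmod (pole_limit N k1 x) \<le> M \<and>
      cmod (pole_integrand N k1 k2 x - pole_limit N k1 x) \<le> M * (case x of (t, q, u, \<kappa>) \<Rightarrow> 1 / t + q)"
    using approx_onE[OF approx] by blast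
  \<comment> \<open>The summands pay for the comparison on the circle and for replacing
    \<open>a\<close> by \<open>pi\<close>; the powers of \<open>4\<close> come from
    \<open>a \<le> 4 (1 + q)\<close>.\<close>
  define M2 where "M2 = 4 ^ k2 * (2 * pi * M) + 4 ^ k2 * ((real k2 + 1) * (2 * pi * pi ^ N * exp (K\<^sup>2 / 4)))"
  have "?P t q \<kappa> M2"
    if t: "t \<ge> T" and q: "q \<ge> 0" and \<kappa>: "0 \<le> \<kappa>" "\<kappa> \<le> K" for t q \<kappa> :: real
  proof -
    define f where "f = line_integrand t (\<kappa>\<^sup>2 / (4 * pi * t)) N k1 k2 q"
    define a where "a = sqrt (pi\<^sup>2 + q)"
    define p where "p = \<i> * complex_of_real a"
    define r where "r = pi / (a * t)"
    define E where "E = exp (- t * a) * t ^ (N - 1)"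
    have t_ge: "t \<ge> 1" "t > 0" using t T by auto
    have a2: "a\<^sup>2 = pi\<^sup>2 + q" using q by (simp add: a_def)
    have api: "a \<ge> pi" using q unfolding a_def by (intro real_le_rsqrt) simp
    have a: "a > 1" "a > 0" using api pi_ge_two by linarith+
    have r: "r > 0" using a t_ge by (simp add: r_def)
    have E: "E > 0" using t_ge by (simp add: E_def)
    have aq: "a - pi \<le> q" unfolding a_def by (rule sqrt_pi_square_bounds(3)[OF q])
    have nz: "t \<noteq> 0" "a \<noteq> 0" using t_ge a by auto
    \<comment> \<open>The length of the circle consumes one power of \<open>t\<close>, which is why
      \<open>t^(N-1)\<close> appears in the result.\<close>
    have Er: "exp (- t * a) * t ^ N * r = E * (pi / a)"
      using nz N by (cases N) (simp_all add: E_def r_def)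
    define s where "s = {v. -1 < Im v \<and> Im v < sqrt ((2 * pi)\<^sup>2 + q)}"
    have s: "open s"
      unfolding s_def Collect_conj_eq using open_halfspace_Im_gt open_halfspace_Im_lt
      by (auto intro!: open_Int)
    \<comment> \<open>The disc stays below the second singularity: there is room
      \<open>3 pi^2\<close> between \<open>a^2\<close> and \<open>(2 pi)^2 + q\<close>, while
      \<open>2 a r + r^2\<close> is at most \<open>2 pi / 9 + 1\<close>.\<close>
    have gap: "a + r < sqrt ((2 * pi)\<^sup>2 + q)"
    proof (rule real_less_rsqrt)
      have "pi / a \<le> 1" using api a(2) by (simp add: divide_le_eq)
      hence r1: "r \<le> 1 / t" using divide_right_mono[of "pi / a" 1 t] t_ge by (simp add: r_def)
      have "2 * a * r = 2 * pi / t" using a by (simp add: r_def)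
      also have "\<dots> \<le> 2 * pi / 9" using t T by (intro divide_left_mono) auto
      finally have "2 * a * r \<le> 2 * pi / 9" .
      moreover have "r\<^sup>2 \<le> 1" using r1 r t_ge by (intro power_le_one) (auto intro: order.trans[of _ "1/t"])
      moreover have "pi\<^sup>2 \<ge> 2 * pi" using pi_ge_two by (simp add: power2_eq_square)
      ultimately show "(a + r)\<^sup>2 < (2 * pi)\<^sup>2 + q" using pi_ge_two a2 unfolding power2_sum power_mult_distrib
        by simp
    qed
    have r_le: "r \<le> 1"
    proof -
      have "pi * 1 \<le> a * t" by (intro mult_mono) (use api t_ge a pi_gt_zero in linarith)+
      thus ?thesis using a t_ge by (simp add: r_def)
    qed
    have ps: "p \<in> s" "cball p r \<subseteq> s"
    proof -
      show sub: "cball p r \<subseteq> s"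
      proof
        fix v assume "v \<in> cball p r"
        hence "\<bar>Im v - a\<bar> \<le> r"
          using abs_Im_le_cmod[of "v - p"] by (simp add: p_def dist_norm norm_minus_commute)
        thus "v \<in> s" using gap a r_le by (simp add: s_def) linarith
      qed
      thus "p \<in> s" using r by auto
    qed
    have holo: "f holomorphic_on s - {p}"
      unfolding f_def using sinhc_sqrt_nonzero_in_strip[OF q]
      by (intro line_integrand_holomorphic) (auto simp: s_def p_def a_def)
    have res: "(f has_contour_integral 2 * pi * \<i> * residue f p) (circlepath p r)"
      by (rule base_residue[OF s ps(1) r holo ps(2)])
    \<comment> \<open>Makes \<open>\<alpha> (v - p)\<close> the unimodular parameter
      \<open>u\<close> of the circle \<open>v = p - i r u\<close>.\<close>
    define \<alpha> where "\<alpha> = \<i> / of_real r"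
    have \<alpha>: "\<alpha> \<noteq> 0" using r by (simp add: \<alpha>_def)
    define g where "g = (\<lambda>v. of_real (exp (- t * a) * t ^ N) * (\<i> * of_real a) ^ k2 * (-1) ^ k1 *
        (exp (\<alpha> * (v - p)) * exp (of_real (\<kappa>\<^sup>2 / 4) / (\<alpha> * (v - p))) * (of_real pi / (\<alpha> * (v - p))) ^ N))"
    define G where "G = of_real (exp (- t * a) * t ^ N) * (\<i> * of_real a) ^ k2 * (-1) ^ k1 *
        (2 * pi * \<i> / \<alpha> * of_real (pi ^ N * loop_series N \<kappa>))"
    have g: "(g has_contour_integral G) (circlepath p r)"
      unfolding g_def G_def by (intro has_contour_integral_lmul loop_integral_loop_series r N \<alpha>)
    have diff: "cmod (f v - g v) \<le> exp (- t * a) * t ^ N * a ^ k2 * (M * (1 / t + q))" if v: "cmod (v - p) = r" for v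
    proof -
      define u where "u = \<alpha> * (v - p)"
      have u: "cmod u = 1" using v r by (simp add: u_def \<alpha>_def norm_mult norm_divide)
      have "v = p - \<i> * of_real r * u" using r by (simp add: u_def \<alpha>_def field_simps)
      hence "v = \<i> * of_real a - \<i> * of_real (pi / (a * t)) * u" by (simp add: p_def r_def)
      hence "f v = of_real (exp (- t * a) * t ^ N) * (\<i> * of_real a) ^ k2 * pole_integrand N k1 k2 (t, q, u, \<kappa>)"
        using line_integrand_near_pole[OF t_ge(2) q, of \<kappa> N k1 k2 u] by (simp only: f_def a_def)
      moreover have "g v = of_real (exp (- t * a) * t ^ N) * (\<i> * of_real a) ^ k2 * pole_limit N k1 (t, q, u, \<kappa>)"
        unfolding g_def pole_limit_def u_def[symmetric] prod.case by (simp only: mult_ac)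
      ultimately have "f v - g v = of_real (exp (- t * a) * t ^ N) * (\<i> * of_real a) ^ k2 *
          (pole_integrand N k1 k2 (t, q, u, \<kappa>) - pole_limit N k1 (t, q, u, \<kappa>))"
        by (simp only: right_diff_distrib)
      hence "cmod (f v - g v) = exp (- t * a) * t ^ N * a ^ k2 *
          cmod (pole_integrand N k1 k2 (t, q, u, \<kappa>) - pole_limit N k1 (t, q, u, \<kappa>))"
        using a t_ge by (simp add: norm_mult norm_power)
      also have "\<dots> \<le> exp (- t * a) * t ^ N * a ^ k2 * (M * (1 / t + q))"
        using M'[of "(t, q, u, \<kappa>)"] t t_ge q \<kappa> u a by (intro mult_left_mono) auto
      finally show ?thesis .
    qed
    have "cmod (2 * pi * \<i> * residue f p - G) \<le> (exp (- t * a) * t ^ N * a ^ k2 * (M * (1 / t + q))) * (2 * pi * r)"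
    proof (rule has_contour_integral_bound_circlepath[OF has_contour_integral_diff[OF res g]])
      show "0 \<le> exp (- t * a) * t ^ N * a ^ k2 * (M * (1 / t + q))" using t_ge a M q by simp
    qed (use r diff in auto)
    also have "\<dots> = (exp (- t * a) * t ^ N * r) * (a ^ k2 * (M * (1 / t + q)) * (2 * pi))" by (simp only: mult_ac)
    also have "\<dots> = E * a ^ k2 * (M * (1 / t + q)) * (2 * pi * (pi / a))" unfolding Er by (simp only: mult_ac)
    also have "\<dots> \<le> E * a ^ k2 * (M * (1 / t + q)) * (2 * pi * 1)"
      using E a M q t_ge api by (intro mult_left_mono) auto
    finally have d1: "cmod (2 * pi * \<i> * residue f p - G) \<le> E * a ^ k2 * (M * (1 / t + q)) * (2 * pi)" by simp
    have G: "G = of_real E * (\<i> ^ k2 * (-1) ^ k1 * of_real (2 * pi * pi ^ N * loop_series N \<kappa>)) * of_real (a ^ k2 * (pi / a))"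
    proof -
      have "2 * pi * \<i> / \<alpha> = of_real r * of_real (2 * pi)" using r by (simp add: \<alpha>_def)
      hence "G = of_real (exp (- t * a) * t ^ N * r) * (\<i> ^ k2 * (-1) ^ k1 * of_real (2 * pi * pi ^ N * loop_series N \<kappa>)) * of_real (a ^ k2)"
        unfolding G_def by (simp add: power_mult_distrib)
      thus ?thesis unfolding Er by simp
    qed
    have "G - of_real (E * loop_series N \<kappa>) * residue_const N k1 k2
        = of_real E * (\<i> ^ k2 * (-1) ^ k1 * of_real (2 * pi * pi ^ N * loop_series N \<kappa>)) * of_real (a ^ k2 * (pi / a) - pi ^ k2)"
      unfolding G by (simp add: residue_const_def power_mult_distrib algebra_simps)
    hence "cmod (G - of_real (E * loop_series N \<kappa>) * residue_const N k1 k2)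
        = E * (2 * pi * pi ^ N * loop_series N \<kappa>) * \<bar>a ^ k2 * (pi / a) - pi ^ k2\<bar>"
      using E loop_series_nonneg[of N \<kappa>]
      by (simp add: norm_mult norm_power abs_mult del: of_real_diff of_real_mult of_real_power)
    also have "\<dots> \<le> E * (2 * pi * pi ^ N * exp (K\<^sup>2 / 4)) * ((real k2 + 1) * q * a ^ k2)"
    proof (intro mult_mono mult_left_mono)
      have "\<kappa>\<^sup>2 \<le> K\<^sup>2" using \<kappa> by (intro power_mono) auto
      thus "loop_series N \<kappa> \<le> exp (K\<^sup>2 / 4)" using order.trans[OF loop_series_le[of N \<kappa>]] by simp
      have "a ^ k2 - pi ^ k2 \<le> real k2 * (a - pi) * a ^ k2" "0 \<le> a ^ k2 - pi ^ k2"
        using api pi_ge_two power_diff_le[of pi a k2] by (auto intro: power_mono)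
      moreover have "a ^ k2 * (pi / a) - a ^ k2 = - (a ^ k2 * ((a - pi) / a))" using a by (simp add: field_simps)
      moreover have "0 \<le> a ^ k2 * ((a - pi) / a)" using a api by simp
      moreover have "a ^ k2 * ((a - pi) / a) \<le> a ^ k2 * ((a - pi) / 1)"
        using a api by (intro mult_left_mono divide_left_mono) auto
      moreover have "\<bar>X - c\<bar> \<le> P + Q" if "A - c \<le> P" "0 \<le> A - c" "X - A = - Y" "0 \<le> Y" "Y \<le> Q"
        for X c P Q A Y :: real using that by linarith
      ultimately have "\<bar>a ^ k2 * (pi / a) - pi ^ k2\<bar> \<le> real k2 * (a - pi) * a ^ k2 + a ^ k2 * ((a - pi) / 1)"
        by blast
      also have "\<dots> = (real k2 + 1) * (a - pi) * a ^ k2" by (simp add: algebra_simps)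
      also have "\<dots> \<le> (real k2 + 1) * q * a ^ k2"
        using aq a by (intro mult_right_mono mult_left_mono) auto
      finally show "\<bar>a ^ k2 * (pi / a) - pi ^ k2\<bar> \<le> (real k2 + 1) * q * a ^ k2" .
    qed (use E loop_series_nonneg in auto)
    finally have d2: "cmod (G - of_real (E * loop_series N \<kappa>) * residue_const N k1 k2)
        \<le> E * (2 * pi * pi ^ N * exp (K\<^sup>2 / 4)) * ((real k2 + 1) * q * a ^ k2)" .
    have "a \<le> 4 * (1 + q)" using aq pi_less_4 q by simp
    hence ak: "a ^ k2 \<le> 4 ^ k2 * (1 + q) ^ k2"
      using a power_mono[of a "4 * (1 + q)" k2] unfolding power_mult_distrib by simp
    have "cmod (2 * pi * \<i> * residue f p - of_real (E * loop_series N \<kappa>) * residue_const N k1 k2)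
       \<le> E * a ^ k2 * (M * (1 / t + q)) * (2 * pi) + E * (2 * pi * pi ^ N * exp (K\<^sup>2 / 4)) * ((real k2 + 1) * q * a ^ k2)"
      using norm_triangle_le[OF add_mono[OF d1 d2]] by simp
    also have "\<dots> \<le> E * a ^ k2 * (M * (1 / t + q)) * (2 * pi) + E * (2 * pi * pi ^ N * exp (K\<^sup>2 / 4)) * ((real k2 + 1) * (1 / t + q) * a ^ k2)"
      using E a t_ge by (intro add_left_mono mult_left_mono mult_right_mono) auto
    also have "\<dots> = a ^ k2 * (E * (1 / t + q) * (2 * pi * M + (real k2 + 1) * (2 * pi * pi ^ N * exp (K\<^sup>2 / 4))))"
      by (simp only: algebra_simps)
    also have "\<dots> \<le> (4 ^ k2 * (1 + q) ^ k2) * (E * (1 / t + q) * (2 * pi * M + (real k2 + 1) * (2 * pi * pi ^ N * exp (K\<^sup>2 / 4))))"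
      using ak E t_ge q M by (intro mult_right_mono) auto
    also have "\<dots> = M2 * (1 / t + q) * (1 + q) ^ k2 * E"
      by (simp add: M2_def algebra_simps)
    finally show ?thesis by (simp add: f_def p_def a_def E_def)
  qed
  moreover have "M2 \<ge> 0" using M by (simp add: M2_def)
  ultimately show ?thesis using T by (intro exI[of _ M2] exI[of _ T]) auto
qed

subsection \<open>The one-dimensional integral\<close>

text \<open>With \<open>s = sqrt (t q)\<close> and \<open>a = sqrt (c^2 + q)\<close>, the left side
  is \<open>s^2 / (a + c)\<close>. Since \<open>t \<ge> 1\<close> gives
  \<open>a + c \<le> 2 c + s\<close>, the claim follows from
  \<open>(s - 2 c) (s + 2 c) \<le> s^2\<close>.\<close>

lemma sqrt_gap_lower:
  fixes c q t :: real
  assumes "c > 0" "q \<ge> 0" "t \<ge> 1"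
  shows "t * (sqrt (c\<^sup>2 + q) - c) \<ge> sqrt (t * q) - 2 * c"
proof -
  define a where "a = sqrt (c\<^sup>2 + q)"
  define s where "s = sqrt (t * q)"
  have a2: "a\<^sup>2 = c\<^sup>2 + q" using assms by (simp add: a_def)
  have ac: "a \<ge> c" unfolding a_def using assms by (intro real_le_rsqrt) auto
  have s: "s \<ge> 0" "s\<^sup>2 = t * q" using assms by (auto simp: s_def)
  have "a \<le> sqrt (c\<^sup>2) + sqrt q" unfolding a_def using assms by (intro sqrt_add_le_add_sqrt) auto
  also have "sqrt q \<le> s" unfolding s_def using assms by (simp add: mult_le_cancel_right1)
  finally have as: "a + c \<le> 2 * c + s" using assms by simp
  have "(s - 2 * c) * (a + c) \<le> t * q"
  proof (cases "s \<ge> 2 * c")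
    case True
    hence "(s - 2 * c) * (a + c) \<le> (s - 2 * c) * (2 * c + s)" using as by (intro mult_left_mono) auto
    also have "\<dots> = s\<^sup>2 - 4 * c\<^sup>2" by (simp add: power2_eq_square algebra_simps)
    also have "\<dots> \<le> t * q" using s by simp
    finally show ?thesis .
  next
    case False
    hence "(s - 2 * c) * (a + c) \<le> 0" using ac assms by (intro mult_nonpos_nonneg) auto
    also have "0 \<le> t * q" using assms by simp
    finally show ?thesis .
  qed
  also have "q = (a - c) * (a + c)" using a2 by (simp add: power2_eq_square algebra_simps)
  also have "t * ((a - c) * (a + c)) = t * (a - c) * (a + c)" by (simp only: mult.assoc)
  finally have "s - 2 * c \<le> t * (a - c)" using ac assms by (simp add: mult_le_cancel_right)
  thus ?thesis by (simp add: a_def s_def)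
qed

text \<open>A bound of the form \<open>exp (- sqrt (t q))\<close> replaces the Gaussian because \<open>sqrt (c^2 + q)\<close> grows only like
  \<open>sqrt q\<close>; it holds for all \<open>q\<close> at once.\<close>

lemma exp_sqrt_gap_le:
  fixes c q t :: real
  assumes "c > 0" "q \<ge> 0" "t \<ge> 1"
  shows "exp (- t * sqrt (c\<^sup>2 + q)) \<le> exp (- t * c) * (exp (2 * c) * exp (- sqrt (t * q)))"
proof -
  have "- t * sqrt (c\<^sup>2 + q) \<le> - t * c + (2 * c + - sqrt (t * q))"
    using sqrt_gap_lower[OF assms] by (simp add: algebra_simps)
  thus ?thesis by (simp flip: exp_add)
qed

lemma exp_neg_diff_le:
  fixes A B :: real assumes "A \<le> B"
  shows "\<bar>exp (- A) - exp (- B)\<bar> \<le> (B - A) * exp (- A)"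
proof -
  have "exp (- A) * (1 - exp (- (B - A))) \<le> exp (- A) * (B - A)"
  proof (rule mult_left_mono)
    show "1 - exp (- (B - A)) \<le> B - A" using exp_ge_add_one_self[of "- (B - A)"] by linarith
  qed simp
  moreover have "exp (- A) * (1 - exp (- (B - A))) = exp (- A) - exp (- B)"
    by (simp add: right_diff_distrib flip: exp_add)
  ultimately have "exp (- A) - exp (- B) \<le> (B - A) * exp (- A)" by (simp only: mult.commute)
  moreover have "0 \<le> exp (- A) - exp (- B)" using assms by simp
  ultimately show ?thesis by simp
qed

text \<open>For \<open>a = sqrt (pi^2 + q)\<close> the difference
  \<open>q / (2 pi) - (a - pi)\<close> equals \<open>(a - pi)^2 / (2 pi)\<close> exactly. Multiplied
  by \<open>t\<close> it is at most \<open>t q^2 = (t q)^2 / t\<close>, a gain of \<open>1/t\<close>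
  on the scale \<open>t q\<close> of order one.\<close>

lemma gaussian_phase_estimate:
  fixes q t :: real
  assumes q: "q \<ge> 0" and t: "t \<ge> 1"
  shows "\<bar>exp (- t * sqrt (pi\<^sup>2 + q)) - exp (- pi * t) * exp (- t * q / (2 * pi))\<bar>
     \<le> 1 / t * (t * q)\<^sup>2 * (exp (- pi * t) * (exp (2 * pi) * exp (- sqrt (t * q))))"
proof -
  define a where "a = sqrt (pi\<^sup>2 + q)"
  have a: "a \<ge> pi" and a_q: "(a - pi) * (a + pi) = q" and aq: "a - pi \<le> q"
    unfolding a_def by (rule sqrt_pi_square_bounds[OF q])+
  have gap: "t * q / (2 * pi) - t * (a - pi) = t * ((a - pi) * (a - pi)) / (2 * pi)"
    unfolding a_q[symmetric] using pi_gt_zero by (simp add: field_simps)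
  have "0 \<le> t * ((a - pi) * (a - pi)) / (2 * pi)" using t by simp
  hence le: "t * a \<le> pi * t + t * q / (2 * pi)" using gap by (simp add: algebra_simps)
  have "t * ((a - pi) * (a - pi)) / (2 * pi) \<le> t * (q * q) / 1"
    using t aq a q pi_ge_two by (intro frac_le mult_left_mono mult_mono) auto
  also have "\<dots> = 1 / t * (t * q)\<^sup>2" using t by (simp add: power2_eq_square)
  finally have B: "pi * t + t * q / (2 * pi) - t * a \<le> 1 / t * (t * q)\<^sup>2" using gap by (simp add: algebra_simps)
  have "\<bar>exp (- (t * a)) - exp (- (pi * t + t * q / (2 * pi)))\<bar>
      \<le> (pi * t + t * q / (2 * pi) - t * a) * exp (- (t * a))"
    by (rule exp_neg_diff_le[OF le])
  also have "\<dots> \<le> 1 / t * (t * q)\<^sup>2 * (exp (- pi * t) * (exp (2 * pi) * exp (- sqrt (t * q))))"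
    using B exp_sqrt_gap_le[of pi q t] q t by (intro mult_mono) (auto simp: a_def mult.commute)
  also have "exp (- (pi * t + t * q / (2 * pi))) = exp (- pi * t) * exp (- t * q / (2 * pi))"
    by (simp flip: exp_add)
  finally show ?thesis by (simp only: a_def mult_minus_left)
qed

lemma line_integral_bound:
  assumes n: "n \<ge> 1"
  shows "\<exists>C>0. \<forall>t R q. 0 \<le> q \<longrightarrow> 0 \<le> R \<longrightarrow> R \<le> 1 \<longrightarrow>
     cmod (LINT x|lborel. line_integrand t R (n + k1) k1 k2 q (Complex x (sqrt ((3 * pi / 2)\<^sup>2 + q))))
       \<le> exp (- t * sqrt ((3 * pi / 2)\<^sup>2 + q)) * (C * (1 + q) ^ (k2 + (n + k1)))"
proof -
  obtain C where "C > 0" and C: "\<forall>t R q v. 0 \<le> q \<longrightarrow> 0 \<le> R \<longrightarrow> R \<le> 1 \<longrightarrow> 0 \<le> Im v \<longrightarrow> Im v \<le> sqrt ((3 * pi / 2)\<^sup>2 + q)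
     \<longrightarrow> \<bar>Re v\<bar> \<ge> 1 \<or> Im v = sqrt ((3 * pi / 2)\<^sup>2 + q)
     \<longrightarrow> cmod (line_integrand t R (n + k1) k1 k2 q v)
       \<le> exp (- t * Im v) * (C * (1 + q) ^ (k2 + (n + k1))) * inverse (1 + (Re v)\<^sup>2)"
    using line_integrand_decay[OF n, of k1 k2] by blast
  have "cmod (LINT x|lborel. line_integrand t R (n + k1) k1 k2 q (Complex x h)) \<le> exp (- t * h) * (C * pi * (1 + q) ^ (k2 + (n + k1)))"
    if q: "0 \<le> q" and R: "0 \<le> R" "R \<le> 1" and h: "h = sqrt ((3 * pi / 2)\<^sup>2 + q)" for t R q h
  proof -
    have "h \<ge> 0" using q by (simp add: h)
    have "cmod (LINT x|lborel. line_integrand t R (n + k1) k1 k2 q (Complex x h))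
      \<le> (LINT x|lborel. exp (- t * h) * (C * (1 + q) ^ (k2 + (n + k1))) * inverse (1 + x\<^sup>2))"
    proof (rule Bochner_Integration.integral_norm_bound_integral)
      show "integrable lborel (\<lambda>x. line_integrand t R (n + k1) k1 k2 q (Complex x h))"
        unfolding h by (rule contour_shift(2)[OF n q R])
      show "integrable lborel (\<lambda>x. exp (- t * h) * (C * (1 + q) ^ (k2 + (n + k1))) * inverse (1 + x\<^sup>2))"
        by (intro integrable_mult_right integrable_inverse_1_plus_square')
      fix x :: real
      show "norm (line_integrand t R (n + k1) k1 k2 q (Complex x h)) \<le> exp (- t * h) * (C * (1 + q) ^ (k2 + (n + k1))) * inverse (1 + x\<^sup>2)"
        using C[rule_format, of q R "Complex x h" t] q R \<open>h \<ge> 0\<close> h by simp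
    qed
    also have "\<dots> = exp (- t * h) * (C * pi * (1 + q) ^ (k2 + (n + k1)))"
      by (simp add: integral_inverse_1_plus_square')
    finally show ?thesis .
  qed
  with \<open>C > 0\<close> show ?thesis by (intro exI[of _ "C * pi"]) auto
qed

text \<open>Three errors are brought to one form: that of the residue, that of the Gaussian phase,
  and the integral over the shifted line. The identity \<open>1/t + q = (1 + t q) / t\<close> turns
  the loss in \<open>q\<close> into a factor \<open>1/t\<close> times a polynomial in
  \<open>t q\<close>, which the weight \<open>exp (- sqrt (t q))\<close> can absorb.\<close>

lemma line_integral_estimate:
  assumes K: "K \<ge> 0" and n: "n \<ge> 1"
  shows "\<exists>M p T. M \<ge> 0 \<and> T \<ge> 1 \<and> (\<forall>t q \<kappa>. t \<ge> T \<longrightarrow> q \<ge> 0 \<longrightarrow> 0 \<le> \<kappa> \<longrightarrow> \<kappa> \<le> K \<longrightarrow>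
    cmod ((LINT x|lborel. line_integrand t (\<kappa>\<^sup>2 / (4 * pi * t)) (n + k1) k1 k2 q (of_real x))
      - of_real (exp (- pi * t) * t ^ (n + k1 - 1) * loop_series (n + k1) \<kappa> * exp (- t * q / (2 * pi))) * residue_const (n + k1) k1 k2)
    \<le> M * (1 / t) * (exp (- pi * t) * t ^ (n + k1 - 1)) * ((1 + t * q) ^ p * exp (- sqrt (t * q))))"
    (is "\<exists>M p T. _ \<and> _ \<and> (\<forall>t q \<kappa>. _ \<longrightarrow> _ \<longrightarrow> _ \<longrightarrow> _ \<longrightarrow> ?P t q \<kappa> M p)")
proof -
  define N where "N = n + k1"
  have N: "N \<ge> 1" using n by (simp add: N_def)
  obtain M1 T1 where M1: "M1 \<ge> 0" "T1 \<ge> 1" and res: "\<forall>t q \<kappa>. t \<ge> T1 \<longrightarrow> q \<ge> 0 \<longrightarrow> 0 \<le> \<kappa> \<longrightarrow> \<kappa> \<le> K \<longrightarrow>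
    cmod (2 * pi * \<i> * residue (line_integrand t (\<kappa>\<^sup>2 / (4 * pi * t)) N k1 k2 q) (\<i> * of_real (sqrt (pi\<^sup>2 + q)))
      - of_real (exp (- t * sqrt (pi\<^sup>2 + q)) * t ^ (N - 1) * loop_series N \<kappa>) * residue_const N k1 k2)
    \<le> M1 * (1 / t + q) * (1 + q) ^ k2 * (exp (- t * sqrt (pi\<^sup>2 + q)) * t ^ (N - 1))"
    using residue_estimate[OF K N, of k1 k2] by blast
  obtain C where "C > 0" and C: "\<forall>t R q. 0 \<le> q \<longrightarrow> 0 \<le> R \<longrightarrow> R \<le> 1 \<longrightarrow>
     cmod (LINT x|lborel. line_integrand t R N k1 k2 q (Complex x (sqrt ((3 * pi / 2)\<^sup>2 + q))))
       \<le> exp (- t * sqrt ((3 * pi / 2)\<^sup>2 + q)) * (C * (1 + q) ^ (k2 + N))"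
    using line_integral_bound[OF n, of k1 k2] unfolding N_def by blast
  \<comment> \<open>Covers the exponents \<open>k2 + 1\<close>, \<open>2\<close> and
    \<open>k2 + N\<close> required by the three errors.\<close>
  define p where "p = k2 + N + 2"
  \<comment> \<open>\<open>t \<ge> K^2\<close> forces \<open>R \<le> 1\<close>, the range in which
    the bounds on the shifted line are uniform.\<close>
  define T where "T = max T1 (K\<^sup>2 + 1)"
  define M where "M = M1 * exp (2 * pi) + exp (K\<^sup>2 / 4) * cmod (residue_const N k1 k2) * exp (2 * pi) + C * exp (3 * pi)"
  have "?P t q \<kappa> M p"
    if t: "t \<ge> T" and q: "q \<ge> 0" and \<kappa>: "0 \<le> \<kappa>" "\<kappa> \<le> K" for t q \<kappa> :: real
  proof -
    define R where "R = \<kappa>\<^sup>2 / (4 * pi * t)"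
    define y where "y = t * q"
    define X where "X = exp (- sqrt y)"
    define P where "P = exp (- pi * t)"
    define Z where "Z = t ^ (N - 1)"
    define a where "a = sqrt (pi\<^sup>2 + q)"
    define h where "h = sqrt ((3 * pi / 2)\<^sup>2 + q)"
    have t_ge: "t \<ge> 1" "t \<ge> T1" "t \<ge> K\<^sup>2" using t M1 by (auto simp: T_def)
    have R: "0 \<le> R" "R \<le> 1"
    proof -
      show "0 \<le> R" using t_ge by (simp add: R_def)
      have "\<kappa>\<^sup>2 \<le> K\<^sup>2" using \<kappa> by (intro power_mono) auto
      also have "\<dots> \<le> 1 * t" using t_ge by simp
      also have "\<dots> \<le> (4 * pi) * t" using t_ge pi_ge_two by (intro mult_right_mono) auto
      finally show "R \<le> 1" using t_ge by (simp add: R_def divide_le_eq_1)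
    qed
    have y: "y \<ge> 0" "q \<le> y" using q t_ge by (auto simp: y_def mult_le_cancel_right1)
    have pos: "X > 0" "P > 0" "Z \<ge> 1" using t_ge by (auto simp: X_def P_def Z_def)
    have ea: "exp (- t * a) \<le> P * (exp (2 * pi) * X)"
      using exp_sqrt_gap_le[of pi q t] q t_ge by (simp add: a_def P_def X_def y_def mult.commute)
    have qy: "1 / t + q = 1 / t * (1 + y)" using t_ge by (simp add: y_def field_simps)
    have pow: "(1 + y) ^ j \<le> (1 + y) ^ p" if "j \<le> p" for j using that y by (intro power_increasing) auto
    have e1: "cmod (2 * pi * \<i> * residue (line_integrand t R N k1 k2 q) (\<i> * of_real a)
      - of_real (exp (- t * a) * Z * loop_series N \<kappa>) * residue_const N k1 k2)
       \<le> M1 * exp (2 * pi) * (1 / t * (P * Z) * ((1 + y) ^ p * X))"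
    proof -
      have "cmod (2 * pi * \<i> * residue (line_integrand t R N k1 k2 q) (\<i> * of_real a)
        - of_real (exp (- t * a) * Z * loop_series N \<kappa>) * residue_const N k1 k2)
        \<le> M1 * (1 / t + q) * (1 + q) ^ k2 * (exp (- t * a) * Z)"
        using res[rule_format, OF t_ge(2) q \<kappa>] by (simp only: R_def a_def Z_def)
      also have "\<dots> \<le> M1 * (1 / t * (1 + y)) * (1 + y) ^ k2 * ((P * (exp (2 * pi) * X)) * Z)"
        unfolding qy using ea pos y q M1 t_ge
        by (intro mult_mono power_mono order_refl mult_nonneg_nonneg) auto
      also have "\<dots> = M1 * exp (2 * pi) * (1 / t * (P * Z) * ((1 + y) ^ Suc k2 * X))"
        by (simp add: mult_ac)
      also have "\<dots> \<le> M1 * exp (2 * pi) * (1 / t * (P * Z) * ((1 + y) ^ p * X))"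
        using pos M1 t_ge by (intro mult_left_mono mult_right_mono pow) (auto simp: p_def)
      finally show ?thesis .
    qed
    have e2: "cmod (of_real (exp (- t * a) * Z * loop_series N \<kappa>) * residue_const N k1 k2
        - of_real (P * Z * loop_series N \<kappa> * exp (- t * q / (2 * pi))) * residue_const N k1 k2)
       \<le> exp (K\<^sup>2 / 4) * cmod (residue_const N k1 k2) * exp (2 * pi) * (1 / t * (P * Z) * ((1 + y) ^ p * X))"
    proof -
      have "of_real (exp (- t * a) * Z * loop_series N \<kappa>) * residue_const N k1 k2
        - of_real (P * Z * loop_series N \<kappa> * exp (- t * q / (2 * pi))) * residue_const N k1 k2
        = of_real ((exp (- t * a) - P * exp (- t * q / (2 * pi))) * (Z * loop_series N \<kappa>)) * residue_const N k1 k2"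
        by (simp add: algebra_simps)
      hence "cmod (of_real (exp (- t * a) * Z * loop_series N \<kappa>) * residue_const N k1 k2
        - of_real (P * Z * loop_series N \<kappa> * exp (- t * q / (2 * pi))) * residue_const N k1 k2)
        = \<bar>exp (- t * a) - P * exp (- t * q / (2 * pi))\<bar> * (Z * loop_series N \<kappa>) * cmod (residue_const N k1 k2)"
        using pos loop_series_nonneg[of N \<kappa>] by (simp only: norm_mult norm_of_real abs_mult abs_of_nonneg)
      also have "\<dots> \<le> (1 / t * y\<^sup>2 * (P * (exp (2 * pi) * X))) * (Z * exp (K\<^sup>2 / 4)) * cmod (residue_const N k1 k2)"
      proof (intro mult_right_mono mult_mono mult_left_mono)
        show "\<bar>exp (- t * a) - P * exp (- t * q / (2 * pi))\<bar> \<le> 1 / t * y\<^sup>2 * (P * (exp (2 * pi) * X))"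
          using gaussian_phase_estimate[OF q t_ge(1)] by (simp only: a_def P_def X_def y_def)
        have "\<kappa>\<^sup>2 \<le> K\<^sup>2" using \<kappa> by (intro power_mono) auto
        thus "loop_series N \<kappa> \<le> exp (K\<^sup>2 / 4)" using order.trans[OF loop_series_le[of N \<kappa>]] by simp
      qed (use pos t_ge loop_series_nonneg in auto)
      also have "\<dots> = exp (K\<^sup>2 / 4) * cmod (residue_const N k1 k2) * exp (2 * pi) * (1 / t * (P * Z) * (y\<^sup>2 * X))"
        by (simp only: mult_ac)
      also have "\<dots> \<le> exp (K\<^sup>2 / 4) * cmod (residue_const N k1 k2) * exp (2 * pi) * (1 / t * (P * Z) * ((1 + y) ^ p * X))"
      proof (intro mult_left_mono mult_right_mono)
        have "y\<^sup>2 \<le> (1 + y)\<^sup>2" using y by (intro power_mono) auto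
        also have "\<dots> \<le> (1 + y) ^ p" by (rule pow) (simp add: p_def)
        finally show "y\<^sup>2 \<le> (1 + y) ^ p" .
      qed (use pos t_ge in auto)
      finally show ?thesis .
    qed
    have e3: "cmod (LINT x|lborel. line_integrand t R N k1 k2 q (Complex x h)) \<le> C * exp (3 * pi) * (1 / t * (P * Z) * ((1 + y) ^ p * X))"
    proof -
      have "exp (- t * h) \<le> exp (- t * (3 * pi / 2)) * (exp (3 * pi) * X)"
        using exp_sqrt_gap_le[of "3 * pi / 2" q t] q t_ge by (simp add: h_def X_def y_def)
      also have "exp (- t * (3 * pi / 2)) = P * exp (- (t * (pi / 2)))"
        by (simp add: P_def algebra_simps flip: exp_add)
      \<comment> \<open>The height gained at \<open>q = 0\<close> is
        \<open>3 pi / 2 - pi = pi / 2\<close>. Of this exponential gain only a factor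
        \<open>1/t\<close> is kept.\<close>
      also have "exp (- (t * (pi / 2))) \<le> 1 / t * Z"
      proof -
        have "t * 1 \<le> t * (pi / 2)" using t_ge pi_ge_two by (intro mult_left_mono) auto
        also have "\<dots> \<le> exp (t * (pi / 2))" using exp_ge_add_one_self[of "t * (pi / 2)"] by linarith
        finally have "exp (- (t * (pi / 2))) \<le> 1 / t" using t_ge by (simp add: exp_minus field_simps)
        also have "\<dots> \<le> 1 / t * Z" using pos t_ge by (simp add: divide_right_mono)
        finally show ?thesis .
      qed
      finally have eh: "exp (- t * h) \<le> P * (1 / t * Z) * (exp (3 * pi) * X)"
        using pos by (simp add: mult_left_mono mult_right_mono)
      have "cmod (LINT x|lborel. line_integrand t R N k1 k2 q (Complex x h)) \<le> exp (- t * h) * (C * (1 + q) ^ (k2 + N))"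
        using C[rule_format, OF q R] by (simp only: h_def)
      also have "\<dots> \<le> (P * (1 / t * Z) * (exp (3 * pi) * X)) * (C * (1 + y) ^ p)"
      proof (intro mult_mono eh mult_left_mono)
        have "(1 + q) ^ (k2 + N) \<le> (1 + y) ^ (k2 + N)" using y q by (intro power_mono) auto
        also have "\<dots> \<le> (1 + y) ^ p" by (rule pow) (simp add: p_def)
        finally show "(1 + q) ^ (k2 + N) \<le> (1 + y) ^ p" .
      qed (use pos t_ge q \<open>C > 0\<close> in auto)
      finally show ?thesis by (simp only: mult_ac)
    qed
    have shift: "(LINT x|lborel. line_integrand t R N k1 k2 q (of_real x))
       = 2 * pi * \<i> * residue (line_integrand t R N k1 k2 q) (\<i> * of_real a) + (LINT x|lborel. line_integrand t R N k1 k2 q (Complex x h))"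
      unfolding N_def a_def h_def by (rule contour_shift(1)[OF n q R])
    have tri: "cmod (r + l - g) \<le> A + B + D" if "cmod (r - f) \<le> A" "cmod (f - g) \<le> B" "cmod l \<le> D" for r l f g A B D
    proof -
      have "r + l - g = (r - f) + (f - g) + l" by simp
      also have "cmod \<dots> \<le> A + B + D" using that by (intro norm_triangle_le add_mono norm_triangle_le) auto
      finally show ?thesis .
    qed
    have "cmod ((LINT x|lborel. line_integrand t R N k1 k2 q (of_real x))
        - of_real (P * Z * loop_series N \<kappa> * exp (- t * q / (2 * pi))) * residue_const N k1 k2)
      \<le> M1 * exp (2 * pi) * (1 / t * (P * Z) * ((1 + y) ^ p * X))
        + exp (K\<^sup>2 / 4) * cmod (residue_const N k1 k2) * exp (2 * pi) * (1 / t * (P * Z) * ((1 + y) ^ p * X))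
        + C * exp (3 * pi) * (1 / t * (P * Z) * ((1 + y) ^ p * X))"
      unfolding shift by (rule tri[OF e1 e2 e3])
    also have "\<dots> = M * (1 / t * (P * Z) * ((1 + y) ^ p * X))" by (simp only: M_def distrib_right)
    finally show ?thesis unfolding N_def[symmetric] by (simp only: R_def P_def Z_def y_def X_def mult.assoc)
  qed
  moreover have "M \<ge> 0" "T \<ge> 1" using M1 \<open>C > 0\<close> by (auto simp: M_def T_def)
  ultimately show ?thesis by blast
qed

subsection \<open>The distance\<close>

lemma theta_eq: "sin y \<noteq> 0 \<Longrightarrow> theta y = y / (sin y)\<^sup>2 - cot y"
  unfolding theta_def sin_double by (auto simp: cot_def field_simps power2_eq_square)

lemma sin_minus_mult_cos_pos:
  assumes "0 < y" "y < pi" shows "y * cos y < sin y"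
proof -
  define g where "g = (\<lambda>y::real. sin y - y * cos y)"
  have "g 0 < g y"
  proof (rule DERIV_pos_imp_increasing_open[OF assms(1)])
    fix x assume "0 < x" "x < y"
    hence "x * sin x > 0" using assms by (intro mult_pos_pos sin_gt_zero) auto
    moreover have "(g has_real_derivative x * sin x) (at x)"
      unfolding g_def by (auto intro!: derivative_eq_intros simp: algebra_simps)
    ultimately show "\<exists>d. (g has_real_derivative d) (at x) \<and> 0 < d" by blast
  qed (auto simp: g_def intro!: continuous_intros)
  thus ?thesis by (simp add: g_def)
qed

lemma theta_deriv:
  assumes "0 < y" "y < pi"
  shows "((\<lambda>y. y / (sin y)\<^sup>2 - cot y) has_real_derivative 2 * (sin y - y * cos y) / (sin y) ^ 3) (at y)"
proof -
  have s: "sin y > 0" using assms by (rule sin_gt_zero)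
  have "((\<lambda>y. y / (sin y)\<^sup>2 - cos y / sin y) has_real_derivative
      ((sin y)\<^sup>2 - y * (2 * sin y * cos y)) / ((sin y)\<^sup>2 * (sin y)\<^sup>2) - (- sin y * sin y - cos y * cos y) / (sin y * sin y)) (at y)"
    using s by (auto intro!: derivative_eq_intros simp: power2_eq_square)
  also have "- sin y * sin y - cos y * cos y = - 1"
    using sin_cos_squared_add[of y] by (simp add: power2_eq_square)
  also have "((sin y)\<^sup>2 - y * (2 * sin y * cos y)) / ((sin y)\<^sup>2 * (sin y)\<^sup>2) - (- 1) / (sin y * sin y) = 2 * (sin y - y * cos y) / (sin y) ^ 3"
    using s by (simp add: field_simps power2_eq_square power3_eq_cube)
  finally show ?thesis by (simp add: cot_def)
qed

lemma theta_strict_mono: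
  assumes "0 < x" "x < y" "y < pi"
  shows "theta x < theta y"
proof -
  have "(\<lambda>y. y / (sin y)\<^sup>2 - cot y) x < (\<lambda>y. y / (sin y)\<^sup>2 - cot y) y"
  proof (rule DERIV_pos_imp_increasing[OF assms(2)])
    fix z assume "x \<le> z" "z \<le> y"
    hence z: "0 < z" "z < pi" using assms by auto
    hence "2 * (sin z - z * cos z) / (sin z) ^ 3 > 0"
      using sin_minus_mult_cos_pos[OF z] sin_gt_zero[OF z] by simp
    thus "\<exists>d. ((\<lambda>y. y / (sin y)\<^sup>2 - cot y) has_real_derivative d) (at z) \<and> 0 < d"
      using theta_deriv[OF z] by blast
  qed
  thus ?thesis using sin_gt_zero[of x] sin_gt_zero[of y] assms by (simp add: theta_eq)
qed

text \<open>Confines the solutions of \<open>theta y = w\<close> with \<open>w > 0\<close> to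
  \<open>(0, pi)\<close>, where strict monotonicity gives the uniqueness behind
  \<open>y_om\<close>.\<close>

lemma theta_nonpos: "- pi < y \<Longrightarrow> y \<le> 0 \<Longrightarrow> theta y \<le> 0"
  using sin_x_le_x[of "- (2 * y)"]
  by (auto simp: theta_def intro!: divide_nonpos_nonneg)

lemma mult_cot_le:
  assumes "0 < s" "s < pi" shows "(pi - s) * cot s \<le> pi / s - 1"
proof -
  have "cos s * s \<le> sin s" using sin_minus_mult_cos_pos[OF assms] by (simp add: mult.commute)
  hence "cot s \<le> 1 / s" using sin_gt_zero[OF assms] assms by (simp add: cot_def field_simps)
  hence "(pi - s) * cot s \<le> (pi - s) * (1 / s)" using assms by (intro mult_left_mono) auto
  thus ?thesis using assms by (simp add: field_simps)
qed

text \<open>Up to \<open>pi / 2\<close> the estimate \<open>cot s \<ge> 1 / s - s / 2\<close> loses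
  \<open>1 + (pi - s) s / 2 \<le> 3\<close>. Beyond it the left side is at least \<open>-1\<close>,
  while \<open>pi / s \<le> 2\<close>. Together with the upper bound this says
  \<open>(pi - s) cot s = pi / s + O(1)\<close> on the whole interval.\<close>

lemma mult_cot_ge:
  assumes "0 < s" "s < pi" shows "(pi - s) * cot s \<ge> pi / s - 3"
proof (cases "s \<le> pi / 2")
  case True
  have s: "sin s > 0" using sin_gt_zero assms by auto
  have c: "cos s \<ge> 0" using True assms by (intro cos_ge_zero) auto
  have "cos s \<ge> 1 - s\<^sup>2 / 2"
  proof -
    have "(sin (s/2))\<^sup>2 \<le> (s/2)\<^sup>2" using assms sin_x_le_x[of "s/2"] sin_ge_zero[of "s/2"] by (intro power_mono) auto
    thus ?thesis using cos_double_sin[of "s/2"] by (simp add: power_divide)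
  qed
  hence "1 - s\<^sup>2 / 2 \<le> cos s" .
  also have "cos s * sin s \<le> cos s * s" using c assms sin_x_le_x[of s] by (intro mult_left_mono) auto
  hence "cos s \<le> s * cot s" using s by (simp add: cot_def field_simps)
  finally have "1 / s - s / 2 \<le> cot s" using assms by (simp add: field_simps power2_eq_square)
  hence "(pi - s) * (1 / s - s / 2) \<le> (pi - s) * cot s" using assms by (intro mult_left_mono) auto
  moreover have "(pi - s) * (1 / s - s / 2) = pi / s - 1 - (pi - s) * s / 2"
    using assms by (simp add: field_simps)
  moreover have "(pi - s) * s \<le> 4"
  proof -
    have "0 \<le> (pi / 2 - s)\<^sup>2" by simp
    hence "(pi - s) * s \<le> (pi / 2)\<^sup>2" by (simp add: power2_eq_square algebra_simps)
    also have "\<dots> \<le> 2\<^sup>2" using pi_less_4 by (intro power_mono) auto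
    finally show ?thesis by simp
  qed
  ultimately show ?thesis by linarith
next
  case False
  have s: "0 < pi - s" "pi - s < pi" using assms by auto
  have "(pi - s) * cos (pi - s) \<le> sin (pi - s)" using sin_minus_mult_cos_pos[OF s] by simp
  hence "- sin s \<le> (pi - s) * cos s" by simp
  hence "(pi - s) * cot s \<ge> -1" using sin_gt_zero[OF assms] by (simp add: cot_def field_simps)
  moreover have "pi / s \<le> 2" using False assms by (simp add: field_simps)
  ultimately show ?thesis by linarith
qed

lemma theta_surj:
  assumes w: "w > 0" shows "\<exists>y. 0 < y \<and> y < pi \<and> theta y = w"
proof -
  define g where "g = (\<lambda>y::real. y / (sin y)\<^sup>2 - cot y)"
  have lo: "\<exists>y. 0 < y \<and> y < pi \<and> g y \<le> w"
  proof -
    have "(theta \<longlongrightarrow> 0) (at_right 0)"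
    proof -
      have "((\<lambda>y. (2*y - sin (2*y)) / (2 * (sin y)\<^sup>2)) \<longlongrightarrow> 0) (at_right (0::real))"
        by real_asymp
      thus ?thesis
        by (rule Lim_transform_eventually) (auto simp: theta_def eventually_at_filter)
    qed
    hence "eventually (\<lambda>y. theta y < w) (at_right 0)" using w by (rule order_tendstoD)
    moreover have "eventually (\<lambda>y. 0 < y \<and> y < pi) (at_right (0::real))"
      unfolding eventually_at_right_field by (intro exI[of _ pi]) auto
    ultimately have "eventually (\<lambda>y. theta y < w \<and> 0 < y \<and> y < pi) (at_right 0)" by (rule eventually_conj)
    from eventually_happens[OF this] obtain y where "theta y < w" "0 < y" "y < pi"
      by (auto simp: trivial_limit_at_right_real)
    thus ?thesis using theta_eq[of y] sin_gt_zero[of y] by (intro exI[of _ y]) (auto simp: g_def)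
  qed
  then obtain y0 where y0: "0 < y0" "y0 < pi" "g y0 \<le> w" by blast
  have hi: "\<exists>y. y0 \<le> y \<and> y < pi \<and> w \<le> g y"
  proof -
    \<comment> \<open>The second entry gives \<open>s \<le> 1\<close> and
      \<open>s w \<le> 1\<close>; then \<open>sin s ^ 2 \<le> s\<close> forces
      \<open>theta (pi - s)\<close> above \<open>w\<close>.\<close>
    define s where "s = min (pi - y0) (1 / (w + 1))"
    have s: "0 < s" "s \<le> pi - y0" "s \<le> 1 / (w + 1)" "s < pi" using y0 w by (auto simp: s_def)
    have sn: "sin s > 0" using sin_gt_zero s by auto
    have "g (pi - s) = (pi - s) / (sin s)\<^sup>2 + cot s"
      by (simp add: g_def cot_def)
    also have "\<dots> \<ge> w"
    proof -
      have "s \<le> 1" using s(3) w by (simp add: field_simps order.trans[OF s(3)])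
      have "cos s \<ge> 0" using \<open>s \<le> 1\<close> s pi_ge_two by (intro cos_ge_zero) auto
      hence "cot s \<ge> 0" using sn by (simp add: cot_def)
      have "sin s \<le> s" using s by (intro sin_x_le_x) auto
      hence "(sin s)\<^sup>2 \<le> s * 1" unfolding power2_eq_square using \<open>s \<le> 1\<close> sn by (intro mult_mono) auto
      hence "(sin s)\<^sup>2 * w \<le> s * w" using w by (intro mult_right_mono) auto
      also have "s * w \<le> 1" using s(3) w s(1) by (simp add: field_simps)
      also have "1 \<le> pi - s" using \<open>s \<le> 1\<close> pi_ge_two by linarith
      finally have "w \<le> (pi - s) / (sin s)\<^sup>2" using sn by (simp add: field_simps)
      with \<open>cot s \<ge> 0\<close> show ?thesis by linarith
    qed
    finally show ?thesis using s by (intro exI[of _ "pi - s"]) auto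
  qed
  then obtain y1 where y1: "y0 \<le> y1" "y1 < pi" "w \<le> g y1" by blast
  have "\<exists>y. y0 \<le> y \<and> y \<le> y1 \<and> g y = w"
  proof (rule IVT[OF y0(3) y1(3) y1(1)], intro allI impI)
    fix y assume "y0 \<le> y \<and> y \<le> y1"
    hence "0 < y" "y < pi" using y0 y1 by auto
    from theta_deriv[OF this] show "isCont g y" unfolding g_def by (rule DERIV_isCont)
  qed
  then obtain y where y: "y0 \<le> y" "y \<le> y1" "g y = w" by blast
  hence "0 < y" "y < pi" using y0 y1 by auto
  thus ?thesis using y theta_eq[of y] sin_gt_zero[of y] by (intro exI[of _ y]) (auto simp: g_def)
qed

lemma y_om_props:
  assumes w: "w > 0"
  shows "0 < y_om w" "y_om w < pi" "theta (y_om w) = w"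
proof -
  obtain y where y: "0 < y" "y < pi" "theta y = w" using theta_surj[OF w] by blast
  have "y_om w = y"
    unfolding y_om_def
  proof (rule the_equality)
    fix z assume z: "- pi < z \<and> z < pi \<and> theta z = w"
    hence "z > 0" using theta_nonpos[of z] w by (cases "z > 0") auto
    thus "z = y" using theta_strict_mono[of z y] theta_strict_mono[of y z] y z
      by (cases z y rule: linorder_cases) auto
  qed (use y in auto)
  with y show "0 < y_om w" "y_om w < pi" "theta (y_om w) = w" by auto
qed

section \<open>The squared distance as the maximum of a phase\<close>

lemma phase_deriv:
  assumes "0 < y" "y < pi"
  shows "((\<lambda>y. c * y + R * (y * cot y)) has_real_derivative c - R * theta y) (at y)"
proof -
  have s: "sin y > 0" using assms by (rule sin_gt_zero)
  have "((\<lambda>y. c * y + R * (y * cot y)) has_real_derivative c + R * (1 * cot y + - inverse ((sin y)\<^sup>2) * y)) (at y)"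
    using s by (auto intro!: derivative_eq_intros DERIV_cot)
  thus ?thesis using s by (simp add: theta_eq divide_inverse algebra_simps)
qed

text \<open>\<open>d^2/4\<close> is the maximum of this phase, so every trial point bounds it from below.\<close>

lemma phase_max:
  assumes R: "R > 0" and c: "c > 0" and y: "0 < y" "y < pi"
  shows "c * y + R * (y * cot y) \<le> c * y_om (c / R) + R * (y_om (c / R) * cot (y_om (c / R)))"
proof -
  define Y where "Y = y_om (c / R)"
  define \<psi> where "\<psi> = (\<lambda>y. c * y + R * (y * cot y))"
  have Y: "0 < Y" "Y < pi" "theta Y = c / R" using y_om_props[of "c / R"] R c by (auto simp: Y_def)
  have "\<psi> y \<le> \<psi> Y"
  proof (cases y Y rule: linorder_cases)
    case less
    show ?thesis
    proof (rule DERIV_nonneg_imp_nondecreasing[where f = \<psi>])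
      fix x assume "y \<le> x" "x \<le> Y"
      hence x: "0 < x" "x < pi" "theta x \<le> theta Y"
        using y Y theta_strict_mono[of x Y] by (cases "x = Y"; force)+
      hence "c - R * theta x \<ge> 0" using R Y by (simp add: field_simps)
      thus "\<exists>d. (\<psi> has_real_derivative d) (at x) \<and> 0 \<le> d"
        using phase_deriv[OF x(1,2), of c R] unfolding \<psi>_def by blast
    qed (use less in auto)
  next
    case greater
    show ?thesis
    proof (rule DERIV_nonpos_imp_nonincreasing[where f = \<psi>])
      fix x assume "Y \<le> x" "x \<le> y"
      hence x: "0 < x" "x < pi" "theta Y \<le> theta x"
        using y Y theta_strict_mono[of Y x] by (cases "x = Y"; force)+
      hence "c - R * theta x \<le> 0" using R Y by (simp add: field_simps)
      thus "\<exists>d. (\<psi> has_real_derivative d) (at x) \<and> d \<le> 0"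
        using phase_deriv[OF x(1,2), of c R] unfolding \<psi>_def by blast
    qed (use greater in auto)
  qed auto
  thus ?thesis by (simp add: \<psi>_def Y_def)
qed

text \<open>The equation \<open>theta Y = omega x t\<close> reads
  \<open>Y / (sin Y)^2 = omega x t + cot Y\<close>, which removes the squared sine from
  \<open>R Y^2 / (sin Y)^2\<close>. The result is the phase at its critical point.\<close>

lemma dd_square_eq:
  fixes x :: "real^'a" and t :: "real^'m"
  assumes "x \<noteq> 0" "t \<noteq> 0"
  defines "Y \<equiv> y_om (omega x t)"
  shows "(dd x t)\<^sup>2 / 4 = norm t * Y + Rpar x * (Y * cot Y)"
proof -
  have R: "Rpar x > 0" using assms by (simp add: Rpar_def)
  have w: "omega x t > 0" using R assms by (simp add: omega_def)
  have Y: "0 < Y" "Y < pi" "theta Y = omega x t" using y_om_props[OF w] by (auto simp: Y_def)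
  have s: "sin Y > 0" using Y by (intro sin_gt_zero) auto
  have "(dd x t)\<^sup>2 / 4 = Rpar x * (Y\<^sup>2 / (sin Y)\<^sup>2)"
    using assms by (simp add: dd_def Rpar_def power_mult_distrib power_divide Y_def)
  also have "Y\<^sup>2 / (sin Y)\<^sup>2 = Y * (omega x t + cot Y)"
  proof -
    have "Y / (sin Y)\<^sup>2 = omega x t + cot Y" using Y(3) s by (simp add: theta_eq)
    moreover have "Y\<^sup>2 / (sin Y)\<^sup>2 = Y * (Y / (sin Y)\<^sup>2)" by (simp add: power2_eq_square)
    ultimately show ?thesis by simp
  qed
  also have "Rpar x * \<dots> = norm t * Y + Rpar x * (Y * cot Y)"
    using R by (simp add: omega_def algebra_simps)
  finally show ?thesis .
qed

text \<open>At \<open>y = pi - s\<close> the phase is \<open>pi t - (t s + R pi / s)\<close> up to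
  \<open>O(R)\<close>, with \<open>t\<close> for the norm, and the bracket has minimum
  \<open>\<kappa>\<close> at \<open>s = pi \<delta>\<close>. The lower bound uses that
  \<open>s\<close> as a trial point, admissible since \<open>\<delta> < 1\<close>; the upper bound
  evaluates at the true maximiser and applies the arithmetic-geometric inequality. For bounded
  \<open>\<kappa>\<close> the gap \<open>3 R\<close> is \<open>O(1/t)\<close>.\<close>

lemma dd_square_bounds:
  fixes x :: "real^'a" and t :: "real^'m"
  assumes "x \<noteq> 0" "t \<noteq> 0" "delta x t < 1"
  shows "pi * norm t - kappa x t \<le> (dd x t)\<^sup>2 / 4"
    and "(dd x t)\<^sup>2 / 4 \<le> pi * norm t - kappa x t + 3 * Rpar x"
proof -
  define R c where "R = Rpar x" and "c = norm t"
  define Y where "Y = y_om (omega x t)"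
  have R: "R > 0" using assms by (simp add: R_def Rpar_def)
  have c: "c > 0" using assms by (simp add: c_def)
  have Y: "0 < Y" "Y < pi" using y_om_props[of "omega x t"] R c
    by (auto simp: Y_def R_def c_def omega_def)
  have dd: "(dd x t)\<^sup>2 / 4 = c * Y + R * (Y * cot Y)"
    using dd_square_eq[OF assms(1,2)] by (simp add: Y_def R_def c_def)
  have cot_minus: "cot (pi - s) = - cot s" for s :: real by (simp add: cot_def)
  define d where "d = delta x t"
  have d: "d > 0" "d < 1" using assms(3) R c by (auto simp: d_def delta_def R_def c_def)
  have d2: "R = pi * c * d\<^sup>2" using R c by (simp add: d_def delta_def R_def c_def)
  have k: "kappa x t = 2 * (pi * c * d)"
  proof -
    have "pi * c * R = (pi * c * d)\<^sup>2" using d2 by (simp add: power2_eq_square)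
    thus ?thesis using c d by (simp add: kappa_def R_def[symmetric] c_def[symmetric])
  qed
  show "pi * norm t - kappa x t \<le> (dd x t)\<^sup>2 / 4"
  proof -
    define s where "s = pi * d"
    have s: "0 < s" "s < pi" using d by (simp_all add: s_def)
    have "R * ((pi - s) * cot s) \<le> R * (pi / s - 1)"
      using mult_cot_le[OF s] R by (intro mult_left_mono) auto
    also have "\<dots> \<le> R * (pi / s)" using R by (intro mult_left_mono) auto
    also have "\<dots> = pi * c * d" using d by (simp add: s_def d2 power2_eq_square)
    finally have "pi * c - kappa x t \<le> c * (pi - s) + R * ((pi - s) * cot (pi - s))"
      by (simp add: cot_minus k s_def algebra_simps)
    also have "\<dots> \<le> c * Y + R * (Y * cot Y)"
      using phase_max[OF R c, of "pi - s"] s by (simp add: Y_def omega_def R_def c_def)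
    finally show ?thesis by (simp add: dd c_def)
  qed
  show "(dd x t)\<^sup>2 / 4 \<le> pi * norm t - kappa x t + 3 * Rpar x"
  proof -
    define s where "s = pi - Y"
    have s: "0 < s" "s < pi" using Y by (auto simp: s_def)
    have "R * (pi / s - 3) \<le> R * ((pi - s) * cot s)"
      using mult_cot_ge[OF s] R by (intro mult_left_mono) auto
    moreover have "R * (Y * cot Y) = - (R * ((pi - s) * cot s))"
      using cot_minus[of s] by (simp add: s_def)
    ultimately have "(dd x t)\<^sup>2 / 4 \<le> c * (pi - s) - R * (pi / s) + 3 * R"
      unfolding dd by (simp add: s_def algebra_simps)
    moreover have "2 * (pi * c * d) \<le> c * s + R * (pi / s)"
    proof -
      have "0 \<le> c * (s - pi * d)\<^sup>2 / s" using c s by simp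
      also have "\<dots> = c * s + R * (pi / s) - 2 * (pi * c * d)"
        using s by (simp add: d2 power2_eq_square field_simps)
      finally show ?thesis by simp
    qed
    ultimately show ?thesis unfolding k by (simp add: R_def c_def algebra_simps)
  qed
qed

subsection \<open>Reduction to one dimension\<close>

lemma integrable_prod_Basis:
  fixes g :: "real \<Rightarrow> real"
  assumes g: "integrable lborel g"
  shows "integrable lborel (\<lambda>l::'b::euclidean_space. \<Prod>b\<in>Basis. g (l \<bullet> b))"
proof -
  interpret product_sigma_finite "\<lambda>_::'b. lborel :: real measure" by standard
  have [measurable]: "g \<in> borel_measurable borel" using g by auto
  have "integrable (\<Pi>\<^sub>M b\<in>(Basis :: 'b set). lborel) (\<lambda>f. \<Prod>b\<in>Basis. g (f b))"
    using g by (intro product_integrable_prod) auto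
  also have "(\<lambda>f. \<Prod>b\<in>Basis. g (f b)) = (\<lambda>f. \<Prod>b\<in>(Basis :: 'b set). g ((\<Sum>c\<in>Basis. f c *\<^sub>R c) \<bullet> b))"
    by (intro ext prod.cong refl) simp
  finally show ?thesis
    by (subst lborel_eq) (subst integrable_distr_eq, auto)
qed

text \<open>Fubini with the coordinate along \<open>u\<close> innermost. Measurability of the inner
  integral is kept as a conclusion because integrability of its difference from the Gaussian is
  obtained by domination.\<close>

lemma lborel_integral_split_Basis:
  fixes f :: "'b::euclidean_space \<Rightarrow> complex"
  assumes u: "u \<in> Basis" and f: "integrable lborel f"
  shows "integral\<^sup>L lborel f =
    (\<integral>x. (\<integral>v. f (v *\<^sub>R u + (\<Sum>b\<in>Basis - {u}. x b *\<^sub>R b)) \<partial>lborel) \<partial>(\<Pi>\<^sub>M b\<in>Basis - {u}. lborel))"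
    and "(\<lambda>x. \<integral>v. f (v *\<^sub>R u + (\<Sum>b\<in>Basis - {u}. x b *\<^sub>R b)) \<partial>lborel) \<in> borel_measurable (\<Pi>\<^sub>M b\<in>Basis - {u}. lborel)"
proof -
  interpret product_sigma_finite "\<lambda>_::'b. lborel :: real measure" by standard
  have [measurable]: "f \<in> borel_measurable borel" using f by auto
  let ?s = "\<lambda>x :: 'b \<Rightarrow> real. \<Sum>b\<in>Basis. x b *\<^sub>R b"
  have ins: "insert u (Basis - {u}) = Basis" using u by auto
  have upd: "?s (x(u := v)) = v *\<^sub>R u + (\<Sum>b\<in>Basis - {u}. x b *\<^sub>R b)" for x v
    using u by (subst sum.remove[of _ u]) (auto intro!: sum.cong)
  have int: "integrable (\<Pi>\<^sub>M b\<in>Basis. lborel) (\<lambda>x. f (?s x))"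
    using f by (subst (asm) lborel_eq) (subst (asm) integrable_distr_eq, auto)
  have "integral\<^sup>L lborel f = (\<integral>x. f (?s x) \<partial>(\<Pi>\<^sub>M b\<in>Basis. lborel))"
    by (subst lborel_eq) (subst integral_distr, auto)
  also have "\<dots> = (\<integral>x. (\<integral>v. f (?s (x(u := v))) \<partial>lborel) \<partial>(\<Pi>\<^sub>M b\<in>Basis - {u}. lborel))"
    using product_integral_insert[of "Basis - {u}" u "\<lambda>x. f (?s x)"] int unfolding ins by auto
  finally show "integral\<^sup>L lborel f =
    (\<integral>x. (\<integral>v. f (v *\<^sub>R u + (\<Sum>b\<in>Basis - {u}. x b *\<^sub>R b)) \<partial>lborel) \<partial>(\<Pi>\<^sub>M b\<in>Basis - {u}. lborel))"
    by (simp only: upd)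
  show "(\<lambda>x. \<integral>v. f (v *\<^sub>R u + (\<Sum>b\<in>Basis - {u}. x b *\<^sub>R b)) \<partial>lborel) \<in> borel_measurable (\<Pi>\<^sub>M b\<in>Basis - {u}. lborel)"
    by measurable
qed

lemma norm_split_Basis:
  fixes u :: "'b::euclidean_space"
  assumes u: "u \<in> Basis"
  defines "l \<equiv> \<lambda>v x. v *\<^sub>R u + (\<Sum>b\<in>Basis - {u}. x b *\<^sub>R b)"
  shows "l v x \<bullet> u = v" and "(norm (l v x))\<^sup>2 = v\<^sup>2 + (\<Sum>b\<in>Basis - {u}. (x b)\<^sup>2)"
proof -
  have upd: "l v x = (\<Sum>b\<in>Basis. (x(u := v)) b *\<^sub>R b)"
    using u unfolding l_def by (subst sum.remove[of _ u]) (auto intro!: sum.cong)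
  have comp: "l v x \<bullet> b = (x(u := v)) b" if "b \<in> Basis" for b
    unfolding upd using that by simp
  show "l v x \<bullet> u = v" using comp[OF u] by simp
  have "(norm (l v x))\<^sup>2 = (\<Sum>b\<in>Basis. (l v x \<bullet> b)\<^sup>2)"
    unfolding power2_norm_eq_inner by (subst euclidean_inner) (simp add: power2_eq_square)
  also have "\<dots> = (\<Sum>b\<in>Basis. ((x(u := v)) b)\<^sup>2)" by (intro sum.cong refl) (simp add: comp)
  also have "\<dots> = v\<^sup>2 + (\<Sum>b\<in>Basis - {u}. (x b)\<^sup>2)"
    using u by (subst sum.remove[of _ u]) (auto intro!: sum.cong)
  finally show "(norm (l v x))\<^sup>2 = v\<^sup>2 + (\<Sum>b\<in>Basis - {u}. (x b)\<^sup>2)" .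
qed

text \<open>Trades radial decay for decay in each coordinate separately, so that dominating
  functions become products and integrate factor by factor.\<close>

lemma prod_one_plus_le:
  fixes a :: "'i \<Rightarrow> real"
  assumes "finite I" "\<And>i. i \<in> I \<Longrightarrow> a i \<ge> 0"
  shows "(\<Prod>i\<in>I. 1 + a i) \<le> (1 + sum a I) ^ card I"
proof -
  have "(\<Prod>i\<in>I. 1 + a i) \<le> (\<Prod>i\<in>I. 1 + sum a I)"
    using assms by (intro prod_mono) (auto intro: member_le_sum)
  thus ?thesis by simp
qed

lemma integral_inverse_1_plus_scaled_square:
  assumes t: "t > 0"
  shows "integrable lborel (\<lambda>v::real. inverse (1 + t * v\<^sup>2))"
    and "(LINT v|lborel. inverse (1 + t * v\<^sup>2)) = pi / sqrt t"
proof -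
  have "has_bochner_integral lborel (\<lambda>x::real. inverse (1 + x\<^sup>2)) pi"
    using integrable_inverse_1_plus_square' integral_inverse_1_plus_square' by (simp add: has_bochner_integral_iff)
  hence "has_bochner_integral lborel (\<lambda>x::real. inverse (1 + (0 + sqrt t * x)\<^sup>2)) (pi /\<^sub>R \<bar>sqrt t\<bar>)"
    using t lborel_has_bochner_integral_real_affine_iff[of "sqrt t" "\<lambda>x. inverse (1 + x\<^sup>2)" pi 0] by simp
  hence "has_bochner_integral lborel (\<lambda>x::real. inverse (1 + t * x\<^sup>2)) (pi / sqrt t)"
    using t by (simp add: power_mult_distrib divide_inverse mult.commute)
  thus "integrable lborel (\<lambda>v::real. inverse (1 + t * v\<^sup>2))" "(LINT v|lborel. inverse (1 + t * v\<^sup>2)) = pi / sqrt t"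
    by (simp_all add: has_bochner_integral_iff)
qed

text \<open>A multiple of the centred normal density of variance \<open>pi / t\<close>.\<close>

lemma integral_gaussian_phase:
  assumes t: "t > 0"
  shows "integrable lborel (\<lambda>v::real. exp (- t * v\<^sup>2 / (2 * pi)))"
    and "(LINT v|lborel. exp (- t * v\<^sup>2 / (2 * pi))) = sqrt (2 * pi\<^sup>2 / t)"
proof -
  define \<sigma> where "\<sigma> = sqrt (pi / t)"
  have \<sigma>: "\<sigma> > 0" "\<sigma>\<^sup>2 = pi / t" using t by (auto simp: \<sigma>_def)
  have "sqrt (2 * pi * \<sigma>\<^sup>2) = sqrt (2 * pi\<^sup>2 / t)" unfolding \<sigma> by (simp add: power2_eq_square)
  moreover have "sqrt (2 * pi\<^sup>2 / t) > 0" using t by simp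
  moreover have "- (v - 0)\<^sup>2 / (2 * \<sigma>\<^sup>2) = - t * v\<^sup>2 / (2 * pi)" for v
    unfolding \<sigma> using t by simp
  ultimately have eq: "exp (- t * v\<^sup>2 / (2 * pi)) = sqrt (2 * pi\<^sup>2 / t) * normal_density 0 \<sigma> v" for v
    unfolding normal_density_def using t by simp
  show "integrable lborel (\<lambda>v::real. exp (- t * v\<^sup>2 / (2 * pi)))"
    unfolding eq using \<sigma> by (intro integrable_mult_right integrable_normal_density) auto
  show "(LINT v|lborel. exp (- t * v\<^sup>2 / (2 * pi))) = sqrt (2 * pi\<^sup>2 / t)"
    unfolding eq using \<sigma> by (subst integral_mult_right_zero) (simp add: integral_normal_density)
qed

section \<open>The full integrand and Laplace's method in the transverse variables\<close>

definition kernel_integrand :: "'b::euclidean_space \<Rightarrow> real \<Rightarrow> real \<Rightarrow> nat \<Rightarrow> nat \<Rightarrow> nat \<Rightarrow> 'b \<Rightarrow> complex" where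
  "kernel_integrand u t R N k1 k2 l =
     line_integrand t R N k1 k2 ((norm l)\<^sup>2 - (l \<bullet> u)\<^sup>2) (of_real (l \<bullet> u))"

lemma kernel_integrand_eq:
  "kernel_integrand u t R N k1 k2 l
     = exp (\<i> * of_real (t * (l \<bullet> u))) * of_real (l \<bullet> u) ^ k2 * radial_symbol R N k1 (of_real ((norm l)\<^sup>2))"
  by (simp add: kernel_integrand_def line_integrand_def mult.assoc)

text \<open>The zeros of \<open>sinhc_sqrt\<close> are negative reals, so no squared norm meets
  them, and the origin is not exceptional either.\<close>

lemma continuous_kernel_integrand: "continuous_on UNIV (kernel_integrand u t R N k1 k2)"
proof -
  have "radial_symbol R N k1 holomorphic_on {z. sinhc_sqrt z \<noteq> 0}"
    unfolding radial_symbol_def by (intro holomorphic_intros) auto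
  hence c: "continuous_on {z. sinhc_sqrt z \<noteq> 0} (radial_symbol R N k1)"
    by (rule holomorphic_on_imp_continuous_on)
  have nz: "sinhc_sqrt (of_real ((norm l)\<^sup>2)) \<noteq> 0" for l :: 'a
  proof
    assume "sinhc_sqrt (of_real ((norm l)\<^sup>2)) = 0"
    then obtain j :: nat where "j \<ge> 1" "complex_of_real ((norm l)\<^sup>2) = - of_real ((pi * real j)\<^sup>2)"
      unfolding sinhc_sqrt_eq_0_iff by blast
    hence j: "j \<ge> 1" "(norm l)\<^sup>2 = - ((pi * real j)\<^sup>2)"
      by (metis of_real_eq_iff of_real_minus)+
    moreover have "(pi * real j)\<^sup>2 > 0" using j by simp
    ultimately show False using zero_le_power2[of "norm l"] by linarith
  qed
  show ?thesis
    unfolding kernel_integrand_eq[abs_def]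
    by (intro continuous_intros continuous_on_compose2[OF c]) (use nz in auto)
qed

lemma integrable_kernel_integrand:
  fixes u :: "'b::euclidean_space"
  assumes "n \<ge> 1" "R \<ge> 0" "u \<in> Basis"
  shows "integrable lborel (kernel_integrand u t R (n + k1) k1 k2)"
proof -
  obtain D where D: "D > 0" and bd: "\<And>R l. R \<ge> 0 \<Longrightarrow> l \<ge> 0 \<Longrightarrow>
     l ^ k2 * cmod (radial_symbol R (n + k1) k1 (of_real (l\<^sup>2))) \<le> D * inverse ((1 + l\<^sup>2) ^ DIM('b))"
    using radial_symbol_real_decay[OF assms(1), of k2 k1 "DIM('b)"] by blast
  have le: "cmod (kernel_integrand u t R (n + k1) k1 k2 l) \<le> D * (\<Prod>b\<in>Basis. inverse (1 + (l \<bullet> b)\<^sup>2))" for l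
  proof -
    have "cmod (kernel_integrand u t R (n + k1) k1 k2 l) = \<bar>l \<bullet> u\<bar> ^ k2 * cmod (radial_symbol R (n + k1) k1 (of_real ((norm l)\<^sup>2)))"
      by (simp add: kernel_integrand_eq norm_mult norm_power power_abs)
    also have "\<dots> \<le> norm l ^ k2 * cmod (radial_symbol R (n + k1) k1 (of_real ((norm l)\<^sup>2)))"
      using Basis_le_norm[OF assms(3), of l] by (intro mult_right_mono power_mono) auto
    also have "\<dots> \<le> D * inverse ((1 + (norm l)\<^sup>2) ^ DIM('b))" using assms(2) by (intro bd) auto
    also have "\<dots> \<le> D * inverse (\<Prod>b\<in>Basis. 1 + (l \<bullet> b)\<^sup>2)"
    proof -
      have "(norm l)\<^sup>2 = (\<Sum>b\<in>Basis. (l \<bullet> b)\<^sup>2)"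
        unfolding power2_norm_eq_inner by (subst euclidean_inner) (simp add: power2_eq_square)
      hence "(\<Prod>b\<in>Basis. 1 + (l \<bullet> b)\<^sup>2) \<le> (1 + (norm l)\<^sup>2) ^ DIM('b)"
        using prod_one_plus_le[of "Basis :: 'b set" "\<lambda>b. (l \<bullet> b)\<^sup>2"] by simp
      moreover have "(\<Prod>b\<in>Basis. 1 + (l \<bullet> b)\<^sup>2) > 0" by (intro prod_pos) (auto intro: add_pos_nonneg)
      ultimately show ?thesis using D by (intro mult_left_mono le_imp_inverse_le) auto
    qed
    also have "inverse (\<Prod>b\<in>Basis. 1 + (l \<bullet> b)\<^sup>2) = (\<Prod>b\<in>Basis. inverse (1 + (l \<bullet> b)\<^sup>2))"
      by (rule prod_inversef[symmetric, unfolded o_def])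
    finally show ?thesis .
  qed
  show ?thesis
  proof (rule Bochner_Integration.integrable_bound)
    show "integrable lborel (\<lambda>l::'b. D * (\<Prod>b\<in>Basis. inverse (1 + (l \<bullet> b)\<^sup>2)))"
      by (intro integrable_mult_right integrable_prod_Basis integrable_inverse_1_plus_square')
    show "AE l in lborel. norm (kernel_integrand u t R (n + k1) k1 k2 l) \<le> norm (D * (\<Prod>b\<in>Basis. inverse (1 + (l \<bullet> b)\<^sup>2)))"
    proof (rule AE_I2)
      fix l :: 'b
      have "D * (\<Prod>b\<in>Basis. inverse (1 + (l \<bullet> b)\<^sup>2)) \<ge> 0"
        using D by (intro mult_nonneg_nonneg prod_nonneg) auto
      thus "norm (kernel_integrand u t R (n + k1) k1 k2 l) \<le> norm (D * (\<Prod>b\<in>Basis. inverse (1 + (l \<bullet> b)\<^sup>2)))"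
        using le[of l] by simp
    qed
  qed (use borel_measurable_continuous_onI[OF continuous_kernel_integrand] in simp)
qed

text \<open>The line estimate is integrated over the \<open>DIM('b) - 1\<close> transverse
  coordinates. Gaussian and error majorant both scale like
  \<open>(1 / sqrt t)^(DIM('b) - 1)\<close>, so the factor \<open>1/t\<close> gained on each line
  survives as a relative error.\<close>

lemma kernel_integral_estimate:
  fixes u :: "'b::euclidean_space"
  assumes K: "K \<ge> 0" and n: "n \<ge> 1" and u: "u \<in> Basis"
  shows "\<exists>M T. M \<ge> 0 \<and> T \<ge> 1 \<and> (\<forall>t \<kappa>. t \<ge> T \<longrightarrow> 0 \<le> \<kappa> \<longrightarrow> \<kappa> \<le> K \<longrightarrow>
    cmod (integral\<^sup>L lborel (kernel_integrand u t (\<kappa>\<^sup>2 / (4 * pi * t)) (n + k1) k1 k2)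
      - of_real (exp (- pi * t) * t ^ (n + k1 - 1) * loop_series (n + k1) \<kappa> * sqrt (2 * pi\<^sup>2 / t) ^ (DIM('b) - 1))
          * residue_const (n + k1) k1 k2)
    \<le> M * (1 / t) * (exp (- pi * t) * t ^ (n + k1 - 1)) * (1 / sqrt t) ^ (DIM('b) - 1))"
    (is "\<exists>M T. _ \<and> _ \<and> (\<forall>t \<kappa>. _ \<longrightarrow> _ \<longrightarrow> _ \<longrightarrow> ?P t \<kappa> M)")
proof -
  define I where "I = (Basis :: 'b set) - {u}"
  define d where "d = DIM('b) - 1"
  have I: "finite I" "card I = d" using u by (auto simp: I_def d_def)
  obtain M p T where M: "M \<ge> 0" "T \<ge> 1" and est: "\<forall>t q \<kappa>. t \<ge> T \<longrightarrow> q \<ge> 0 \<longrightarrow> 0 \<le> \<kappa> \<longrightarrow> \<kappa> \<le> K \<longrightarrow>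
    cmod ((LINT x|lborel. line_integrand t (\<kappa>\<^sup>2 / (4 * pi * t)) (n + k1) k1 k2 q (of_real x))
      - of_real (exp (- pi * t) * t ^ (n + k1 - 1) * loop_series (n + k1) \<kappa> * exp (- t * q / (2 * pi))) * residue_const (n + k1) k1 k2)
    \<le> M * (1 / t) * (exp (- pi * t) * t ^ (n + k1 - 1)) * ((1 + t * q) ^ p * exp (- sqrt (t * q)))"
    using line_integral_estimate[OF K n, of k1 k2] by blast
  \<comment> \<open>Applied at \<open>x = sqrt (t q)\<close>: the exponent doubles because
    \<open>1 + t q \<le> (1 + sqrt (t q))^2\<close>, and \<open>d\<close> extra powers pay for the
    product of the \<open>1 + t x_b^2\<close>.\<close>
  obtain D :: real where D: "D > 0" "\<forall>x\<ge>0. (1 + x) ^ (2 * (p + d)) \<le> D * exp (1 * x)"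
    using poly_le_exp[OF zero_less_one, of "2 * (p + d)"] by blast
  have "?P t \<kappa> (M * D * pi ^ d)"
    if t: "t \<ge> T" and \<kappa>: "0 \<le> \<kappa>" "\<kappa> \<le> K" for t \<kappa> :: real
  proof -
    interpret P: product_sigma_finite "\<lambda>_::'b. lborel :: real measure" by standard
    define P where "P = (\<Pi>\<^sub>M b\<in>I. (lborel :: real measure))"
    define R where "R = \<kappa>\<^sup>2 / (4 * pi * t)"
    define f where "f = kernel_integrand u t R (n + k1) k1 k2"
    define q where "q = (\<lambda>x::'b \<Rightarrow> real. \<Sum>b\<in>I. (x b)\<^sup>2)"
    define Kq where "Kq = (\<lambda>x. LINT v|lborel. line_integrand t R (n + k1) k1 k2 (q x) (of_real v))"
    define E where "E = exp (- pi * t) * t ^ (n + k1 - 1)"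
    define A where "A = of_real (E * loop_series (n + k1) \<kappa>) * residue_const (n + k1) k1 k2"
    have t_ge: "t \<ge> 1" "t > 0" using t M by auto
    have E: "E > 0" using t_ge by (simp add: E_def)
    have R: "R \<ge> 0" using t_ge by (simp add: R_def)
    have q0: "q x \<ge> 0" for x by (simp add: q_def sum_nonneg)
    have f: "integrable lborel f" unfolding f_def by (rule integrable_kernel_integrand[OF n R u])
    have inner: "(\<integral>v. f (v *\<^sub>R u + (\<Sum>b\<in>I. x b *\<^sub>R b)) \<partial>lborel) = Kq x" for x
      unfolding f_def kernel_integrand_def I_def norm_split_Basis[OF u] Kq_def q_def by simp
    have split: "integral\<^sup>L lborel f = (\<integral>x. Kq x \<partial>P)" and meas: "Kq \<in> borel_measurable P"
      using lborel_integral_split_Basis[OF u f] unfolding I_def[symmetric] inner P_def by auto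
    define B where "B = (\<lambda>x::'b \<Rightarrow> real. M * (1 / t) * E * D * (\<Prod>b\<in>I. inverse (1 + t * (x b)\<^sup>2)))"
    define G where "G = (\<lambda>x::'b \<Rightarrow> real. \<Prod>b\<in>I. exp (- t * (x b)\<^sup>2 / (2 * pi)))"
    have pointwise: "cmod (Kq x - A * of_real (G x)) \<le> B x" for x
    proof -
      define y where "y = t * q x"
      have y: "y \<ge> 0" using q0 t_ge by (simp add: y_def)
      have "G x = exp (- t * q x / (2 * pi))"
        using I by (simp add: G_def q_def sum_distrib_left sum_divide_distrib sum_negf flip: exp_sum)
      hence "cmod (Kq x - A * of_real (G x)) \<le> M * (1 / t) * E * ((1 + y) ^ p * exp (- sqrt y))"
        using est[rule_format, OF t q0[of x] \<kappa>] unfolding Kq_def R_def A_def E_def y_def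
        by (simp add: mult_ac)
      also have "\<dots> \<le> M * (1 / t) * E * (D * (\<Prod>b\<in>I. inverse (1 + t * (x b)\<^sup>2)))"
      proof (rule mult_left_mono)
        show "(1 + y) ^ p * exp (- sqrt y) \<le> D * (\<Prod>b\<in>I. inverse (1 + t * (x b)\<^sup>2))"
      proof -
        have pr: "(\<Prod>b\<in>I. 1 + t * (x b)\<^sup>2) > 0" using t_ge by (intro prod_pos) (auto intro: add_pos_nonneg)
        have "(\<Prod>b\<in>I. 1 + t * (x b)\<^sup>2) \<le> (1 + y) ^ d"
          using prod_one_plus_le[OF I(1), of "\<lambda>b. t * (x b)\<^sup>2"] t_ge I(2) by (simp add: y_def q_def sum_distrib_left)
        hence "(1 + y) ^ p * (\<Prod>b\<in>I. 1 + t * (x b)\<^sup>2) \<le> (1 + y) ^ p * (1 + y) ^ d"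
          using y by (intro mult_left_mono) auto
        also have "\<dots> = (1 + (sqrt y)\<^sup>2) ^ (p + d)" using y by (simp add: power_add)
        also have "\<dots> \<le> ((1 + sqrt y)\<^sup>2) ^ (p + d)" using y by (intro power_mono) (auto simp: power2_sum)
        also have "\<dots> \<le> D * exp (sqrt y)" using D(2) y unfolding power_mult[symmetric] by simp
        finally have "(1 + y) ^ p * (\<Prod>b\<in>I. 1 + t * (x b)\<^sup>2) \<le> D * exp (sqrt y)" .
        hence "(1 + y) ^ p * exp (- sqrt y) \<le> D * inverse (\<Prod>b\<in>I. 1 + t * (x b)\<^sup>2)"
          using pr by (simp add: exp_minus field_simps)
        thus ?thesis by (simp add: prod_inversef[unfolded o_def])
        qed
      qed (use M E t_ge in auto)
      finally show ?thesis by (simp only: B_def mult.assoc)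
    qed
    have intB: "integrable P B"
      unfolding B_def P_def using I t_ge
      by (intro integrable_mult_right P.product_integrable_prod integral_inverse_1_plus_scaled_square) auto
    have intG: "integrable P G"
      unfolding P_def G_def using I t_ge by (intro P.product_integrable_prod integral_gaussian_phase) auto
    have intAG: "integrable P (\<lambda>x. A * of_real (G x))"
      using intG by (intro integrable_mult_right integrable_of_real)
    have intd: "integrable P (\<lambda>x. Kq x - A * of_real (G x))"
    proof (rule Bochner_Integration.integrable_bound[OF intB])
      show "(\<lambda>x. Kq x - A * of_real (G x)) \<in> borel_measurable P"
        using meas intAG by (intro borel_measurable_diff) auto
      show "AE x in P. norm (Kq x - A * of_real (G x)) \<le> norm (B x)"
        by (intro AE_I2) (simp only: real_norm_def, rule order.trans[OF pointwise abs_ge_self])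
    qed
    \<comment> \<open>The inner integral inherits integrability from the dominated difference and
      the Gaussian.\<close>
    have "integrable P (\<lambda>x. (Kq x - A * of_real (G x)) + A * of_real (G x))"
      by (rule Bochner_Integration.integrable_add[OF intd intAG])
    hence intK: "integrable P Kq" by simp
    have IG: "(\<integral>x. A * of_real (G x) \<partial>P) = A * of_real (sqrt (2 * pi\<^sup>2 / t) ^ d)"
    proof -
      have "(\<integral>x. G x \<partial>P) = sqrt (2 * pi\<^sup>2 / t) ^ d"
        unfolding P_def G_def
        by (subst P.product_integral_prod[OF I(1) integral_gaussian_phase(1)[OF t_ge(2)]])
          (simp only: integral_gaussian_phase(2)[OF t_ge(2)] prod_constant I(2))
      thus ?thesis by (subst integral_mult_right_zero) (simp only: integral_complex_of_real)
    qed
    have IB: "(\<integral>x. B x \<partial>P) = M * (1 / t) * E * D * (pi / sqrt t) ^ d"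
    proof -
      have "(\<integral>x. (\<Prod>b\<in>I. inverse (1 + t * (x b)\<^sup>2)) \<partial>P) = (pi / sqrt t) ^ d"
        unfolding P_def
        by (subst P.product_integral_prod[OF I(1) integral_inverse_1_plus_scaled_square(1)[OF t_ge(2)]])
          (simp only: integral_inverse_1_plus_scaled_square(2)[OF t_ge(2)] prod_constant I(2))
      thus ?thesis unfolding B_def by (subst integral_mult_right_zero) simp
    qed
    have "integral\<^sup>L lborel f - A * of_real (sqrt (2 * pi\<^sup>2 / t) ^ d)
       = (\<integral>x. (Kq x - A * of_real (G x)) \<partial>P)"
      unfolding split IG[symmetric] by (rule Bochner_Integration.integral_diff[OF intK intAG, symmetric])
    also have "cmod \<dots> \<le> (\<integral>x. B x \<partial>P)"
    proof -
      have "cmod (\<integral>x. (Kq x - A * of_real (G x)) \<partial>P)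
          \<le> (\<integral>x. cmod (Kq x - A * of_real (G x)) \<partial>P)"
        by (rule Bochner_Integration.integral_norm_bound)
      also have "\<dots> \<le> (\<integral>x. B x \<partial>P)"
        by (rule Bochner_Integration.integral_mono[OF integrable_norm[OF intd] intB]) (rule pointwise)
      finally show ?thesis .
    qed
    also have "\<dots> = (M * D * pi ^ d) * (1 / t) * E * (1 / sqrt t) ^ d"
      unfolding IB by (simp add: power_divide)
    finally show ?thesis unfolding f_def R_def A_def E_def d_def[symmetric] by (simp add: mult_ac)
  qed
  moreover have "M * D * pi ^ d \<ge> 0" using M D by simp
  ultimately show ?thesis using M(2) by blast
qed

subsection \<open>The kernel\<close>

definition profile :: "nat \<Rightarrow> nat \<Rightarrow> nat \<Rightarrow> nat \<Rightarrow> real \<Rightarrow> real" where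
  "profile d n k1 k2 \<tau> = (-1) ^ k2 * pi ^ (k1 + k2) / 4 ^ n * (1 / sqrt (2 * \<tau>)) ^ d * \<tau> ^ (n + k1 - 1)"

lemma kappa_square: "(kappa x t)\<^sup>2 = 4 * pi * norm t * Rpar x"
  by (simp add: kappa_def Rpar_def power_mult_distrib)

lemma pker_eq_kernel_integral:
  fixes x :: "real^'a" and t :: "(real, 'm::{finite,wellorder}) vec"
  assumes "n \<ge> 1" "t \<noteq> 0"
  shows "pker n k1 k2 x t = ((-1) ^ k1 * \<i> ^ k2 / ((4 * of_real pi) ^ n * (2 * of_real pi) ^ CARD('m))) *
    integral\<^sup>L lborel (kernel_integrand (first_basis :: (real, 'm) vec) (norm t) ((kappa x t)\<^sup>2 / (4 * pi * norm t)) (n + k1) k1 k2)"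
proof -
  define R where "R = (kappa x t)\<^sup>2 / (4 * pi * norm t)"
  have R: "R = norm x ^ 2 / 4" using assms(2) by (simp add: R_def kappa_square Rpar_def)
  define f :: "(real, 'm) vec \<Rightarrow> complex" where "f = (\<lambda>l. exp (\<i> * of_real (norm t * inner l first_basis)
             - of_real (norm x ^ 2 / 4 * norm l * (cosh (norm l) / sinh (norm l)))) *
        of_real (norm l ^ (n+k1) * cosh (norm l) ^ k1 / sinh (norm l) ^ (n+k1)
                 * (inner l first_basis) ^ k2))"
  define g where "g = kernel_integrand (first_basis :: (real, 'm) vec) (norm t) R (n + k1) k1 k2"
  \<comment> \<open>at \<open>l = 0\<close> the quotients in \<open>f\<close> have the junk value \<open>0\<close>, while \<open>g\<close> is continuous\<close>
  have eq: "f l = (if l = 0 then 0 else g l)" for l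
  proof (cases "l = 0")
    case False
    define w where "w = complex_of_real (norm l)"
    have w: "w \<noteq> 0" using False by (simp add: w_def)
    have cs: "sinh w = of_real (sinh (norm l))" "cosh w = of_real (cosh (norm l))"
      by (simp_all add: w_def sinh_field_def cosh_field_def flip: exp_of_real)
    have "radial_symbol R (n + k1) k1 (of_real ((norm l)\<^sup>2))
       = exp (- of_real R * (w * cosh w / sinh w)) * cosh w ^ k1 * w ^ (n + k1) / sinh w ^ (n + k1)"
      using radial_symbol_square[OF w] by (simp add: w_def)
    also have "\<dots> = exp (- of_real (norm x ^ 2 / 4 * norm l * (cosh (norm l) / sinh (norm l)))) *
        of_real (norm l ^ (n+k1) * cosh (norm l) ^ k1 / sinh (norm l) ^ (n+k1))"
      unfolding cs R by (simp add: w_def mult.assoc)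
    finally show ?thesis using False
      by (simp add: f_def g_def kernel_integrand_eq exp_diff exp_minus field_simps)
  qed (use assms in \<open>simp add: f_def\<close>)
  have [measurable]: "g \<in> borel_measurable borel"
    unfolding g_def by (rule borel_measurable_continuous_onI[OF continuous_kernel_integrand])
  have f_eq: "f = (\<lambda>l. if l = 0 then 0 else g l)" using eq by blast
  have "integral\<^sup>L lborel f = integral\<^sup>L lborel g"
  proof (rule integral_cong_AE)
    show "AE l in lborel. f l = g l"
      using AE_lborel_singleton[of 0] by eventually_elim (simp add: eq)
  qed (auto simp: f_eq)
  thus ?thesis by (simp add: pker_def f_def g_def R_def)
qed

lemma first_basis_in_Basis: "(first_basis :: (real, 'm::{finite,wellorder}) vec) \<in> Basis"
  by (simp add: first_basis_def)

text \<open>\<open>sqrt (2 pi^2 / \<tau>)\<close> is \<open>2 pi / sqrt (2 \<tau>)\<close>, so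
  \<open>d\<close> of the \<open>d + 1\<close> factors \<open>2 pi\<close> in the denominator cancel
  against the transverse Gaussians and the last one against the factor in
  \<open>residue_const\<close>. The signs from \<open>k1\<close> square to one, and
  \<open>i^k2\<close> occurs twice, giving \<open>(-1)^k2\<close>.\<close>

lemma prefactor_eq:
  assumes \<tau>: "\<tau> > 0"
  shows "((-1) ^ k1 * \<i> ^ k2 / ((4 * of_real pi) ^ n * (2 * of_real pi) ^ Suc d)) *
      (of_real (E * \<tau> ^ (n + k1 - 1) * J * sqrt (2 * pi\<^sup>2 / \<tau>) ^ d) * residue_const (n + k1) k1 k2)
    = of_real (profile d n k1 k2 \<tau> * E * J)"
proof -
  have s: "sqrt (2 * pi\<^sup>2 / \<tau>) = 2 * pi * (1 / sqrt (2 * \<tau>))"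
  proof (rule real_sqrt_unique)
    show "(2 * pi * (1 / sqrt (2 * \<tau>)))\<^sup>2 = 2 * pi\<^sup>2 / \<tau>" using \<tau> by (simp add: power_mult_distrib power_divide)
  qed (use \<tau> in simp)
  have "(-1) ^ k1 * (-1) ^ k1 = (1 :: complex)" by (simp flip: power_mult_distrib)
  moreover have "\<i> ^ k2 * (\<i> * of_real pi) ^ k2 = (of_real ((-1) ^ k2 * pi ^ k2) :: complex)"
    by (simp add: power_mult_distrib flip: mult.assoc) (simp flip: power_mult_distrib)
  ultimately have "((-1) ^ k1 * (-1) ^ k1) * (\<i> ^ k2 * (\<i> * of_real pi) ^ k2) = (of_real ((-1) ^ k2 * pi ^ k2) :: complex)"
    by simp
  hence "((-1) ^ k1 * \<i> ^ k2 / ((4 * of_real pi) ^ n * (2 * of_real pi) ^ Suc d)) *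
      (of_real (E * \<tau> ^ (n + k1 - 1) * J * sqrt (2 * pi\<^sup>2 / \<tau>) ^ d) * residue_const (n + k1) k1 k2)
     = of_real ((-1) ^ k2 * pi ^ k2) * (of_real (2 * pi * pi ^ (n + k1) * (E * \<tau> ^ (n + k1 - 1) * J * sqrt (2 * pi\<^sup>2 / \<tau>) ^ d))
         / ((4 * of_real pi) ^ n * (2 * of_real pi) ^ Suc d))"
    unfolding residue_const_def by (simp add: mult_ac)
  also have "\<dots> = of_real ((-1) ^ k2 * pi ^ k2 * (2 * pi * pi ^ (n + k1) * (E * \<tau> ^ (n + k1 - 1) * J * sqrt (2 * pi\<^sup>2 / \<tau>) ^ d)
         / ((4 * pi) ^ n * (2 * pi) ^ Suc d)))" by simp
  also have "(-1) ^ k2 * pi ^ k2 * (2 * pi * pi ^ (n + k1) * (E * \<tau> ^ (n + k1 - 1) * J * sqrt (2 * pi\<^sup>2 / \<tau>) ^ d)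
         / ((4 * pi) ^ n * (2 * pi) ^ Suc d)) = profile d n k1 k2 \<tau> * E * J"
    unfolding s power_mult_distrib[of "2 * pi"] profile_def
    by (simp add: power_add power_mult_distrib field_simps)
  finally show ?thesis .
qed

text \<open>Still phrased with \<open>exp (- pi t)\<close>, and with an error measured against the
  profile alone. For this the constant divides by \<open>c0\<close>, the nonzero numerical part of
  \<open>profile\<close>, and \<open>sqrt 2 ^ d\<close> adjusts the normalisation of the
  root.\<close>

lemma pker_estimate:
  assumes K: "K \<ge> 0" and n: "n \<ge> 1"
  defines "d \<equiv> CARD('m::{finite,wellorder}) - 1"
  shows "\<exists>M T. M \<ge> 0 \<and> T \<ge> 1 \<and> (\<forall>(x::real^'a) (t::(real, 'm) vec). norm t \<ge> T \<longrightarrow> kappa x t \<le> K \<longrightarrow>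
    cmod (pker n k1 k2 x t - of_real (profile d n k1 k2 (norm t) * exp (- pi * norm t) * loop_series (n + k1) (kappa x t)))
    \<le> M * (1 / norm t) * \<bar>profile d n k1 k2 (norm t) * exp (- pi * norm t)\<bar>)"
    (is "\<exists>M T. _ \<and> _ \<and> (\<forall>x t. _ \<longrightarrow> _ \<longrightarrow> ?P x t M)")
proof -
  obtain M T where M: "M \<ge> 0" "T \<ge> 1" and est: "\<forall>\<tau> \<kappa>. \<tau> \<ge> T \<longrightarrow> 0 \<le> \<kappa> \<longrightarrow> \<kappa> \<le> K \<longrightarrow>
    cmod (integral\<^sup>L lborel (kernel_integrand (first_basis :: (real, 'm) vec) \<tau> (\<kappa>\<^sup>2 / (4 * pi * \<tau>)) (n + k1) k1 k2)
      - of_real (exp (- pi * \<tau>) * \<tau> ^ (n + k1 - 1) * loop_series (n + k1) \<kappa> * sqrt (2 * pi\<^sup>2 / \<tau>) ^ (DIM((real, 'm) vec) - 1))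
          * residue_const (n + k1) k1 k2)
    \<le> M * (1 / \<tau>) * (exp (- pi * \<tau>) * \<tau> ^ (n + k1 - 1)) * (1 / sqrt \<tau>) ^ (DIM((real, 'm) vec) - 1)"
    using kernel_integral_estimate[OF K n first_basis_in_Basis, of k1 k2] by blast
  have Suc_d: "CARD('m) = Suc d" unfolding d_def by (simp add: card_gt_0_iff)
  have d: "DIM((real, 'm) vec) - 1 = d" by (simp add: d_def)
  define c where "c = (-1) ^ k1 * \<i> ^ k2 / ((4 * complex_of_real pi) ^ n * (2 * complex_of_real pi) ^ Suc d)"
  define c0 where "c0 = (-1) ^ k2 * pi ^ (k1 + k2) / 4 ^ n"
  have c0: "\<bar>c0\<bar> > 0" by (simp add: c0_def)
  have "?P x t (cmod c * M * sqrt 2 ^ d / \<bar>c0\<bar>)"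
    if t: "norm t \<ge> T" and \<kappa>: "kappa x t \<le> K" for x :: "real^'a" and t :: "(real, 'm) vec"
  proof -
    define \<tau> where "\<tau> = norm t"
    define \<kappa> where "\<kappa> = kappa x t"
    define I where "I = integral\<^sup>L lborel (kernel_integrand (first_basis :: (real, 'm) vec) \<tau> (\<kappa>\<^sup>2 / (4 * pi * \<tau>)) (n + k1) k1 k2)"
    define G where "G = of_real (exp (- pi * \<tau>) * \<tau> ^ (n + k1 - 1) * loop_series (n + k1) \<kappa> * sqrt (2 * pi\<^sup>2 / \<tau>) ^ d)
          * residue_const (n + k1) k1 k2"
    have \<tau>: "\<tau> \<ge> T" "\<tau> > 0" using t M by (auto simp: \<tau>_def)
    have t0: "t \<noteq> 0" using \<tau> by (auto simp: \<tau>_def)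
    have \<kappa>0: "0 \<le> \<kappa>" "\<kappa> \<le> K" using \<kappa> by (auto simp: \<kappa>_def kappa_def Rpar_def)
    have 1: "pker n k1 k2 x t = c * I"
      using pker_eq_kernel_integral[OF n t0, of k1 k2 x] by (simp only: c_def I_def \<tau>_def \<kappa>_def Suc_d)
    have 2: "of_real (profile d n k1 k2 \<tau> * exp (- pi * \<tau>) * loop_series (n + k1) \<kappa>) = c * G"
      unfolding c_def G_def by (rule prefactor_eq[OF \<tau>(2), symmetric])
    have pr: "(1 / sqrt \<tau>) ^ d = sqrt 2 ^ d * (1 / sqrt (2 * \<tau>)) ^ d"
      using \<tau> by (simp add: real_sqrt_mult power_mult_distrib power_divide)
    have "cmod (c * I - c * G) = cmod c * cmod (I - G)" by (simp add: norm_mult flip: right_diff_distrib)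
    also have "\<dots> \<le> cmod c * (M * (1 / \<tau>) * (exp (- pi * \<tau>) * \<tau> ^ (n + k1 - 1)) * (1 / sqrt \<tau>) ^ d)"
      using est[rule_format, OF \<tau>(1) \<kappa>0] unfolding d I_def G_def by (intro mult_left_mono) auto
    also have "\<dots> = (cmod c * M * sqrt 2 ^ d / \<bar>c0\<bar>) * (1 / \<tau>) * (\<bar>c0\<bar> * (1 / sqrt (2 * \<tau>)) ^ d * \<tau> ^ (n + k1 - 1) * exp (- pi * \<tau>))"
      unfolding pr using c0 by simp
    also have "\<bar>c0\<bar> * (1 / sqrt (2 * \<tau>)) ^ d * \<tau> ^ (n + k1 - 1) * exp (- pi * \<tau>) = \<bar>profile d n k1 k2 \<tau> * exp (- pi * \<tau>)\<bar>"
      using \<tau> by (simp add: profile_def c0_def abs_mult)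
    finally show ?thesis unfolding 1 \<tau>_def[symmetric] \<kappa>_def[symmetric] 2 .
  qed
  moreover have "cmod c * M * sqrt 2 ^ d / \<bar>c0\<bar> \<ge> 0" using M by simp
  ultimately show ?thesis using M(2) by blast
qed

definition leading_term :: "nat \<Rightarrow> nat \<Rightarrow> nat \<Rightarrow> nat \<Rightarrow> real^'a \<Rightarrow> real^'m \<Rightarrow> real" where
  "leading_term d n k1 k2 x t = profile d n k1 k2 (norm t) * exp (- (dd x t ^ 2) / 4) * exp (- kappa x t)
     * loop_series (n + k1) (kappa x t)"

text \<open>The exponent \<open>S = d^2/4 + \<kappa>\<close> exceeds \<open>pi t\<close> by at most
  \<open>3 R = O(1/t)\<close>, so exchanging the exponentials costs a relative
  \<open>O(1/t)\<close>. The lower bound of \<open>loop_series\<close> makes the error relative to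
  the whole leading term. Positivity of \<open>\<kappa>\<close> gives \<open>x \<noteq> 0\<close>,
  as the distance bounds require.\<close>

lemma pker_estimate_dd:
  assumes K: "K \<ge> 0" and n: "n \<ge> 1"
  defines "d \<equiv> CARD('m::{finite,wellorder}) - 1"
  shows "\<exists>M T. M \<ge> 0 \<and> T \<ge> 1 \<and> (\<forall>(x::real^'a) (t::(real, 'm) vec). norm t \<ge> T \<longrightarrow> 0 < kappa x t \<longrightarrow> kappa x t \<le> K \<longrightarrow>
    cmod (pker n k1 k2 x t - of_real (leading_term d n k1 k2 x t)) \<le> M * (1 / norm t) * \<bar>leading_term d n k1 k2 x t\<bar>)"
proof -
  obtain M T where M: "M \<ge> 0" "T \<ge> 1" and est: "\<forall>(x::real^'a) (t::(real, 'm) vec). norm t \<ge> T \<longrightarrow> kappa x t \<le> K \<longrightarrow>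
    cmod (pker n k1 k2 x t - of_real (profile d n k1 k2 (norm t) * exp (- pi * norm t) * loop_series (n + k1) (kappa x t)))
    \<le> M * (1 / norm t) * \<bar>profile d n k1 k2 (norm t) * exp (- pi * norm t)\<bar>"
    using pker_estimate[OF K n, of k1 k2, where 'm = 'm and 'a = 'a] unfolding d_def by blast
  define T' where "T' = max T (K\<^sup>2 + K + 1)"
  define F where "F = (fact (n + k1 - 1) :: real)"
  \<comment> \<open>\<open>F\<close> is the reciprocal of the lower bound for the series,
    \<open>3 * K\<^sup>2\<close> comes from \<open>3 R \<le> 3 K^2 / t\<close>, and
    \<open>exp 3\<close> from \<open>S - pi t \<le> 3 R \<le> 3\<close>.\<close>
  define M' where "M' = exp 3 * (M * F + 3 * K\<^sup>2)"
  have key: "cmod (pker n k1 k2 x t - of_real main) \<le> M' * (1 / norm t) * \<bar>main\<bar>"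
    if t: "norm t \<ge> T'" and \<kappa>: "0 < kappa x t" "kappa x t \<le> K"
      and main: "main = leading_term d n k1 k2 x t"
    for x :: "real^'a" and t :: "(real, 'm) vec" and main
  proof -
    define \<tau> where "\<tau> = norm t"
    define \<kappa> where "\<kappa> = kappa x t"
    define A where "A = profile d n k1 k2 \<tau>"
    define J where "J = loop_series (n + k1) \<kappa>"
    define R where "R = Rpar x"
    define S where "S = dd x t ^ 2 / 4 + \<kappa>"
    have \<tau>: "\<tau> \<ge> T" "\<tau> \<ge> 1" "\<tau> \<ge> K\<^sup>2"
      using t M K by (auto simp: \<tau>_def T'_def)
    have t0: "t \<noteq> 0" using \<tau> by (auto simp: \<tau>_def)
    have x0: "x \<noteq> 0" using \<kappa> by (auto simp: kappa_def Rpar_def)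
    have R: "R > 0" using x0 by (simp add: R_def Rpar_def)
    have Rk: "R = \<kappa>\<^sup>2 / (4 * pi * \<tau>)" using \<tau> by (simp add: R_def \<kappa>_def \<tau>_def kappa_square t0)
    have RK: "R \<le> K\<^sup>2 / \<tau>"
    proof -
      have "\<kappa>\<^sup>2 \<le> K\<^sup>2" using \<kappa> by (intro power_mono) (auto simp: \<kappa>_def)
      moreover have "1 * \<tau> \<le> 4 * pi * \<tau>" using \<tau> pi_ge_two by (intro mult_right_mono) auto
      ultimately show ?thesis unfolding Rk using \<tau> by (intro frac_le) auto
    qed
    have R1: "R \<le> 1" using RK \<tau> by (simp add: order.trans divide_le_eq_1)
    have "(delta x t)\<^sup>2 < 1"
    proof -
      have "(delta x t)\<^sup>2 = R / (pi * \<tau>)" using R \<tau> by (simp add: delta_def R_def \<tau>_def)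
      moreover have "R < pi * \<tau>" using R1 \<tau> pi_ge_two mult_mono[of 2 pi 1 \<tau>] by simp
      ultimately show ?thesis using \<tau> by (simp add: divide_less_eq_1)
    qed
    hence "delta x t < 1" using power2_less_imp_less[of "delta x t" 1] by simp
    note dd = dd_square_bounds[OF x0 t0 this]
    have S: "pi * \<tau> \<le> S" "S \<le> pi * \<tau> + 3 * R" using dd by (auto simp: S_def \<tau>_def \<kappa>_def R_def)
    have main': "main = A * exp (- S) * J"
    proof -
      have "exp (- S) = exp (- (dd x t ^ 2) / 4) * exp (- \<kappa>)" by (simp add: S_def flip: exp_add)
      thus ?thesis unfolding main leading_term_def by (simp only: A_def J_def \<tau>_def \<kappa>_def mult_ac)
    qed
    have "exp (- (pi * \<tau>)) \<le> exp (3 + - S)" using S R1 by simp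
    hence eP: "exp (- pi * \<tau>) \<le> exp 3 * exp (- S)" by (simp only: exp_add mult_minus_left)
    have J: "J > 0" "1 \<le> F * J"
    proof -
      have "1 / F \<le> J" using loop_series_ge[where N = "n + k1" and \<kappa> = \<kappa>] by (simp add: J_def F_def)
      moreover have "F > 0" by (simp add: F_def)
      ultimately show "1 \<le> F * J" by (simp add: field_simps)
      have "0 < 1 / F" using \<open>F > 0\<close> by simp
      thus "J > 0" using \<open>1 / F \<le> J\<close> by linarith
    qed
    have d1: "cmod (pker n k1 k2 x t - of_real (A * exp (- pi * \<tau>) * J)) \<le> M * (1 / \<tau>) * (\<bar>A\<bar> * exp (- pi * \<tau>))"
      using est[rule_format, of t x] t \<tau> \<kappa> by (simp add: A_def J_def \<tau>_def \<kappa>_def abs_mult)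
    also have "\<dots> \<le> M * (1 / \<tau>) * (\<bar>A\<bar> * (exp 3 * exp (- S)) * (F * J))"
      using M \<tau> eP J mult_mono[OF eP J(2)]
      by (intro mult_left_mono) (auto simp: mult.assoc mult_left_mono)
    finally have e1: "cmod (pker n k1 k2 x t - of_real (A * exp (- pi * \<tau>) * J)) \<le> M * (1 / \<tau>) * (\<bar>A\<bar> * (exp 3 * exp (- S)) * (F * J))" .
    have "\<bar>exp (- (pi * \<tau>)) - exp (- S)\<bar> \<le> (S - pi * \<tau>) * exp (- (pi * \<tau>))" by (rule exp_neg_diff_le[OF S(1)])
    also have "\<dots> \<le> (3 * (K\<^sup>2 / \<tau>)) * (exp 3 * exp (- S))"
      using S RK eP \<tau> by (intro mult_mono) auto
    finally have "\<bar>exp (- (pi * \<tau>)) - exp (- S)\<bar> \<le> (3 * (K\<^sup>2 / \<tau>)) * (exp 3 * exp (- S))" .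
    hence "\<bar>A\<bar> * J * \<bar>exp (- (pi * \<tau>)) - exp (- S)\<bar> \<le> \<bar>A\<bar> * J * ((3 * (K\<^sup>2 / \<tau>)) * (exp 3 * exp (- S)))"
      using J by (intro mult_left_mono) auto
    moreover have "cmod (of_real (A * exp (- pi * \<tau>) * J) - of_real main) = \<bar>A\<bar> * J * \<bar>exp (- (pi * \<tau>)) - exp (- S)\<bar>"
    proof -
      have "A * exp (- pi * \<tau>) * J - main = A * J * (exp (- (pi * \<tau>)) - exp (- S))"
        by (simp add: main' algebra_simps)
      thus ?thesis using J by (simp only: norm_of_real abs_mult abs_of_pos flip: of_real_diff)
    qed
    ultimately have e2: "cmod (of_real (A * exp (- pi * \<tau>) * J) - of_real main) \<le> \<bar>A\<bar> * J * ((3 * (K\<^sup>2 / \<tau>)) * (exp 3 * exp (- S)))"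
      by simp
    have "cmod (pker n k1 k2 x t - of_real main)
       \<le> M * (1 / \<tau>) * (\<bar>A\<bar> * (exp 3 * exp (- S)) * (F * J)) + \<bar>A\<bar> * J * ((3 * (K\<^sup>2 / \<tau>)) * (exp 3 * exp (- S)))"
      using norm_triangle_le[OF add_mono[OF e1 e2]] by simp
    also have "\<dots> = M' * (1 / \<tau>) * (\<bar>A\<bar> * exp (- S) * J)"
      by (simp add: M'_def algebra_simps)
    also have "\<bar>A\<bar> * exp (- S) * J = \<bar>main\<bar>" using J by (simp add: main' abs_mult)
    finally show ?thesis by (simp add: \<tau>_def)
  qed
  show ?thesis
  proof (rule exI[of _ M'], rule exI[of _ T'], intro conjI allI impI)
    show "M' \<ge> 0" "T' \<ge> 1" using M K by (auto simp: M'_def T'_def F_def)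
  qed (rule key[OF _ _ _ refl])
qed


section \<open>From the common leading term to the two regimes\<close>

lemma besselI_eq_loop_series:
  assumes "N \<ge> 1"
  shows "besselI (N - 1) \<kappa> = (\<kappa> / 2) ^ (N - 1) * loop_series N \<kappa>"
proof -
  define \<nu> where "\<nu> = N - 1"
  have "\<kappa> ^ (2*k+\<nu>) / (2 ^ (2*k+\<nu>) * fact k * Gamma (real (k+\<nu>+1)))
      = (\<kappa> / 2) ^ \<nu> * ((\<kappa>\<^sup>2 / 4) ^ k / (fact k * fact (\<nu> + k)))" for k
  proof -
    have "Gamma (real (k+\<nu>+1)) = fact (\<nu> + k)"
      using Gamma_fact[of "\<nu> + k", where 'a = real] by (simp add: add_ac)
    moreover have "\<kappa> ^ (2*k+\<nu>) / 2 ^ (2*k+\<nu>) = (\<kappa> / 2) ^ \<nu> * (\<kappa>\<^sup>2 / 4) ^ k"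
    proof -
      have "\<kappa> ^ (2*k+\<nu>) / 2 ^ (2*k+\<nu>) = (\<kappa> / 2) ^ (2*k+\<nu>)" by (rule power_divide[symmetric])
      also have "\<dots> = (\<kappa> / 2) ^ \<nu> * ((\<kappa> / 2)\<^sup>2) ^ k"
        unfolding power_add power_mult by (rule mult.commute)
      also have "(\<kappa> / 2)\<^sup>2 = \<kappa>\<^sup>2 / 4" by (simp add: power_divide)
      finally show ?thesis .
    qed
    ultimately show ?thesis by (simp flip: divide_divide_eq_left)
  qed
  thus ?thesis
    using suminf_mult[OF summable_loop_series[of \<kappa> N], of "(\<kappa> / 2) ^ \<nu>"]
    by (simp add: besselI_def loop_series_def \<nu>_def)
qed

lemma powr_half_of_nat: "a > 0 \<Longrightarrow> a powr (real d / 2) = sqrt a ^ d"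
proof -
  assume "a > 0"
  hence "sqrt a ^ d = (a powr (1/2)) powr real d" by (simp add: powr_half_sqrt powr_realpow)
  also have "\<dots> = a powr (real d / 2)" by (simp add: powr_powr)
  finally show ?thesis ..
qed

text \<open>With \<open>a = pi \<delta>\<close> and \<open>\<kappa> = 2 \<tau> a\<close>, the Bessel
  function supplies \<open>(\<tau> a)^(n + k1 - 1)\<close>. The two \<open>powr\<close> factors
  contain \<open>a\<close> to the powers \<open>n + k1 - 1 - d/2\<close> and \<open>d/2\<close>, so
  all dependence on \<open>a\<close> outside the series cancels.\<close>

lemma bessel_regime_prefactor:
  assumes N: "n + k1 \<ge> 1" and pos: "\<tau> > 0" "\<delta> > 0" and \<kappa>: "\<kappa> = 2 * pi * \<tau> * \<delta>"
  shows "(-1) ^ k2 * pi ^ (k1 + k2)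
           / (4 ^ n * (pi * \<delta>) powr (real (n + k1) - (real (Suc d) + 1) / 2) * \<kappa> powr ((real (Suc d) - 1) / 2))
           * E1 * E2 * besselI (n + k1 - 1) \<kappa>
       = profile d n k1 k2 \<tau> * E1 * E2 * loop_series (n + k1) \<kappa>"
proof -
  define a where "a = pi * \<delta>"
  have a: "a > 0" using pos by (simp add: a_def)
  have ka: "\<kappa> = 2 * \<tau> * a" by (simp add: \<kappa> a_def)
  have "real (n + k1) - (real (Suc d) + 1) / 2 = real (n + k1 - 1) - real d / 2"
    using N by (simp add: of_nat_diff field_simps)
  hence "a powr (real (n + k1) - (real (Suc d) + 1) / 2) = a ^ (n + k1 - 1) / sqrt a ^ d"
    using a by (simp only: powr_diff powr_half_of_nat powr_realpow)
  moreover have "\<kappa> powr ((real (Suc d) - 1) / 2) = sqrt (2 * \<tau>) ^ d * sqrt a ^ d"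
    using pos a unfolding ka by (simp add: powr_half_of_nat real_sqrt_mult power_mult_distrib)
  moreover have "sqrt a ^ d \<noteq> 0" using a by simp
  ultimately have D: "a powr (real (n + k1) - (real (Suc d) + 1) / 2) * \<kappa> powr ((real (Suc d) - 1) / 2) = a ^ (n + k1 - 1) * sqrt (2 * \<tau>) ^ d"
    by (simp only: times_divide_eq_left mult.assoc[symmetric]) simp
  have cancel: "c / (r * (A * S)) * (t * A) = c / r * (1 / S) * t" if "A \<noteq> 0" for c r A S t :: real
    using that by simp
  have "a ^ (n + k1 - 1) \<noteq> 0" using a by simp
  hence main: "(-1) ^ k2 * pi ^ (k1 + k2) / (4 ^ n * (a ^ (n + k1 - 1) * sqrt (2 * \<tau>) ^ d)) * (\<tau> ^ (n + k1 - 1) * a ^ (n + k1 - 1))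
      = profile d n k1 k2 \<tau>"
    unfolding profile_def power_one_over by (rule cancel)
  have bessel: "besselI (n + k1 - 1) \<kappa> = \<tau> ^ (n + k1 - 1) * a ^ (n + k1 - 1) * loop_series (n + k1) \<kappa>"
    unfolding besselI_eq_loop_series[OF N] by (simp add: ka power_mult_distrib)
  show ?thesis
    unfolding a_def[symmetric] mult.assoc[of "4 ^ n"] D bessel main[symmetric] by (simp only: mult_ac)
qed

lemma power_regime_prefactor:
  assumes N: "n + k1 \<ge> 1" and \<tau>: "\<tau> > 0"
  shows "(-1) ^ k2 * pi ^ (k1 + k2)
            / (2 powr (real (2 * n) + (real (Suc d) - 1) / 2) * fact (n + k1 - 1))
            * \<tau> powr (real (n + k1) - 1 - (real (Suc d) - 1) / 2) * E
       = profile d n k1 k2 \<tau> / fact (n + k1 - 1) * E"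
proof -
  have e: "real (n + k1) - 1 - (real (Suc d) - 1) / 2 = real (n + k1 - 1) - real d / 2"
    using N by (simp add: of_nat_diff)
  have t: "\<tau> powr (real (n + k1) - 1 - (real (Suc d) - 1) / 2) = \<tau> ^ (n + k1 - 1) / sqrt \<tau> ^ d"
    unfolding e using \<tau> by (simp only: powr_diff powr_half_of_nat powr_realpow)
  have "2 powr (real (2 * n) + (real (Suc d) - 1) / 2) = 2 powr real (2 * n) * 2 powr (real d / 2)"
    by (simp add: powr_add)
  also have "2 powr real (2 * n) = (2 :: real) ^ (2 * n)" by (rule powr_realpow) simp
  also have "\<dots> = 4 ^ n" by (simp add: power_mult)
  also have "2 powr (real d / 2) = sqrt 2 ^ d" by (simp add: powr_half_of_nat)
  finally show ?thesis
    unfolding t by (simp add: profile_def real_sqrt_mult power_mult_distrib power_divide)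
qed

text \<open>After normalisation each term is at most the corresponding term of
  \<open>exp (\<kappa>^2 / 4)\<close>, and the first equals one. Hence the normalised series is
  \<open>1 + O(\<kappa>^2)\<close> for small \<open>\<kappa>\<close>, and the factor
  \<open>exp (- \<kappa>)\<close> dominates the error.\<close>

lemma fact_loop_series_bounds:
  assumes "N \<ge> 1"
  shows "1 \<le> fact (N - 1) * loop_series N \<kappa>" "fact (N - 1) * loop_series N \<kappa> \<le> exp (\<kappa>\<^sup>2 / 4)"
proof -
  show "1 \<le> fact (N - 1) * loop_series N \<kappa>"
    using loop_series_ge[of N \<kappa>] by (simp add: field_simps)
  have e: "(\<lambda>k. (\<kappa>\<^sup>2 / 4) ^ k /\<^sub>R fact k) sums exp (\<kappa>\<^sup>2 / 4)" by (rule exp_converges)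
  have s: "(\<lambda>k. fact (N - 1) * ((\<kappa>\<^sup>2 / 4) ^ k / (fact k * fact (N - 1 + k)))) sums (fact (N - 1) * loop_series N \<kappa>)"
    unfolding loop_series_def by (intro sums_mult summable_sums summable_loop_series)
  show "fact (N - 1) * loop_series N \<kappa> \<le> exp (\<kappa>\<^sup>2 / 4)"
  proof (rule sums_le[OF _ s e])
    fix k
    have "fact (N - 1) \<le> (fact (N - 1 + k) :: real)" by (intro fact_mono) auto
    hence "fact (N - 1) / fact (N - 1 + k) \<le> (1 :: real)" by simp
    hence "(\<kappa>\<^sup>2 / 4) ^ k / fact k * (fact (N - 1) / fact (N - 1 + k)) \<le> (\<kappa>\<^sup>2 / 4) ^ k / fact k * 1"
      by (intro mult_left_mono) auto
    moreover have "fact (N - 1) * ((\<kappa>\<^sup>2 / 4) ^ k / (fact k * fact (N - 1 + k)))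
        = (\<kappa>\<^sup>2 / 4) ^ k / fact k * (fact (N - 1) / fact (N - 1 + k))" by simp
    moreover have "(\<kappa>\<^sup>2 / 4) ^ k / fact k * 1 = (\<kappa>\<^sup>2 / 4) ^ k /\<^sub>R fact k"
      by (simp only: real_scaleR_def divide_inverse mult.commute mult_1_right)
    ultimately show "fact (N - 1) * ((\<kappa>\<^sup>2 / 4) ^ k / (fact k * fact (N - 1 + k))) \<le> (\<kappa>\<^sup>2 / 4) ^ k /\<^sub>R fact k"
      by (simp only:)
  qed
qed

theorem theorem4p14:
  fixes n k1 k2 :: nat and C :: real
  assumes "n \<ge> 1" and "CARD('a::finite) = 2 * n" and "C > 1"
  shows
   "(\<exists>M \<epsilon>. \<epsilon> > 0 \<and> (\<forall>(x::real^'a) (t::real^'m::{finite,wellorder}).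
       0 < delta x t \<and> delta x t < \<epsilon> \<and> 1 / C \<le> kappa x t \<and> kappa x t \<le> C \<longrightarrow>
       (let m = real CARD('m);
            main = (-1) ^ k2 * pi ^ (k1 + k2)
                   / (4 ^ n * (pi * delta x t) powr (real (n + k1) - (m + 1) / 2)
                      * kappa x t powr ((m - 1) / 2))
                   * exp (- (dd x t ^ 2) / 4) * exp (- kappa x t)
                   * besselI (n + k1 - 1) (kappa x t)
        in cmod (pker n k1 k2 x t - of_real main) \<le> M * delta x t * \<bar>main\<bar>)))
    \<and>
    (\<exists>M \<epsilon> T. \<epsilon> > 0 \<and> (\<forall>(x::real^'a) (t::real^'m::{finite,wellorder}).
       0 < kappa x t \<and> kappa x t < \<epsilon> \<and> norm t > T \<longrightarrow>
       (let m = real CARD('m);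
            main = (-1) ^ k2 * pi ^ (k1 + k2)
                   / (2 powr (real (2 * n) + (m - 1) / 2) * fact (n + k1 - 1))
                   * norm t powr (real (n + k1) - 1 - (m - 1) / 2)
                   * exp (- (dd x t ^ 2) / 4)
        in cmod (pker n k1 k2 x t - of_real main) \<le> M * (kappa x t + 1 / norm t) * \<bar>main\<bar>)))"
    (is "(\<exists>M \<epsilon>. _ \<and> (\<forall>x t. _ \<longrightarrow> ?P x t M)) \<and> (\<exists>M \<epsilon> T. _ \<and> (\<forall>x t. _ \<longrightarrow> ?Q x t M))")
proof
  define d where "d = CARD('m) - 1"
  have m: "CARD('m) = Suc d" unfolding d_def by (simp add: card_gt_0_iff)
  have N: "n + k1 \<ge> 1" using assms(1) by simp
  show "\<exists>M \<epsilon>. \<epsilon> > 0 \<and> (\<forall>x t. 0 < delta x t \<and> delta x t < \<epsilon> \<and> 1 / C \<le> kappa x t \<and> kappa x t \<le> C \<longrightarrow> ?P x t M)"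
  proof -
    have "C \<ge> 0" using assms(3) by simp
    obtain M T where M: "M \<ge> 0" "T \<ge> 1" and est: "\<forall>(x::real^'a) (t::(real, 'm) vec). norm t \<ge> T \<longrightarrow> 0 < kappa x t \<longrightarrow> kappa x t \<le> C \<longrightarrow>
      cmod (pker n k1 k2 x t - of_real (leading_term d n k1 k2 x t)) \<le> M * (1 / norm t) * \<bar>leading_term d n k1 k2 x t\<bar>"
      using pker_estimate_dd[OF \<open>C \<ge> 0\<close> assms(1), of k1 k2, where 'm = 'm and 'a = 'a, folded d_def]
      by (elim exE conjE) (rule that)
    \<comment> \<open>From \<open>\<kappa> = 2 pi |t| \<delta> \<ge> 1 / C\<close> follows
      \<open>1 / |t| \<le> 2 pi C \<delta>\<close>. This converts the error and shows that the
      threshold on \<open>\<delta>\<close> forces \<open>|t| \<ge> T\<close>.\<close>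
    have main: "?P x t (M * (2 * pi * C))"
      if "0 < delta x t" "delta x t < 1 / (2 * pi * C * T)" "1 / C \<le> kappa x t" "kappa x t \<le> C"
      for x :: "real^'a" and t :: "(real, 'm) vec"
    proof -
      \<comment> \<open>Division by zero yields \<open>0\<close>, so \<open>t = 0\<close> would give
        \<open>delta x t = 0\<close>; positivity of \<open>delta x t\<close> excludes it along with
        \<open>x = 0\<close>.\<close>
      have R: "Rpar x > 0" "norm t > 0"
        using that(1) by (auto simp: delta_def Rpar_def zero_less_divide_iff mult_less_0_iff)
      have \<kappa>: "kappa x t = 2 * pi * norm t * delta x t"
      proof -
        have "sqrt (pi * norm t * Rpar x) = pi * norm t * sqrt (Rpar x / (pi * norm t))"
        proof (rule real_sqrt_unique)
          show "(pi * norm t * sqrt (Rpar x / (pi * norm t)))\<^sup>2 = pi * norm t * Rpar x"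
          proof -
            have "(sqrt (Rpar x / (pi * norm t)))\<^sup>2 = Rpar x / (pi * norm t)" using R by simp
            hence "(pi * norm t * sqrt (Rpar x / (pi * norm t)))\<^sup>2 = (pi * norm t)\<^sup>2 * (Rpar x / (pi * norm t))"
              by (simp only: power_mult_distrib)
            thus ?thesis using R by (simp add: power2_eq_square)
          qed
        qed (use R in simp)
        thus ?thesis by (simp add: kappa_def delta_def)
      qed
      have \<kappa>0: "kappa x t > 0" using R that(1) by (simp add: \<kappa>)
      have inv: "1 / norm t \<le> 2 * pi * C * delta x t"
      proof -
        have "1 \<le> C * kappa x t" using that(3) assms(3) by (simp add: field_simps)
        thus ?thesis using R by (simp add: \<kappa> field_simps)
      qed
      also have "\<dots> \<le> 1 / T" using that(2) M assms(3) by (simp add: field_simps)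
      finally have "T \<le> norm t" using R M by (simp add: field_simps)
      define main where "main = leading_term d n k1 k2 x t"
      have le: "cmod (pker n k1 k2 x t - of_real main) \<le> M * (1 / norm t) * \<bar>main\<bar>"
        using est[rule_format, OF \<open>T \<le> norm t\<close> \<kappa>0 that(4)] by (simp only: main_def)
      note le
      also have "M * (1 / norm t) * \<bar>main\<bar> \<le> M * (2 * pi * C * delta x t) * \<bar>main\<bar>"
        using inv M by (intro mult_right_mono mult_left_mono) auto
      finally show ?thesis
        unfolding Let_def m bessel_regime_prefactor[OF N R(2) that(1) \<kappa>] leading_term_def[symmetric] main_def[symmetric]
        by (simp only: mult.assoc)
    qed
    have eps: "1 / (2 * pi * C * T) > 0" using M assms(3) by simp
    show ?thesis
      by (rule exI[of _ "M * (2 * pi * C)"], rule exI[of _ "1 / (2 * pi * C * T)"], intro conjI allI impI)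
         (rule eps, elim conjE, rule main)
  qed
  show "\<exists>M \<epsilon> T. \<epsilon> > 0 \<and> (\<forall>x t. 0 < kappa x t \<and> kappa x t < \<epsilon> \<and> norm t > T \<longrightarrow> ?Q x t M)"
  proof -
    obtain M T where M: "M \<ge> 0" "T \<ge> 1" and est: "\<forall>(x::real^'a) (t::(real, 'm) vec). norm t \<ge> T \<longrightarrow> 0 < kappa x t \<longrightarrow> kappa x t \<le> 1 \<longrightarrow>
      cmod (pker n k1 k2 x t - of_real (leading_term d n k1 k2 x t)) \<le> M * (1 / norm t) * \<bar>leading_term d n k1 k2 x t\<bar>"
      using pker_estimate_dd[OF zero_le_one assms(1), of k1 k2, where 'm = 'm and 'a = 'a, folded d_def]
      by (elim exE conjE) (rule that)
    \<comment> \<open>\<open>M\<close> is the constant of the common estimate, and \<open>1\<close>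
      pays for replacing the factor \<open>c\<close> by one.\<close>
    have main: "?Q x t (max M 1)"
      if "0 < kappa x t" "kappa x t < 1" "norm t > T"
      for x :: "real^'a" and t :: "(real, 'm) vec"
    proof -
      define \<kappa> where "\<kappa> = kappa x t"
      define F where "F = (fact (n + k1 - 1) :: real)"
      \<comment> \<open>The quotient of the common leading term by the one stated for this regime.
        For \<open>\<kappa> < 1\<close> it lies between \<open>1 - \<kappa>\<close> and
        \<open>1\<close>, because \<open>\<kappa>^2 / 4 \<le> \<kappa>\<close>.\<close>
      define c where "c = F * loop_series (n + k1) \<kappa> * exp (- \<kappa>)"
      define main where "main = profile d n k1 k2 (norm t) / F * exp (- (dd x t ^ 2) / 4)"
      have t: "norm t > 0" using that M by linarith
      have \<kappa>: "0 < \<kappa>" "\<kappa> < 1" using that by (auto simp: \<kappa>_def)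
      have F: "F > 0" by (simp add: F_def)
      have c: "1 - \<kappa> \<le> c" "c \<le> 1"
      proof -
        have "1 - \<kappa> \<le> exp (- \<kappa>)" using exp_ge_add_one_self[of "- \<kappa>"] by simp
        also have "\<dots> = 1 * exp (- \<kappa>)" by simp
        also have "\<dots> \<le> c" unfolding c_def using fact_loop_series_bounds(1)[OF N] by (intro mult_right_mono) (auto simp: F_def)
        finally show "1 - \<kappa> \<le> c" .
        have "c \<le> exp (\<kappa>\<^sup>2 / 4) * exp (- \<kappa>)"
          unfolding c_def using fact_loop_series_bounds(2)[OF N] by (intro mult_right_mono) (auto simp: F_def)
        also have "\<dots> = exp (\<kappa>\<^sup>2 / 4 - \<kappa>)" by (simp flip: exp_add)
        also have "\<dots> \<le> 1"
        proof -
          have "\<kappa>\<^sup>2 \<le> \<kappa> * 4" unfolding power2_eq_square using \<kappa> by (intro mult_left_mono) auto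
          thus ?thesis by simp
        qed
        finally show "c \<le> 1" .
      qed
      have "leading_term d n k1 k2 x t = c * main"
        using F by (simp add: leading_term_def main_def c_def \<kappa>_def)
      hence le1: "cmod (pker n k1 k2 x t - of_real (c * main)) \<le> M * (1 / norm t) * \<bar>c * main\<bar>"
        using est[rule_format, of t x] that by simp
      also have "\<dots> \<le> max M 1 * (1 / norm t) * (1 * \<bar>main\<bar>)"
        unfolding abs_mult using c \<kappa> t M by (intro mult_mono) auto
      finally have le1: "cmod (pker n k1 k2 x t - of_real (c * main)) \<le> max M 1 * (1 / norm t) * \<bar>main\<bar>" by simp
      have "of_real (c * main) - of_real main = (of_real ((c - 1) * main) :: complex)" by (simp add: algebra_simps)
      hence "cmod (of_real (c * main) - of_real main) = \<bar>c - 1\<bar> * \<bar>main\<bar>"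
        by (simp only: norm_of_real abs_mult)
      also have "\<dots> \<le> (max M 1 * \<kappa>) * \<bar>main\<bar>"
      proof (rule mult_right_mono)
        have "\<bar>c - 1\<bar> \<le> 1 * \<kappa>" using c by simp
        also have "\<dots> \<le> max M 1 * \<kappa>" using \<kappa> by (intro mult_right_mono) auto
        finally show "\<bar>c - 1\<bar> \<le> max M 1 * \<kappa>" .
      qed simp
      finally have le2: "cmod (of_real (c * main) - of_real main) \<le> (max M 1 * \<kappa>) * \<bar>main\<bar>" .
      have "cmod (pker n k1 k2 x t - of_real main) \<le> max M 1 * (\<kappa> + 1 / norm t) * \<bar>main\<bar>"
        using norm_triangle_le[OF add_mono[OF le1 le2]] by (simp add: algebra_simps)
      thus ?thesis
        unfolding Let_def m power_regime_prefactor[OF N t] main_def F_def \<kappa>_def .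
    qed
    show ?thesis
      by (rule exI[of _ "max M 1"], rule exI[of _ 1], rule exI[of _ T], intro conjI allI impI)
         (rule zero_less_one, elim conjE, rule main)
  qed
qed

end
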